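(* Let $t$ be an interior point of $[0,M]$ at which $f_0$ has a continuous derivative, let $c>0$, and let $h=h_n\sim cn^{-1/5}$ as $n\to\infty$. Put $$\sigma^2=\frac{F_0(t)\{1-F_0(t)\}}{c\,g(t)}\int K(u)^2\,du .$$ Then, for almost every sequence $(T_1,\Delta_1),(T_2,\Delta_2),\dots$, the conditional distribution, given $(T_1,\Delta_1),\dots,(T_n,\Delta_n)$, of $$n^{2/5}\left\{\tilde F_{nh}^*(t)-\int \mathbb{K}_h(t-u)\,d\tilde F_{nh}(u)\right\}$$ converges weakly to the normal distribution $N(0,\sigma^2)$ as $n\to\infty$.
   Context: Current status model. $X_1,X_2,\dots$ are i.i.d. with distribution function $F_0$ whose distribution has support $[0,M]$ ($0<M<\infty$), with a density $f_0$ that is continuous on $[0,M]$ and stays away from zero on $[0,M]$. $T_1,T_2,\dots$ are i.i.d., independent of all the $X_j$, with distribution function $G$ having a Lebesgue density $g$ whose support contains $[0,M]$; $g$ stays away from zero on $[0,M]$ and has a bounded derivative $g'$. One observes $(T_i,\Delta_i)$, $i=1,\dots,n$, where $\Delta_i=1_{\{X_i\le T_i\}}$. Kernel. $K$ is a symmetric probability density with support $[-1,1]$, twice continuously differentiable on $\mathbb{R}$; $\mathbb{K}(u)=\int_{-\infty}^u K(x)\,dx$; for $h>0$, $K_h(u)=h^{-1}K(u/h)$ and $\mathbb{K}_h(u)=\mathbb{K}(u/h)$. MLE. $\hat F_n$ is the nonparametric maximum likelihood estimator, maximizing $\sum_{i=1}^n\{\Delta_i\log F(T_i)+(1-\Delta_i)\log(1-F(T_i))\}$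 over distribution functions $F$. Concretely (there are almost surely no ties), if $T_{(1)}<\dots<T_{(n)}$ are the order statistics and $\Delta_{(j)}$ is the indicator belonging to $T_{(j)}$, then $\hat F_n(T_{(i)})$ is the left-continuous slope at $i$ of the greatest convex minorant of the points $(0,0)$ and $(i,\sum_{j\le i}\Delta_{(j)})$, $i=1,\dots,n$; $\hat F_n$ is the right-continuous step function with these values, constant between successive order statistics and to the right of $T_{(n)}$, and equal to $0$ to the left of $T_{(1)}$. $d\hat F_n$ denotes the measure given by its jumps. SMLE. The smoothed maximum likelihood estimator is $\tilde F_{nh}(x)=\int \mathbb{K}_h(x-y)\,d\hat F_n(y)$, $x\in\mathbb{R}$. Smooth bootstrap. Given $(T_1,\Delta_1),\dots,(T_n,\Delta_n)$, the $T_i$ are kept fixed and $\Delta_1^*,\dots,\Delta_n^*$ are drawn independently, $\Delta_i^*$ being Bernoulli with success probability $\tilde F_{nh}(T_i)$. $\hat F_n^*$ is the MLE computed, in the same way as $\hat F_n$, from $(T_1,\Delta_1^* ),\dots,(T_n,\Delta_n^* )$, and $\tilde F_{nh}^*(x)=\int \mathbb{K}_h(x-y)\,d\hat F_n^*(y)$ is the bootstrap SMLE (same kernel and bandwidth). *)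

theory Defs
  imports "HOL-Probability.Probability" "HOL-Library.Landau_Symbols"
begin

text \<open>Samples are indexed from \<open>0\<close>: the first \<open>n\<close> observations are those with index in \<open>{..<n}\<close>.\<close>

definition measure_support :: "real measure \<Rightarrow> real set" where
  "measure_support N = {x. \<forall>e>0. emeasure N (ball x e) > 0}"

definition smoothing_kernel :: "(real \<Rightarrow> real) \<Rightarrow> bool" where
  "smoothing_kernel K \<longleftrightarrow>
     (\<forall>u. K u \<ge> 0) \<and> integral\<^sup>L lborel K = 1 \<and>
     (\<forall>u. K (- u) = K u) \<and>
     closure {u. K u \<noteq> 0} = {-1..1} \<and>
     (\<exists>K' K''. (\<forall>u. (K has_real_derivative K' u) (at u)) \<and>
               (\<forall>u. (K' has_real_derivative K'' u) (at u)) \<and>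
               continuous_on UNIV K'')"

definition integrated_kernel :: "(real \<Rightarrow> real) \<Rightarrow> real \<Rightarrow> real" where
  "integrated_kernel K u = (LINT x:{..u}|lborel. K x)"

text \<open>
  Smoothing of a right-continuous nondecreasing function \<open>F\<close>; \<open>interval_measure F\<close> is its
  Lebesgue-Stieltjes measure \<open>dF\<close>, whose total mass may be less than 1.
\<close>
definition kernel_smooth :: "(real \<Rightarrow> real) \<Rightarrow> real \<Rightarrow> (real \<Rightarrow> real) \<Rightarrow> real \<Rightarrow> real" where
  "kernel_smooth K h F x = (LINT y|interval_measure F. integrated_kernel K ((x - y) / h))"

text \<open>Greatest convex minorant, on \<open>[0, n]\<close>, of the points \<open>(i, S i)\<close>, \<open>i = 0, ..., n\<close>.\<close>
definition gcm :: "nat \<Rightarrow> (nat \<Rightarrow> real) \<Rightarrow> real \<Rightarrow> real" where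
  "gcm n S x = Sup {\<phi> x |\<phi>. convex_on {0..real n} \<phi> \<and> (\<forall>i\<le>n. \<phi> (real i) \<le> S i)}"

text \<open>
  \<open>sort_key T [0..<n] ! j\<close> is the index of the observation at the order statistic of rank \<open>j + 1\<close>,
  so this is the sum of the first \<open>i\<close> indicators in the order of the observation times.
\<close>
definition cusum :: "nat \<Rightarrow> (nat \<Rightarrow> real) \<Rightarrow> (nat \<Rightarrow> bool) \<Rightarrow> nat \<Rightarrow> real" where
  "cusum n T \<Delta> i = (\<Sum>j<i. of_bool (\<Delta> (sort_key T [0..<n] ! j)))"

text \<open>
  The nonparametric maximum likelihood estimator. For \<open>x\<close> between the order statistics of rank
  \<open>k\<close> (included) and \<open>k + 1\<close> (excluded), \<open>k\<close> is the number of observation times \<open>\<le> x\<close>.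
\<close>
definition mle :: "nat \<Rightarrow> (nat \<Rightarrow> real) \<Rightarrow> (nat \<Rightarrow> bool) \<Rightarrow> real \<Rightarrow> real" where
  "mle n T \<Delta> x =
     (let k = card {i. i < n \<and> T i \<le> x} in
      if k = 0 then 0
      else vector_derivative (gcm n (cusum n T \<Delta>)) (at_left (real k)))"

definition smle ::
  "(real \<Rightarrow> real) \<Rightarrow> real \<Rightarrow> nat \<Rightarrow> (nat \<Rightarrow> real) \<Rightarrow> (nat \<Rightarrow> bool) \<Rightarrow> real \<Rightarrow> real" where
  "smle K h n T \<Delta> = kernel_smooth K h (mle n T \<Delta>)"

text \<open>Conditional law of the bootstrap indicators given the data.\<close>
definition bootstrap_indicators ::
  "(real \<Rightarrow> real) \<Rightarrow> real \<Rightarrow> nat \<Rightarrow> (nat \<Rightarrow> real) \<Rightarrow> (nat \<Rightarrow> bool) \<Rightarrow> (nat \<Rightarrow> bool) pmf" where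
  "bootstrap_indicators K h n T \<Delta> =
     Pi_pmf {..<n} False (\<lambda>i. bernoulli_pmf (smle K h n T \<Delta> (T i)))"

text \<open>
  Conditional law, given the data, of the normalized difference at \<open>t\<close> between the bootstrap SMLE
  and the smoothed SMLE.
\<close>
definition bootstrap_law ::
  "(real \<Rightarrow> real) \<Rightarrow> real \<Rightarrow> real \<Rightarrow> nat \<Rightarrow> (nat \<Rightarrow> real) \<Rightarrow> (nat \<Rightarrow> bool) \<Rightarrow> real measure" where
  "bootstrap_law K h t n T \<Delta> =
     distr (measure_pmf (bootstrap_indicators K h n T \<Delta>)) borel
       (\<lambda>\<Delta>'. real n powr (2/5) * (smle K h n T \<Delta>' t - kernel_smooth K h (smle K h n T \<Delta>) t))"

end

theory Submission
  imports Defs "HOL-Real_Asymp.Real_Asymp"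
begin

text \<open>
  Write \<open>Q\<close> for the smoothed estimator that generates the bootstrap indicators \<open>\<Delta>'\<close>, \<open>F'\<close> for the
  bootstrap MLE, and \<open>\<phi> u = K ((t - u) / h) / (h * g u)\<close>. The difference of the smoothed estimators
  at \<open>t\<close> is \<open>\<integral> \<phi> (F' - Q) g\<close>. Up to \<open>o(n powr (-2/5))\<close> it equals \<open>(\<Sum>i<n. \<phi> (T i) * (F' - Q) (T i)) / n\<close>:
  the function \<open>\<phi> (F' - Q)\<close> has bounded variation on the window of width \<open>h\<close>, and there the empirical
  distribution of the times is within \<open>n powr (-9/20)\<close> of the true one. Summation by parts replaces
  \<open>F' (T i)\<close> by \<open>\<Delta>' i\<close>: the error involves only the height of the cumulative sum diagram over its
  greatest convex minorant, which is at most \<open>ln n\<close> times the square root of the length of a block of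
  the isotonic fit. What remains is a sum of independent small terms, to which Lindeberg's
  argument applies.

  All this is deterministic once every sum of noise over consecutive ranks \<open>a \<le> i < b\<close> is at most
  \<open>ln n * sqrt (b - a)\<close>, which Hoeffding's inequality guarantees. The min-max formula then yields the
  crude rate \<open>n powr (-1/4)\<close> for the isotonic fit near \<open>t\<close>, first for the original and then for the
  bootstrap sample; this suffices, since it makes the blocks much shorter than \<open>h\<close>.
\<close>

section \<open>Greatest convex minorants\<close>

text \<open>No rate is established for the derivative of the smoothed estimator \<open>Q\<close>, so
  block lengths of the bootstrap fit cannot be read off from \<open>Q\<close>. Both isotonic fits
  are therefore compared with \<open>F0\<close>, whose slope near \<open>t\<close> is bounded below:
  a uniform error of order \<open>n powr (-1/4)\<close> confines blocks to time spans of that order,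
  hence to about \<open>n powr (3/4)\<close> ranks. The error of the summation by parts is then of
  order \<open>ln n * n powr (3/8)\<close>; divided by \<open>n * h\<close> it is
  \<open>ln n * n powr (-17/40)\<close>, just below \<open>n powr (-2/5)\<close>. The sharp exponent
  -1/3 for the fits is not sought; the slack absorbs the logarithms. No bias term survives, because
  the centring smooths \<open>Q\<close> once more: the linear term has conditional mean exactly
  zero.\<close>

lemma convex_on_three_points:
  fixes f :: "real \<Rightarrow> real"
  assumes f: "convex_on A f" and "x \<in> A" "z \<in> A" and "x \<le> y" "y \<le> z"
  shows "(z - x) * f y \<le> (z - y) * f x + (y - x) * f z"
proof (cases "x = z")
  case False
  then have xz: "x < z" using assms by simp
  have A: "convex A" using f by (rule convex_on_imp_convex)
  then have "{x..z} \<subseteq> A" using assms closed_segment_subset[of x A z] xz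
    by (auto simp: closed_segment_eq_real_ivl)
  with f have "convex_on {x..z} f" by (rule convex_on_subset) simp
  from convex_onD_Icc'[OF this, of y] assms
  have "f y \<le> (f z - f x) / (z - x) * (y - x) + f x" by simp
  then have "(z - x) * f y \<le> (z - x) * ((f z - f x) / (z - x) * (y - x) + f x)"
    using xz by (intro mult_left_mono) auto
  also have "\<dots> = (f z - f x) * (y - x) + (z - x) * f x"
    using xz by (simp add: distrib_left)
  finally show ?thesis by (simp add: algebra_simps)
qed (use assms in auto)

context
  fixes n :: nat and S :: "nat \<Rightarrow> real"
begin

text \<open>The \<open>Sup\<close> in \<open>gcm\<close> is meaningful only for a set bounded above:
  a convex minorant stays below its chord over \<open>{0..n}\<close>, whose ends are controlled by
  \<open>S\<close>.\<close>

lemma minorant_bound: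
  assumes "convex_on {0..real n} \<phi>" "\<forall>i\<le>n. \<phi> (real i) \<le> S i" "x \<in> {0..real n}"
  shows "\<phi> x \<le> max (S 0) (S n)"
proof (cases "n = 0")
  case True then show ?thesis using assms by auto
next
  case False
  have "real n * \<phi> x \<le> (real n - x) * \<phi> 0 + x * \<phi> (real n)"
    using convex_on_three_points[OF assms(1), of 0 "real n" x] assms(3) by simp
  also have "\<dots> \<le> (real n - x) * max (S 0) (S n) + x * max (S 0) (S n)"
  proof -
    have "\<phi> 0 \<le> S 0" "\<phi> (real n) \<le> S n" using assms(2)[rule_format, of 0] assms(2)[rule_format, of n] by auto
    then show ?thesis using assms(3) by (intro add_mono mult_left_mono) auto
  qed
  also have "\<dots> = real n * max (S 0) (S n)" by (simp add: algebra_simps)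
  finally show ?thesis using False by simp
qed

lemma gcm_greatest:
  assumes "convex_on {0..real n} \<phi>" "\<And>i. i \<le> n \<Longrightarrow> \<phi> (real i) \<le> S i" "x \<in> {0..real n}"
  shows "\<phi> x \<le> gcm n S x"
  unfolding gcm_def
proof (rule cSup_upper)
  show "bdd_above {\<phi> x |\<phi>. convex_on {0..real n} \<phi> \<and> (\<forall>i\<le>n. \<phi> (real i) \<le> S i)}"
    using minorant_bound assms(3) by (intro bdd_aboveI[of _ "max (S 0) (S n)"]) blast
qed (use assms in blast)

lemma gcm_least:
  assumes "\<And>\<phi>. convex_on {0..real n} \<phi> \<Longrightarrow> (\<And>i. i \<le> n \<Longrightarrow> \<phi> (real i) \<le> S i) \<Longrightarrow> \<phi> x \<le> c"
  shows "gcm n S x \<le> c"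
  unfolding gcm_def
proof (rule cSup_least)
  \<comment> \<open>The constant minimum of the points is a convex minorant, so the set under
    \<open>Sup\<close> is nonempty.\<close>
  have "convex_on {0..real n} (\<lambda>_. Min (S ` {..n})) \<and> (\<forall>i\<le>n. Min (S ` {..n}) \<le> S i)"
    by (auto intro!: Min_le convex_onI simp: algebra_simps)
  then show "{\<phi> x |\<phi>. convex_on {0..real n} \<phi> \<and> (\<forall>i\<le>n. \<phi> (real i) \<le> S i)} \<noteq> {}" by blast
qed (use assms in blast)

lemma gcm_le: "i \<le> n \<Longrightarrow> gcm n S (real i) \<le> S i"
  by (intro gcm_least)

lemma convex_on_gcm: "convex_on {0..real n} (gcm n S)"
proof (rule convex_onI)
  fix t x y :: real
  assume *: "0 < t" "t < 1" "x \<in> {0..real n}" "y \<in> {0..real n}"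
  show "gcm n S ((1 - t) *\<^sub>R x + t *\<^sub>R y) \<le> (1 - t) * gcm n S x + t * gcm n S y"
  proof (rule gcm_least)
    fix \<phi> assume \<phi>: "convex_on {0..real n} \<phi>" "\<And>i. i \<le> n \<Longrightarrow> \<phi> (real i) \<le> S i"
    have "\<phi> ((1 - t) *\<^sub>R x + t *\<^sub>R y) \<le> (1 - t) * \<phi> x + t * \<phi> y"
      using convex_onD[OF \<phi>(1)] * by simp
    also have "\<dots> \<le> (1 - t) * gcm n S x + t * gcm n S y"
      using * by (intro add_mono mult_left_mono gcm_greatest \<phi>) auto
    finally show "\<phi> ((1 - t) *\<^sub>R x + t *\<^sub>R y) \<le> (1 - t) * gcm n S x + t * gcm n S y" .
  qed
qed simp

text \<open>From here on lines are the only test minorants needed: each lower bound for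
  \<open>gcm\<close> below comes from exhibiting an affine function under the points.\<close>

lemma gcm_ge_affine:
  assumes "\<And>i. i \<le> n \<Longrightarrow> \<alpha> + \<beta> * real i \<le> S i" "x \<in> {0..real n}"
  shows "\<alpha> + \<beta> * x \<le> gcm n S x"
proof (rule gcm_greatest)
  show "convex_on {0..real n} (\<lambda>x. \<alpha> + \<beta> * x)"
    by (rule convex_onI) (auto simp: algebra_simps)
qed (use assms in auto)

lemma gcm_discrete_convex:
  assumes "i \<le> j" "j \<le> k" "k \<le> n"
  shows "(real k - real i) * gcm n S (real j)
         \<le> (real k - real j) * gcm n S (real i) + (real j - real i) * gcm n S (real k)"
  using convex_on_three_points[OF convex_on_gcm, of "real i" "real k" "real j"] assms by auto

text \<open>A convex function lies above the extension of a chord outside the chord's interval. For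
  neighbouring \<open>i\<close> and \<open>k\<close> the extended chord is thus a minorant of all
  the points; for \<open>k = i + 2\<close> only the middle point can fail.\<close>

lemma gcm_chord_le:
  assumes "i < k" "k \<le> n" "j \<le> n" "j \<le> i \<or> k \<le> j"
  defines "\<beta> \<equiv> (gcm n S (real k) - gcm n S (real i)) / (real k - real i)"
  shows "gcm n S (real i) + \<beta> * (real j - real i) \<le> S j"
proof -
  have \<beta>: "gcm n S (real k) = gcm n S (real i) + \<beta> * (real k - real i)"
    using assms by (simp add: \<beta>_def)
  have "gcm n S (real i) + \<beta> * (real j - real i) \<le> gcm n S (real j)"
    using assms(4)
  proof
    assume "j \<le> i"
    with gcm_discrete_convex[of j i k] assms(1,2)
    have "(real k - real i) * (gcm n S (real i) + \<beta> * (real j - real i)) \<le> (real k - real i) * gcm n S (real j)"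
      unfolding \<beta> by (simp add: algebra_simps)
    then show ?thesis using assms(1) by simp
  next
    assume "k \<le> j"
    with gcm_discrete_convex[of i k j] assms(1,3)
    have "(real k - real i) * (gcm n S (real i) + \<beta> * (real j - real i)) \<le> (real k - real i) * gcm n S (real j)"
      unfolding \<beta> by (simp add: algebra_simps)
    then show ?thesis using assms(1) by simp
  qed
  also have "\<dots> \<le> S j" using assms by (intro gcm_le)
  finally show ?thesis .
qed

text \<open>Convexity gives the upper bound. For the lower one, no integer lies strictly between
  \<open>i - 1\<close> and \<open>i\<close>, so the extended chord is an affine minorant.\<close>

lemma gcm_linear:
  assumes "0 < i" "i \<le> n" "x \<in> {real i - 1..real i}"
  shows "gcm n S x = gcm n S (real i - 1) + (x - (real i - 1)) * (gcm n S (real i) - gcm n S (real i - 1))"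
    (is "_ = ?\<alpha> + _ * ?\<beta>")
proof (rule antisym)
  have i: "real (i - 1) = real i - 1" using assms by simp
  show "gcm n S x \<le> ?\<alpha> + (x - (real i - 1)) * ?\<beta>"
    using convex_on_three_points[OF convex_on_gcm, of "real i - 1" "real i" x] assms
    by (simp add: algebra_simps)
  have "(?\<alpha> - (real i - 1) * ?\<beta>) + ?\<beta> * x \<le> gcm n S x"
  proof (rule gcm_ge_affine)
    fix j assume "j \<le> n"
    then have "gcm n S (real (i - 1)) + (gcm n S (real i) - gcm n S (real (i - 1))) / (real i - real (i - 1))
        * (real j - real (i - 1)) \<le> S j"
      using assms by (intro gcm_chord_le) auto
    then show "(?\<alpha> - (real i - 1) * ?\<beta>) + ?\<beta> * real j \<le> S j"
      unfolding i by (simp add: algebra_simps)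
  next
    have "0 \<le> real i - 1" "real i \<le> real n" using assms by auto
    then show "x \<in> {0..real n}" using assms(3) by auto
  qed
  then show "?\<alpha> + (x - (real i - 1)) * ?\<beta> \<le> gcm n S x" by (simp add: algebra_simps)
qed

lemma gcm_left_derivative:
  assumes "0 < i" "i \<le> n"
  shows "vector_derivative (gcm n S) (at_left (real i)) = gcm n S (real i) - gcm n S (real i - 1)"
    (is "_ = ?\<beta>")
proof (rule vector_derivative_within)
  have "(gcm n S has_vector_derivative ?\<beta>) (at (real i) within {..real i})"
  proof (rule has_vector_derivative_transform_within[where d = 1])
    show "((\<lambda>x. gcm n S (real i - 1) + (x - (real i - 1)) * ?\<beta>) has_vector_derivative ?\<beta>)
        (at (real i) within {..real i})"
      by (auto intro!: derivative_eq_intros)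
    show "gcm n S (real i - 1) + (x - (real i - 1)) * ?\<beta> = gcm n S x"
      if "x \<in> {..real i}" "dist x (real i) < 1" for x
      using that gcm_linear[of i x] assms by (auto simp: dist_real_def)
  qed auto
  then show "(gcm n S has_vector_derivative ?\<beta>) (at_left (real i))"
    by (rule has_vector_derivative_within_subset) auto
qed (simp add: trivial_limit_at_left_real)

lemma gcm_0: "gcm n S 0 = S 0"
proof (rule antisym)
  show "gcm n S 0 \<le> S 0" using gcm_le[of 0] by simp
  \<comment> \<open>The smallest slope from the first point to another one. The index 0 contributes
    \<open>0 / 0 = 0\<close>, which can only lower the minimum.\<close>
  define \<beta> where "\<beta> = Min ((\<lambda>i. (S i - S 0) / real i) ` {..n})"
  have "S 0 + \<beta> * 0 \<le> gcm n S 0"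
  proof (rule gcm_ge_affine)
    fix i assume i: "i \<le> n"
    then have "\<beta> \<le> (S i - S 0) / real i" unfolding \<beta>_def by (intro Min_le) auto
    then show "S 0 + \<beta> * real i \<le> S i" by (cases "i = 0") (auto simp: field_simps)
  qed auto
  then show "S 0 \<le> gcm n S 0" by simp
qed

lemma gcm_n: "gcm n S (real n) = S n"
proof (rule antisym)
  show "gcm n S (real n) \<le> S n" using gcm_le[of n] by simp
  \<comment> \<open>Here the index \<open>n\<close> contributes \<open>0 / 0 = 0\<close>, which can
    only raise the maximum.\<close>
  define \<beta> where "\<beta> = Max ((\<lambda>i. (S n - S i) / (real n - real i)) ` {..n})"
  have "(S n - \<beta> * real n) + \<beta> * real n \<le> gcm n S (real n)"
  proof (rule gcm_ge_affine)
    fix i assume i: "i \<le> n"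
    then have "\<beta> \<ge> (S n - S i) / (real n - real i)" unfolding \<beta>_def by (intro Max_ge) auto
    then show "S n - \<beta> * real n + \<beta> * real i \<le> S i"
      using i by (cases "i = n") (auto simp: field_simps)
  qed auto
  then show "S n \<le> gcm n S (real n)" by simp
qed

text \<open>Complementary slackness: there is no kink where the minorant lies strictly below the
  points. Otherwise the chord across \<open>k\<close>, lowered no further than to height
  \<open>S k\<close>, would be an affine minorant exceeding \<open>gcm\<close> at
  \<open>k\<close>.\<close>

lemma gcm_slack:
  assumes "0 < k" "k < n" "gcm n S (real k) < S k"
  shows "gcm n S (real k + 1) - gcm n S (real k) = gcm n S (real k) - gcm n S (real k - 1)"
proof (rule ccontr)
  have k: "real (k - 1) = real k - 1" "real (Suc k) = real k + 1" using assms by auto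
  assume "\<not> ?thesis"
  define \<beta> where "\<beta> = (gcm n S (real k + 1) - gcm n S (real k - 1)) / 2"
  have "2 * gcm n S (real k) \<le> gcm n S (real k - 1) + gcm n S (real k + 1)"
    using gcm_discrete_convex[of "k - 1" k "Suc k"] assms by (simp add: k add.commute)
  with \<open>\<not> ?thesis\<close> have less: "gcm n S (real k) < gcm n S (real k - 1) + \<beta>"
    unfolding \<beta>_def by (simp add: field_simps)
  \<comment> \<open>The drop that brings the chord below \<open>S k\<close>. If it is positive, the
    lowered line has height exactly \<open>S k\<close> at \<open>k\<close>, still above the
    minorant.\<close>
  define d where "d = max 0 (gcm n S (real k - 1) + \<beta> - S k)"
  have "(gcm n S (real k - 1) - \<beta> * (real k - 1) - d) + \<beta> * real k \<le> gcm n S (real k)"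
  proof (rule gcm_ge_affine)
    fix j assume j: "j \<le> n"
    show "(gcm n S (real k - 1) - \<beta> * (real k - 1) - d) + \<beta> * real j \<le> S j"
    proof (cases "j = k")
      case True then show ?thesis by (simp add: d_def algebra_simps)
    next
      case False
      have "gcm n S (real (k - 1)) + (gcm n S (real (Suc k)) - gcm n S (real (k - 1))) / (real (Suc k) - real (k - 1))
           * (real j - real (k - 1)) \<le> S j"
        using False j assms by (intro gcm_chord_le) auto
      then have "gcm n S (real k - 1) + \<beta> * (real j - (real k - 1)) \<le> S j"
        unfolding k \<beta>_def by (simp add: algebra_simps)
      moreover have "0 \<le> d" by (simp add: d_def)
      ultimately show ?thesis by (simp add: algebra_simps)
    qed
  qed (use assms in auto)
  then have "gcm n S (real k - 1) + \<beta> - d \<le> gcm n S (real k)" by (simp add: algebra_simps)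
  then show False using less assms(3) by (auto simp: d_def max_def split: if_splits)
qed

end

section \<open>Isotonic fits and order statistics\<close>

text \<open>Here \<open>C\<close> is a greatest convex minorant at the integers, described by its
  end values, convexity and complementary slackness; \<open>y\<close> are the responses in sorted
  order and \<open>p\<close> their nondecreasing means. All arguments about blocks need no more than
  this and are deterministic.\<close>

locale isotonic_fit =
  fixes n :: nat and y p :: "nat \<Rightarrow> real" and C :: "nat \<Rightarrow> real" and L :: real
  assumes C_0: "C 0 = 0" and C_n: "C n = (\<Sum>j<n. y j)"
    and C_le: "i \<le> n \<Longrightarrow> C i \<le> (\<Sum>j<i. y j)"
    and C_convex: "Suc k < n \<Longrightarrow> C (Suc k) - C k \<le> C (Suc (Suc k)) - C (Suc k)"
    and C_slack: "Suc k < n \<Longrightarrow> C (Suc k) < (\<Sum>j<Suc k. y j) \<Longrightarrow> C (Suc (Suc k)) - C (Suc k) = C (Suc k) - C k"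
    and p_mono: "i \<le> j \<Longrightarrow> j < n \<Longrightarrow> p i \<le> p j"
    and deviation: "a < b \<Longrightarrow> b \<le> n \<Longrightarrow> \<bar>\<Sum>j=a..<b. y j - p j\<bar> \<le> L * sqrt (real b - real a)"
begin

definition S :: "nat \<Rightarrow> real" where "S k = (\<Sum>j<k. y j)"
definition slope :: "nat \<Rightarrow> real" where "slope j = C (Suc j) - C j"

lemma slope_mono: "i \<le> j \<Longrightarrow> j < n \<Longrightarrow> slope i \<le> slope j"
  by (induction j rule: dec_induct) (use C_convex in \<open>force simp: slope_def\<close>)+

lemma sum_slope: "a \<le> b \<Longrightarrow> (\<Sum>j=a..<b. slope j) = C b - C a"
  unfolding slope_def by (rule sum_Suc_diff')

lemma S_diff: "a \<le> b \<Longrightarrow> S b - S a = (\<Sum>j=a..<b. y j)"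
  unfolding S_def by (simp add: lessThan_atLeast0 sum_diff_nat_ivl)

lemma S_diff_bounds:
  assumes "a < b" "b \<le> n"
  shows "S b - S a \<le> (\<Sum>j=a..<b. p j) + L * sqrt (real b - real a)"
    and "S b - S a \<ge> (\<Sum>j=a..<b. p j) - L * sqrt (real b - real a)"
  using deviation[OF assms] assms by (auto simp: S_diff sum_subtractf)

text \<open>Going left, slackness lets the slope change only where \<open>C\<close> touches the
  partial sums; \<open>C_0\<close> supplies a touching point in the worst case.\<close>

lemma slope_const_left:
  assumes "k < n"
  obtains a where "a \<le> k" "C a = S a" "\<And>j. a \<le> j \<Longrightarrow> j \<le> k \<Longrightarrow> slope j = slope k"
proof -
  have "\<exists>a\<le>k. C a = S a \<and> (\<forall>j. a \<le> j \<longrightarrow> j \<le> k \<longrightarrow> slope j = slope k)"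
    using assms
  proof (induction k)
    case 0 then show ?case using C_0 by (auto simp: S_def)
  next
    case (Suc k)
    show ?case
    proof (cases "C (Suc k) = S (Suc k)")
      case True then show ?thesis by (intro exI[of _ "Suc k"]) (auto dest: le_antisym)
    next
      case False
      then have "C (Suc k) < S (Suc k)" using C_le[of "Suc k"] Suc.prems by (auto simp: S_def)
      then have "slope (Suc k) = slope k" using C_slack[of k] Suc.prems by (auto simp: slope_def S_def)
      then show ?thesis using Suc by (metis Suc_lessD le_Suc_eq)
    qed
  qed
  then show ?thesis using that by blast
qed

text \<open>The mirror image, with \<open>C_n\<close> supplying the last touching point; the
  induction is on the distance to \<open>n\<close>.\<close>

lemma slope_const_right:
  assumes "k < n"
  obtains b where "k < b" "b \<le> n" "C b = S b" "\<And>j. k \<le> j \<Longrightarrow> j < b \<Longrightarrow> slope j = slope k"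
proof -
  have "\<exists>b. k < b \<and> b \<le> n \<and> C b = S b \<and> (\<forall>j. k \<le> j \<longrightarrow> j < b \<longrightarrow> slope j = slope k)"
    using assms
  proof (induction "n - k" arbitrary: k)
    case 0 then show ?case by simp
  next
    case (Suc m)
    show ?case
    proof (cases "C (Suc k) = S (Suc k)")
      case True
      then show ?thesis using Suc.prems by (intro exI[of _ "Suc k"]) (auto simp: less_Suc_eq dest: le_antisym)
    next
      case False
      then have k: "Suc k < n" using Suc.prems C_n by (metis S_def Suc_lessI)
      then have "C (Suc k) < S (Suc k)" using C_le[of "Suc k"] False by (auto simp: S_def)
      then have eq: "slope (Suc k) = slope k" using C_slack[of k] k by (auto simp: slope_def S_def)
      have "m = n - Suc k" using Suc.hyps(2) by simp
      from Suc.hyps(1)[OF this k] obtain b where "Suc k < b" "b \<le> n" "C b = S b"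
        "\<forall>j. Suc k \<le> j \<longrightarrow> j < b \<longrightarrow> slope j = slope (Suc k)" by blast
      moreover from this(4) have "\<forall>j. k \<le> j \<longrightarrow> j < b \<longrightarrow> slope j = slope k"
        using eq by (metis Suc_leI le_neq_implies_less)
      ultimately show ?thesis by (meson Suc_lessD)
    qed
  qed
  then show ?thesis using that by blast
qed

text \<open>Half of the min-max formula: average from the left end of the block of \<open>k\<close> up to \<open>k + m\<close>.\<close>
lemma slope_upper:
  assumes "0 < m" "k + m < n" and L: "0 \<le> L"
  shows "slope k \<le> p (k + m) + L / sqrt (real m)"
proof -
  obtain a where a: "a \<le> k" "C a = S a" "\<And>j. a \<le> j \<Longrightarrow> j \<le> k \<Longrightarrow> slope j = slope k"
    using slope_const_left assms by (metis add_lessD1)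
  define d where "d = real (Suc (k + m)) - real a"
  have d: "real m \<le> d" "0 < d" using a(1,2) assms by (auto simp: d_def)
  have "slope k \<le> slope j" if "a \<le> j" "j < Suc (k + m)" for j
  proof (cases "j \<le> k")
    case True then show ?thesis using a(3)[of j] that by linarith
  next
    case False then show ?thesis using slope_mono[of k j] that assms by simp
  qed
  then have "(\<Sum>j=a..<Suc (k + m). slope k) \<le> (\<Sum>j=a..<Suc (k + m). slope j)"
    by (intro sum_mono) auto
  moreover have "(\<Sum>j=a..<Suc (k + m). slope k) = d * slope k"
    using a(1) by (simp add: d_def of_nat_diff)
  ultimately have "d * slope k \<le> (\<Sum>j=a..<Suc (k + m). slope j)" by linarith
  also have "\<dots> = C (Suc (k + m)) - C a" using a(1,2) by (intro sum_slope) auto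
  also have "\<dots> \<le> S (Suc (k + m)) - S a" using a(1,2) C_le[of "Suc (k + m)"] assms by (auto simp: S_def)
  also have "\<dots> \<le> (\<Sum>j=a..<Suc (k + m). p j) + L * sqrt d"
    unfolding d_def using a(1,2) assms by (intro S_diff_bounds) auto
  also have "(\<Sum>j=a..<Suc (k + m). p j) \<le> (\<Sum>j=a..<Suc (k + m). p (k + m))"
    using assms by (intro sum_mono p_mono) auto
  also have "\<dots> = d * p (k + m)" using a(1,2) by (simp add: d_def of_nat_diff)
  finally have "d * (slope k - p (k + m)) \<le> L * sqrt d" by (simp add: algebra_simps)
  then have "slope k - p (k + m) \<le> L * sqrt d / d" using d by (simp add: field_simps)
  also have "\<dots> = L / sqrt d" using d by (metis divide_divide_eq_right real_div_sqrt less_imp_le)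
  also have "\<dots> \<le> L / sqrt (real m)" using d L assms by (intro divide_left_mono) auto
  finally show ?thesis by simp
qed

text \<open>The other half of the min-max formula: the average runs from the \<open>m\<close>-th
  last index up to \<open>k\<close> to the right end of the block of \<open>k\<close>. On this range
  \<open>p\<close> is at least its value at the left end, and there are at least \<open>m\<close>
  summands to average the noise.\<close>

lemma slope_lower:
  assumes "0 < m" "m \<le> Suc k" "k < n" and L: "0 \<le> L"
  shows "slope k \<ge> p (Suc k - m) - L / sqrt (real m)"
proof -
  obtain b where b: "k < b" "b \<le> n" "C b = S b" "\<And>j. k \<le> j \<Longrightarrow> j < b \<Longrightarrow> slope j = slope k"
    using slope_const_right assms by metis
  define a where "a = Suc k - m"
  define d where "d = real b - real a"
  have d: "real m \<le> d" "0 < d" "a < b" "a \<le> k" using b(1,2,3) assms by (auto simp: d_def a_def of_nat_diff)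
  have "slope j \<le> slope k" if "a \<le> j" "j < b" for j
  proof (cases "k \<le> j")
    case True then show ?thesis using b(4)[of j] that by linarith
  next
    case False then show ?thesis using slope_mono[of j k] that assms by simp
  qed
  then have "(\<Sum>j=a..<b. slope j) \<le> (\<Sum>j=a..<b. slope k)"
    by (intro sum_mono) auto
  moreover have "(\<Sum>j=a..<b. slope k) = d * slope k" using d by (simp add: d_def of_nat_diff)
  moreover have "(\<Sum>j=a..<b. slope j) = C b - C a" using d by (intro sum_slope) auto
  \<comment> \<open>Equality at the touching point \<open>b\<close> and \<open>C a \<le> S a\<close>
    fix the direction of this comparison.\<close>
  moreover have "S b - S a \<le> C b - C a" using b(1,2,3) C_le[of a] assms d by (auto simp: S_def)
  moreover have "(\<Sum>j=a..<b. p j) - L * sqrt d \<le> S b - S a"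
    unfolding d_def using b(1,2,3) d by (intro S_diff_bounds) auto
  moreover have "(\<Sum>j=a..<b. p a) \<le> (\<Sum>j=a..<b. p j)"
    using b(1,2,3) by (intro sum_mono p_mono) auto
  moreover have "(\<Sum>j=a..<b. p a) = d * p a" using d by (simp add: d_def of_nat_diff)
  ultimately have "d * p a \<le> L * sqrt d + d * slope k" by linarith
  then have "d * (p a - slope k) \<le> L * sqrt d" by (simp add: algebra_simps)
  then have "p a - slope k \<le> L * sqrt d / d" using d by (simp add: field_simps)
  also have "\<dots> = L / sqrt d" using d by (metis divide_divide_eq_right real_div_sqrt less_imp_le)
  also have "\<dots> \<le> L / sqrt (real m)" using d L assms by (intro divide_left_mono) auto
  finally show ?thesis by (simp add: a_def)
qed

text \<open>
  As \<open>p\<close> is nondecreasing its partial sums are convex, so only the noise lifts the partial sums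
  of \<open>y\<close> above their chord over a block.
\<close>
lemma excess_le:
  assumes ab: "a \<le> k" "k \<le> b" "b \<le> n" "C a = S a" "C b = S b" and L: "0 \<le> L"
    and const: "\<And>j. a \<le> j \<Longrightarrow> j < b \<Longrightarrow> slope j = \<sigma>"
  shows "S k - C k \<le> L * sqrt (real b - real a)"
proof (cases "k = a \<or> k = b")
  case False
  then have k: "a < k" "k < b" using ab by auto
  define u v where "u = real k - real a" and "v = real b - real k"
  have uv: "0 < u" "0 < v" using k by (auto simp: u_def v_def)
  have block: "C j - C i = (real j - real i) * \<sigma>" if "a \<le> i" "i \<le> j" "j \<le> b" for i j
  proof -
    have "C j - C i = (\<Sum>i=i..<j. slope i)" using that by (simp add: sum_slope)
    also have "\<dots> = (\<Sum>i=i..<j. \<sigma>)" using that by (intro sum.cong const) auto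
    finally show ?thesis using that by (simp add: of_nat_diff)
  qed
  have Ck: "C k - C a = u * \<sigma>" and Cb: "C b - C k = v * \<sigma>"
    using block[of a k] block[of k b] k by (auto simp: u_def v_def)
  have "S k - S a \<le> u * p k + L * sqrt u"
  proof -
    have "S k - S a \<le> (\<Sum>j=a..<k. p j) + L * sqrt u"
      unfolding u_def using k ab by (intro S_diff_bounds) auto
    moreover have "(\<Sum>j=a..<k. p j) \<le> (\<Sum>j=a..<k. p k)" using k ab by (intro sum_mono p_mono) auto
    ultimately show ?thesis using k by (simp add: u_def of_nat_diff)
  qed
  moreover have "S b - S k \<ge> v * p k - L * sqrt v"
  proof -
    have "S b - S k \<ge> (\<Sum>j=k..<b. p j) - L * sqrt v"
      unfolding v_def using k ab by (intro S_diff_bounds) auto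
    moreover have "(\<Sum>j=k..<b. p k) \<le> (\<Sum>j=k..<b. p j)" using k ab by (intro sum_mono p_mono) auto
    ultimately show ?thesis using k by (simp add: v_def of_nat_diff)
  qed
  ultimately have "v * (S k - S a) \<le> v * (u * p k + L * sqrt u)" "u * (v * p k - L * sqrt v) \<le> u * (S b - S k)"
    using uv by (intro mult_left_mono; simp)+
  then have 1: "v * (S k - S a) - u * (S b - S k) \<le> v * (u * p k + L * sqrt u) - u * (v * p k - L * sqrt v)"
    by linarith
  \<comment> \<open>The weights \<open>v\<close> and \<open>u\<close> measure the height of the
    partial sums over their chord at \<open>k\<close>; with them the two occurrences of
    \<open>p k\<close> in the previous bound cancel.\<close>
  have "(u + v) * (S k - C k) = v * (S k - S a) - u * (S b - S k)"
  proof -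
    have "S b - S a = (u + v) * \<sigma>" using Ck Cb ab by (simp add: algebra_simps)
    then show ?thesis using Ck ab by (simp add: algebra_simps)
  qed
  also have "\<dots> \<le> v * (L * sqrt u) + u * (L * sqrt v)" using 1 by (simp add: algebra_simps)
  also have "\<dots> \<le> v * (L * sqrt (u + v)) + u * (L * sqrt (u + v))"
    using uv L by (intro add_mono mult_left_mono) auto
  finally have "(u + v) * (S k - C k) \<le> (u + v) * (L * sqrt (u + v))" by (simp add: algebra_simps)
  then show ?thesis using uv by (simp add: u_def v_def)
qed (use ab L in auto)

end

section \<open>Ranks of distinct observation times\<close>

lemma downward_closed_nat:
  assumes "finite (D :: nat set)" "\<And>i j. j \<in> D \<Longrightarrow> i \<le> j \<Longrightarrow> i \<in> D"
  shows "D = {..<card D}"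
proof (cases "D = {}")
  case False
  have "D = {..Max D}" using assms False by (auto intro: Max_ge assms(2)[OF Max_in])
  then show ?thesis by (metis card_atMost lessThan_Suc_atMost)
qed simp

definition count_le :: "nat \<Rightarrow> (nat \<Rightarrow> real) \<Rightarrow> real \<Rightarrow> nat" where
  "count_le n T x = card {i. i < n \<and> T i \<le> x}"

text \<open>
  For distinct times this is the position in the sorted order, written without \<open>sort_key\<close> so that
  it is visibly measurable in \<open>T\<close>.
\<close>
definition time_rank :: "nat \<Rightarrow> (nat \<Rightarrow> real) \<Rightarrow> nat \<Rightarrow> nat" where
  "time_rank n T k = card {i. i < n \<and> T i < T k}"

text \<open>The sums run over original indices selected by rank: for fixed times they are sums of
  independent variables over fixed index sets, and the predicate is measurable jointly in times and
  noise.\<close>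

definition rank_deviation_le :: "nat \<Rightarrow> (nat \<Rightarrow> real) \<Rightarrow> (nat \<Rightarrow> real) \<Rightarrow> real \<Rightarrow> bool" where
  "rank_deviation_le n T \<epsilon> L \<longleftrightarrow>
     (\<forall>b\<le>n. \<forall>a<b. \<bar>\<Sum>k | k < n \<and> a \<le> time_rank n T k \<and> time_rank n T k < b. \<epsilon> k\<bar> \<le> L * sqrt (real b - real a))"

lemma count_le_mono: "x \<le> x' \<Longrightarrow> count_le n T x \<le> count_le n T x'"
  unfolding count_le_def by (intro card_mono) auto

lemma count_le_le: "count_le n T x \<le> n"
  unfolding count_le_def using card_mono[of "{..<n}" "{i. i < n \<and> T i \<le> x}"] by auto

locale distinct_times =
  fixes n :: nat and T :: "nat \<Rightarrow> real"
  assumes inj: "inj_on T {..<n}"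
begin

definition ix :: "nat \<Rightarrow> nat" where "ix j = sort_key T [0..<n] ! j"

lemma ix_less: "j < n \<Longrightarrow> ix j < n"
  unfolding ix_def using nth_mem[of j "sort_key T [0..<n]"] by simp

lemma bij_ix: "bij_betw ix {..<n} {..<n}"
  unfolding ix_def by (rule bij_betw_nth) (auto simp: atLeast0LessThan)

lemma T_ix_strict: "i < j \<Longrightarrow> j < n \<Longrightarrow> T (ix i) < T (ix j)"
proof -
  assume ij: "i < j" "j < n"
  have "sorted (map T (sort_key T [0..<n]))" by simp
  then have "T (ix i) \<le> T (ix j)"
    using sorted_nth_mono[of "map T (sort_key T [0..<n])" i j] ij by (simp add: ix_def)
  moreover have "ix i \<noteq> ix j" using bij_ix ij by (auto simp: bij_betw_def inj_on_def)
  then have "T (ix i) \<noteq> T (ix j)" using inj ix_less[of i] ix_less[of j] ij by (auto simp: inj_on_def)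
  ultimately show ?thesis by simp
qed

lemma T_ix_less_iff: "i < n \<Longrightarrow> j < n \<Longrightarrow> T (ix i) < T (ix j) \<longleftrightarrow> i < j"
  using T_ix_strict by (metis linorder_neqE_nat order_less_asym order_less_irrefl)

lemma sum_ix: "(\<Sum>j<n. f (ix j)) = (\<Sum>k<n. f k)"
  using sum.reindex_bij_betw[OF bij_ix] by simp

lemma rank_ix: "j < n \<Longrightarrow> time_rank n T (ix j) = j"
proof -
  assume j: "j < n"
  have "{i. i < n \<and> T i < T (ix j)} = ix ` {..<j}"
  proof (intro equalityI subsetI)
    fix i assume i: "i \<in> {i. i < n \<and> T i < T (ix j)}"
    then obtain i' where "i' < n" "i = ix i'" using bij_ix by (auto simp: bij_betw_def)
    then show "i \<in> ix ` {..<j}" using i j T_ix_less_iff by auto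
  qed (use j T_ix_less_iff ix_less in auto)
  moreover have "inj_on ix {..<j}" using bij_ix j by (auto simp: bij_betw_def intro: inj_on_subset)
  ultimately show ?thesis by (simp add: time_rank_def card_image)
qed

lemma rank_sum: "b \<le> n \<Longrightarrow> (\<Sum>k | k < n \<and> a \<le> time_rank n T k \<and> time_rank n T k < b. f k) = (\<Sum>j=a..<b. f (ix j))"
proof -
  assume b: "b \<le> n"
  have "(\<Sum>k | k < n \<and> a \<le> time_rank n T k \<and> time_rank n T k < b. f k)
      = (\<Sum>k<n. if a \<le> time_rank n T k \<and> time_rank n T k < b then f k else 0)"
    by (subst sum.inter_filter[symmetric]) auto
  also have "\<dots> = (\<Sum>j<n. if a \<le> time_rank n T (ix j) \<and> time_rank n T (ix j) < b then f (ix j) else 0)"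
    by (rule sum_ix[symmetric])
  also have "\<dots> = (\<Sum>j<n. if a \<le> j \<and> j < b then f (ix j) else 0)"
    by (intro sum.cong) (auto simp: rank_ix)
  also have "\<dots> = (\<Sum>j\<in>{j\<in>{..<n}. a \<le> j \<and> j < b}. f (ix j))"
    by (subst sum.inter_filter) auto
  also have "{j\<in>{..<n}. a \<le> j \<and> j < b} = {a..<b}" using b by auto
  finally show ?thesis .
qed

lemma card_rank: "b \<le> n \<Longrightarrow> card {k. k < n \<and> a \<le> time_rank n T k \<and> time_rank n T k < b} = b - a"
  using rank_sum[of b "\<lambda>_. 1::nat" a] by simp

text \<open>The ranks whose times are at most \<open>x\<close> form an initial segment, which is
  determined by its cardinality.\<close>

lemma T_ix_le_iff: "j < n \<Longrightarrow> T (ix j) \<le> x \<longleftrightarrow> j < count_le n T x"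
proof -
  assume j: "j < n"
  define D where "D = {j. j < n \<and> T (ix j) \<le> x}"
  have "{i. i < n \<and> T i \<le> x} = ix ` D"
  proof (intro equalityI subsetI)
    fix i assume i: "i \<in> {i. i < n \<and> T i \<le> x}"
    then obtain i' where "i' < n" "i = ix i'" using bij_ix by (auto simp: bij_betw_def)
    then show "i \<in> ix ` D" using i by (auto simp: D_def)
  qed (auto simp: D_def ix_less)
  moreover have "inj_on ix D" using bij_ix by (auto simp: bij_betw_def D_def intro: inj_on_subset)
  ultimately have card: "count_le n T x = card D" by (simp add: count_le_def card_image)
  have "D = {..<card D}"
  proof (rule downward_closed_nat)
    fix i j assume "j \<in> D" "i \<le> j"
    then show "i \<in> D" using T_ix_strict[of i j] by (cases "i = j") (auto simp: D_def)
  qed (auto simp: D_def)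
  then have "j \<in> D \<longleftrightarrow> j < card D" by (metis lessThan_iff)
  then show ?thesis using j by (simp add: D_def card)
qed

text \<open>Ranks start at 0 and a time counts itself, hence \<open>Suc j\<close>. So the estimator
  at \<open>T (ix j)\<close> is the increment of the minorant from \<open>j\<close> to
  \<open>Suc j\<close>.\<close>

lemma count_le_ix: "j < n \<Longrightarrow> count_le n T (T (ix j)) = Suc j"
proof (rule antisym)
  assume j: "j < n"
  show "Suc j \<le> count_le n T (T (ix j))" using T_ix_le_iff[OF j, of "T (ix j)"] by simp
  show "count_le n T (T (ix j)) \<le> Suc j"
  proof (rule ccontr)
    assume "\<not> ?thesis"
    then have less: "Suc j < count_le n T (T (ix j))" by simp
    also have "\<dots> \<le> n" by (rule count_le_le)
    finally have "Suc j < n" .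
    then have "T (ix (Suc j)) \<le> T (ix j)" using T_ix_le_iff[of "Suc j" "T (ix j)"] less by simp
    then show False using T_ix_strict[of j "Suc j"] \<open>Suc j < n\<close> by simp
  qed
qed

end

section \<open>The maximum likelihood estimator\<close>

lemma cusum_nonneg: "0 \<le> cusum n T \<Delta> i"
  unfolding cusum_def by (simp add: sum_nonneg)

lemma cusum_0 [simp]: "cusum n T \<Delta> 0 = 0"
  by (simp add: cusum_def)

lemma cusum_diff_le: "i \<le> j \<Longrightarrow> cusum n T \<Delta> j - cusum n T \<Delta> i \<le> real j - real i"
proof -
  assume ij: "i \<le> j"
  have "cusum n T \<Delta> j - cusum n T \<Delta> i = (\<Sum>k=i..<j. of_bool (\<Delta> (sort_key T [0..<n] ! k)))"
    unfolding cusum_def lessThan_atLeast0 by (rule sum_diff_nat_ivl) (use ij in auto)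
  also have "\<dots> \<le> (\<Sum>k=i..<j. 1)" by (intro sum_mono) auto
  finally show ?thesis using ij by (simp add: of_nat_diff)
qed

definition gcm_slope :: "nat \<Rightarrow> (nat \<Rightarrow> real) \<Rightarrow> nat \<Rightarrow> real" where
  "gcm_slope n S k = gcm n S (real (Suc k)) - gcm n S (real k)"

lemma gcm_slope_Suc: "Suc k < n \<Longrightarrow> gcm_slope n S k \<le> gcm_slope n S (Suc k)"
  using gcm_discrete_convex[of k "Suc k" "Suc (Suc k)" n S] by (simp add: gcm_slope_def)

lemma gcm_slope_mono: "i \<le> j \<Longrightarrow> j < n \<Longrightarrow> gcm_slope n S i \<le> gcm_slope n S j"
proof (induction j rule: dec_induct)
  case (step j)
  then show ?case using gcm_slope_Suc[of j n S] by simp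
qed simp

text \<open>The zero line is a minorant, so already the first increment is nonnegative.\<close>

lemma gcm_slope_nonneg:
  assumes "S 0 = 0" "\<And>i. i \<le> n \<Longrightarrow> 0 \<le> S i" "k < n"
  shows "0 \<le> gcm_slope n S k"
proof -
  have "0 + 0 * real 1 \<le> gcm n S (real 1)" using assms by (intro gcm_ge_affine) auto
  then have "0 \<le> gcm_slope n S 0" using gcm_0[of n S] assms(1) by (simp add: gcm_slope_def)
  also have "\<dots> \<le> gcm_slope n S k" using assms by (intro gcm_slope_mono) auto
  finally show ?thesis .
qed

text \<open>The line of slope 1 through the last point is a minorant, which bounds the last and
  hence every increment.\<close>

lemma gcm_slope_le_1:
  assumes "\<And>i. i \<le> n \<Longrightarrow> S n - S i \<le> real n - real i" "k < n"
  shows "gcm_slope n S k \<le> 1"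
proof -
  have "(S n - real n) + 1 * real (n - 1) \<le> gcm n S (real (n - 1))"
    using assms by (intro gcm_ge_affine) (auto simp: algebra_simps)
  then have "gcm_slope n S (n - 1) \<le> 1"
    using gcm_n[of n S] assms(2) by (simp add: gcm_slope_def of_nat_diff)
  moreover have "gcm_slope n S k \<le> gcm_slope n S (n - 1)" using assms by (intro gcm_slope_mono) auto
  ultimately show ?thesis by simp
qed

lemma mle_eq_gcm_slope:
  "mle n T \<Delta> x = (case count_le n T x of 0 \<Rightarrow> 0 | Suc k \<Rightarrow> gcm_slope n (cusum n T \<Delta>) k)"
proof (cases "count_le n T x")
  case (Suc k)
  then have "Suc k \<le> n" using count_le_le[of n T x] by simp
  then show ?thesis
    using Suc gcm_left_derivative[of "Suc k" n "cusum n T \<Delta>"]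
    by (simp add: mle_def count_le_def[symmetric] Let_def gcm_slope_def)
qed (simp add: mle_def count_le_def[symmetric])

lemma mle_nonneg: "0 \<le> mle n T \<Delta> x"
  using count_le_le[of n T x]
  by (auto simp: mle_eq_gcm_slope split: nat.split intro!: gcm_slope_nonneg cusum_nonneg)

lemma mle_le_1: "mle n T \<Delta> x \<le> 1"
  using count_le_le[of n T x]
  by (auto simp: mle_eq_gcm_slope split: nat.split intro!: gcm_slope_le_1 cusum_diff_le)

lemma mle_mono: "x \<le> x' \<Longrightarrow> mle n T \<Delta> x \<le> mle n T \<Delta> x'"
  using count_le_mono[of x x' n T] count_le_le[of n T x'] mle_nonneg[of n T \<Delta> x']
  by (auto simp: mle_eq_gcm_slope split: nat.splits intro!: gcm_slope_mono)

lemma mle_cong_count: "count_le n T x = count_le n T x' \<Longrightarrow> mle n T \<Delta> x = mle n T \<Delta> x'"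
  by (simp add: mle_eq_gcm_slope)

lemma count_le_eventually_right:
  obtains d where "d > 0" "\<And>y. x \<le> y \<Longrightarrow> y < x + d \<Longrightarrow> count_le n T y = count_le n T x"
proof -
  have "\<exists>d>0. \<forall>i<n. x < T i \<longrightarrow> x + d \<le> T i"
  proof (cases "{i. i < n \<and> x < T i} = {}")
    case False
    define m where "m = Min (T ` {i. i < n \<and> x < T i})"
    have fin: "finite {i. i < n \<and> x < T i}" by simp
    have "m \<in> T ` {i. i < n \<and> x < T i}" unfolding m_def using False by (intro Min_in) auto
    then have "x < m" by auto
    moreover have "m \<le> T i" if "i < n" "x < T i" for i unfolding m_def using that by (intro Min_le) auto
    ultimately show ?thesis by (intro exI[of _ "m - x"]) auto
  qed (auto intro!: exI[of _ 1])
  then obtain d where d: "d > 0" "\<And>i. i < n \<Longrightarrow> x < T i \<Longrightarrow> x + d \<le> T i" by blast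
  show ?thesis
  proof (rule that[OF d(1)])
    fix y assume y: "x \<le> y" "y < x + d"
    have "T i \<le> y \<longleftrightarrow> T i \<le> x" if "i < n" for i using d(2)[OF that] y by linarith
    then show "count_le n T y = count_le n T x" unfolding count_le_def by (metis (no_types, lifting))
  qed
qed

text \<open>Needed for \<open>interval_measure\<close> to represent the jumps of the
  estimator.\<close>

lemma mle_right_continuous: "continuous (at_right x) (mle n T \<Delta>)"
proof -
  obtain d where d: "d > 0" "\<And>y. x \<le> y \<Longrightarrow> y < x + d \<Longrightarrow> count_le n T y = count_le n T x"
    using count_le_eventually_right by blast
  have "\<forall>\<^sub>F y in at_right x. mle n T \<Delta> y = mle n T \<Delta> x"
    using eventually_at_right_less[of x] eventually_at_right_field[of "\<lambda>y. y < x + d" x]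
  proof -
    have "\<forall>\<^sub>F y in at_right x. y < x + d"
      using d(1) by (intro eventually_at_right_field[THEN iffD2]) (auto intro!: exI[of _ "x + d"])
    with eventually_at_right_less[of x] show ?thesis
      by eventually_elim (intro mle_cong_count d(2); simp)
  qed
  then show ?thesis
    unfolding continuous_within by (rule tendsto_eventually)
qed

lemma mle_at_bot: "\<exists>x0. \<forall>x<x0. mle n T \<Delta> x = 0"
proof -
  have "\<exists>x0. \<forall>i<n. x0 \<le> T i"
    by (rule exI[of _ "if n = 0 then 0 else Min (T ` {..<n})"]) auto
  then obtain x0 where "\<And>i. i < n \<Longrightarrow> x0 \<le> T i" by blast
  then have "count_le n T x = 0" if "x < x0" for x
    using that unfolding count_le_def by (auto simp: card_eq_0_iff) (meson leD le_less_trans)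
  then show ?thesis by (intro exI[of _ x0]) (auto simp: mle_eq_gcm_slope)
qed

context distinct_times
begin

text \<open>The means \<open>q\<close> are left open: they are values of \<open>F0\<close> for the
  original indicators and of the smoothed estimator for the bootstrap ones.\<close>

lemma isotonic_fit_mle:
  assumes q: "\<And>i j. i < n \<Longrightarrow> j < n \<Longrightarrow> T i \<le> T j \<Longrightarrow> q i \<le> q j"
    and dev: "rank_deviation_le n T (\<lambda>k. of_bool (\<Delta> k) - q k) L"
  shows "isotonic_fit n (\<lambda>j. of_bool (\<Delta> (ix j))) (\<lambda>j. q (ix j)) (\<lambda>k. gcm n (cusum n T \<Delta>) (real k)) L"
proof
  have S: "cusum n T \<Delta> i = (\<Sum>j<i. of_bool (\<Delta> (ix j)))" for i by (simp add: cusum_def ix_def)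
  show "gcm n (cusum n T \<Delta>) (real 0) = 0" using gcm_0[of n "cusum n T \<Delta>"] by simp
  show "gcm n (cusum n T \<Delta>) (real n) = (\<Sum>j<n. of_bool (\<Delta> (ix j)))"
    by (simp add: gcm_n S[symmetric])
  show "gcm n (cusum n T \<Delta>) (real i) \<le> (\<Sum>j<i. of_bool (\<Delta> (ix j)))" if "i \<le> n" for i
    using gcm_le[OF that, of "cusum n T \<Delta>"] by (simp add: S[symmetric])
  show "gcm n (cusum n T \<Delta>) (real (Suc k)) - gcm n (cusum n T \<Delta>) (real k)
      \<le> gcm n (cusum n T \<Delta>) (real (Suc (Suc k))) - gcm n (cusum n T \<Delta>) (real (Suc k))"
    if "Suc k < n" for k using gcm_slope_Suc[OF that, of "cusum n T \<Delta>"] by (simp add: gcm_slope_def)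
  show "gcm n (cusum n T \<Delta>) (real (Suc (Suc k))) - gcm n (cusum n T \<Delta>) (real (Suc k))
      = gcm n (cusum n T \<Delta>) (real (Suc k)) - gcm n (cusum n T \<Delta>) (real k)"
    if "Suc k < n" "gcm n (cusum n T \<Delta>) (real (Suc k)) < (\<Sum>j<Suc k. of_bool (\<Delta> (ix j)))" for k
    using gcm_slack[of "Suc k" n "cusum n T \<Delta>"] that unfolding S[symmetric] by (simp add: algebra_simps)
  show "q (ix i) \<le> q (ix j)" if "i \<le> j" "j < n" for i j
  proof (cases "i = j")
    case False
    then show ?thesis using that T_ix_strict[of i j] by (intro q ix_less) auto
  qed simp
  show "\<bar>\<Sum>j=a..<b. of_bool (\<Delta> (ix j)) - q (ix j)\<bar> \<le> L * sqrt (real b - real a)" if "a < b" "b \<le> n" for a b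
    using dev[unfolded rank_deviation_le_def, rule_format, OF that(2,1)] by (simp only: rank_sum[OF that(2)])
qed

text \<open>\<open>slope_upper\<close> read in time instead of rank: at least \<open>m\<close>
  observations lie in \<open>{x<..z}\<close>, so the one \<open>m\<close> ranks further on still has
  a time at most \<open>z\<close>, where \<open>Q\<close> bounds its mean.\<close>

lemma mle_upper:
  assumes Q: "mono Q" "\<And>u. 0 \<le> Q u" and L: "0 \<le> L"
    and dev: "rank_deviation_le n T (\<lambda>k. of_bool (\<Delta> k) - Q (T k)) L"
    and m: "0 < m" "count_le n T x + m \<le> count_le n T z"
  shows "mle n T \<Delta> x \<le> Q z + L / sqrt (real m)"
proof (cases "count_le n T x")
  case 0
  then show ?thesis using Q(2)[of z] L by (simp add: mle_eq_gcm_slope)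
next
  case (Suc k)
  interpret isotonic_fit n "\<lambda>j. of_bool (\<Delta> (ix j))" "\<lambda>j. Q (T (ix j))" "\<lambda>k. gcm n (cusum n T \<Delta>) (real k)" L
    by (rule isotonic_fit_mle) (use Q dev in \<open>auto dest: monoD\<close>)
  have k: "k + m < count_le n T z" "k + m < n" using m Suc count_le_le[of n T z] by auto
  have "mle n T \<Delta> x = slope k" using Suc by (simp add: mle_eq_gcm_slope gcm_slope_def slope_def)
  also have "\<dots> \<le> Q (T (ix (k + m))) + L / sqrt (real m)"
    using k m L by (intro slope_upper) auto
  also have "Q (T (ix (k + m))) \<le> Q z" using k T_ix_le_iff[of "k + m" z] by (intro monoD[OF Q(1)]) auto
  finally show ?thesis by simp
qed

lemma mle_lower:
  assumes Q: "mono Q" and L: "0 \<le> L"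
    and dev: "rank_deviation_le n T (\<lambda>k. of_bool (\<Delta> k) - Q (T k)) L"
    and m: "0 < m" "count_le n T w + m \<le> count_le n T x"
  shows "mle n T \<Delta> x \<ge> Q w - L / sqrt (real m)"
proof -
  obtain k where Suc: "count_le n T x = Suc k" using m by (cases "count_le n T x") auto
  interpret isotonic_fit n "\<lambda>j. of_bool (\<Delta> (ix j))" "\<lambda>j. Q (T (ix j))" "\<lambda>k. gcm n (cusum n T \<Delta>) (real k)" L
    by (rule isotonic_fit_mle) (use Q dev in \<open>auto dest: monoD\<close>)
  have k: "k < n" "m \<le> Suc k" "Suc k - m < n" using m Suc count_le_le[of n T x] by auto
  have "Q w \<le> Q (T (ix (Suc k - m)))"
    using k m Suc T_ix_le_iff[of "Suc k - m" w] by (intro monoD[OF Q(1)]) auto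
  also have "\<dots> - L / sqrt (real m) \<le> slope k" using k m L by (intro slope_lower) auto
  also have "slope k = mle n T \<Delta> x" using Suc by (simp add: mle_eq_gcm_slope gcm_slope_def slope_def)
  finally show ?thesis by simp
qed

text \<open>
  The hypotheses on the values at \<open>T (ix j) \<plusminus> z\<close> confine the block of \<open>T (ix j)\<close> to the
  interval of radius \<open>z\<close>.
\<close>
lemma cusum_minus_gcm_le:
  assumes Q: "mono Q" and L: "0 \<le> L"
    and dev: "rank_deviation_le n T (\<lambda>k. of_bool (\<Delta> k) - Q (T k)) L"
    and j: "j < n" "k = j \<or> k = Suc j" and z: "0 \<le> z"
    and less: "mle n T \<Delta> (T (ix j) - z) < mle n T \<Delta> (T (ix j))" "mle n T \<Delta> (T (ix j)) < mle n T \<Delta> (T (ix j) + z)"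
  shows "cusum n T \<Delta> k - gcm n (cusum n T \<Delta>) (real k)
         \<le> L * sqrt (real (count_le n T (T (ix j) + z)) - real (count_le n T (T (ix j) - z)))"
proof -
  interpret isotonic_fit n "\<lambda>j. of_bool (\<Delta> (ix j))" "\<lambda>j. Q (T (ix j))" "\<lambda>k. gcm n (cusum n T \<Delta>) (real k)" L
    by (rule isotonic_fit_mle) (use Q dev in \<open>auto dest: monoD\<close>)
  have S_eq: "S i = cusum n T \<Delta> i" for i unfolding S_def unfolding cusum_def ix_def by (rule refl)
  have mle: "mle n T \<Delta> x = slope i" if "count_le n T x = Suc i" for x i
    using that by (simp add: mle_eq_gcm_slope gcm_slope_def slope_def)
  have mle_j: "mle n T \<Delta> (T (ix j)) = slope j" using count_le_ix[OF j(1)] by (rule mle)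
  obtain a where a: "a \<le> j" "gcm n (cusum n T \<Delta>) (real a) = S a" "\<And>i. a \<le> i \<Longrightarrow> i \<le> j \<Longrightarrow> slope i = slope j"
    using slope_const_left[OF j(1)] by metis
  obtain b where b: "j < b" "b \<le> n" "gcm n (cusum n T \<Delta>) (real b) = S b" "\<And>i. j \<le> i \<Longrightarrow> i < b \<Longrightarrow> slope i = slope j"
    using slope_const_right[OF j(1)] by metis
  have cnt_j: "count_le n T (T (ix j)) = Suc j" using j(1) by (rule count_le_ix)
  have "b \<le> count_le n T (T (ix j) + z)"
  proof (rule ccontr)
    assume *: "\<not> ?thesis"
    have "Suc j \<le> count_le n T (T (ix j) + z)"
      using count_le_mono[of "T (ix j)" "T (ix j) + z" n T] z cnt_j by simp
    then obtain i where i: "count_le n T (T (ix j) + z) = Suc i" "j \<le> i" by (metis Suc_le_D Suc_le_mono)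
    have "slope i = slope j" using * i by (intro b(4)) auto
    then show False using mle[OF i(1)] mle_j less by simp
  qed
  moreover have "count_le n T (T (ix j) - z) \<le> a"
  proof (rule ccontr)
    assume *: "\<not> ?thesis"
    then obtain i where i: "count_le n T (T (ix j) - z) = Suc i" "a \<le> i"
      by (metis Suc_le_D Suc_le_mono not_less_eq_eq)
    have "i \<le> j" using count_le_mono[of "T (ix j) - z" "T (ix j)" n T] z cnt_j i by simp
    then have "slope i = slope j" using i by (intro a(3)) auto
    then show False using mle[OF i(1)] mle_j less by simp
  qed
  ultimately have len: "real b - real a \<le> real (count_le n T (T (ix j) + z)) - real (count_le n T (T (ix j) - z))"
    by linarith
  have const: "slope i = slope j" if "a \<le> i" "i < b" for i
    using a(3)[of i] b(4)[of i] that by linarith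
  have "a \<le> k" "k \<le> b" using a(1) b(1) j(2) by auto
  from this b(2) a(2) b(3) L const have "S k - gcm n (cusum n T \<Delta>) (real k) \<le> L * sqrt (real b - real a)"
    by (rule excess_le)
  also have "\<dots> \<le> L * sqrt (real (count_le n T (T (ix j) + z)) - real (count_le n T (T (ix j) - z)))"
    using L len by (intro mult_left_mono) auto
  finally show ?thesis by (simp add: S_eq)
qed

text \<open>Summation by parts: the partial sums of \<open>\<Delta> - mle\<close> are \<open>cusum - gcm\<close>, which vanishes at both ends.\<close>
lemma sum_weighted_residuals_le:
  assumes \<phi>: "\<And>u v. u \<le> v \<Longrightarrow> \<bar>\<phi> u - \<phi> v\<bar> \<le> \<Lambda> * (max l (min r v) - max l (min r u))"
    and zero: "\<And>u. u \<notin> {l..r} \<Longrightarrow> \<phi> u = 0"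
    and lr: "l \<le> r" and \<Lambda>: "0 \<le> \<Lambda>" and B: "0 \<le> B"
    and D: "\<And>j k. j < n \<Longrightarrow> T (ix j) \<in> {l..r} \<Longrightarrow> k = j \<or> k = Suc j \<Longrightarrow>
             cusum n T \<Delta> k - gcm n (cusum n T \<Delta>) (real k) \<le> B"
  shows "\<bar>\<Sum>i<n. \<phi> (T i) * (of_bool (\<Delta> i) - mle n T \<Delta> (T i))\<bar> \<le> \<Lambda> * (r - l) * B"
proof -
  define D' where "D' k = cusum n T \<Delta> k - gcm n (cusum n T \<Delta>) (real k)" for k
  define f where "f j = \<phi> (T (ix j))" for j
  \<comment> \<open>Increments of the clamped times telescope to at most \<open>r - l\<close>, so
    observations outside the window cost nothing.\<close>
  define c where "c j = max l (min r (T (ix j)))" for j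
  have D'0: "D' 0 = 0" "D' n = 0" using gcm_0[of n "cusum n T \<Delta>"] by (auto simp: D'_def gcm_n)
  have D'_nonneg: "0 \<le> D' k" if "k \<le> n" for k using gcm_le[OF that, of "cusum n T \<Delta>"] by (simp add: D'_def)
  have "(\<Sum>i<n. \<phi> (T i) * (of_bool (\<Delta> i) - mle n T \<Delta> (T i)))
      = (\<Sum>j<n. f j * (of_bool (\<Delta> (ix j)) - mle n T \<Delta> (T (ix j))))"
    unfolding f_def by (rule sum_ix[symmetric])
  also have "\<dots> = (\<Sum>j<n. f j * (D' (Suc j) - D' j))"
    by (intro sum.cong refl arg_cong2[where f = times])
       (auto simp: D'_def mle_eq_gcm_slope count_le_ix gcm_slope_def cusum_def ix_def[symmetric])
  also have "\<dots> = (\<Sum>j<n-1. (f j - f (Suc j)) * D' (Suc j))"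
  proof (cases n)
    case (Suc m)
    have "(\<Sum>j<Suc m. f j * (D' (Suc j) - D' j)) = f m * D' (Suc m) - f 0 * D' 0 + (\<Sum>j<m. (f j - f (Suc j)) * D' (Suc j))"
      by (induction m) (auto simp: algebra_simps)
    then show ?thesis using Suc D'0 by simp
  qed simp
  also have "\<bar>\<dots>\<bar> \<le> (\<Sum>j<n-1. \<Lambda> * (c (Suc j) - c j) * B)"
  proof (rule order_trans[OF sum_abs sum_mono])
    fix j assume "j \<in> {..<n-1}"
    then have j: "Suc j < n" by auto
    have T: "T (ix j) \<le> T (ix (Suc j))" using T_ix_strict[of j "Suc j"] j by simp
    have df: "\<bar>f j - f (Suc j)\<bar> \<le> \<Lambda> * (c (Suc j) - c j)" unfolding f_def c_def by (rule \<phi>[OF T])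
    show "\<bar>(f j - f (Suc j)) * D' (Suc j)\<bar> \<le> \<Lambda> * (c (Suc j) - c j) * B"
    \<comment> \<open>If neither neighbour lies in the window, both weights vanish; hence the height
      \<open>B\<close> is required only at ranks adjacent to the window.\<close>
    proof (cases "T (ix j) \<in> {l..r} \<or> T (ix (Suc j)) \<in> {l..r}")
      case True
      then have "D' (Suc j) \<le> B" unfolding D'_def using j D[of j "Suc j"] D[of "Suc j" "Suc j"] by auto
      then show ?thesis unfolding abs_mult using df D'_nonneg[of "Suc j"] j B
        by (intro mult_mono) auto
    next
      case False
      then have "f j = 0" "f (Suc j) = 0" unfolding f_def using zero by blast+
      moreover have "0 \<le> c (Suc j) - c j" using T by (auto simp: c_def)
      ultimately show ?thesis using \<Lambda> B by simp
    qed
  qed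
  also have "\<dots> = \<Lambda> * (c (n - 1) - c 0) * B"
    by (simp only: sum_distrib_left[symmetric] sum_distrib_right[symmetric] sum_lessThan_telescope)
  also have "\<dots> \<le> \<Lambda> * (r - l) * B"
    using \<Lambda> B lr by (intro mult_right_mono mult_left_mono) (auto simp: c_def)
  finally show ?thesis .
qed

end

section \<open>Kernel smoothing\<close>

text \<open>The support condition yields zeros only outside \<open>{-1..1}\<close>; continuity adds
  the end points. The derivative is bounded on the compact support, and clamping to it extends the
  Lipschitz bound to the whole line.\<close>

lemma smoothing_kernelD:
  assumes "smoothing_kernel K"
  shows smoothing_kernel_nonneg: "0 \<le> K u"
    and smoothing_kernel_integral: "integral\<^sup>L lborel K = 1"
    and smoothing_kernel_integrable: "integrable lborel K"
    and smoothing_kernel_symmetric: "K (- u) = K u"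
    and smoothing_kernel_zero: "1 \<le> \<bar>u\<bar> \<Longrightarrow> K u = 0"
    and smoothing_kernel_lipschitz: "\<exists>B>0. (\<forall>u. K u \<le> B) \<and> (\<forall>u v. \<bar>K u - K v\<bar> \<le> B * \<bar>u - v\<bar>)"
proof -
  have K: "\<And>u. K u \<ge> 0" "integral\<^sup>L lborel K = 1" "\<And>u. K (- u) = K u" "closure {u. K u \<noteq> 0} = {-1..1}"
    using assms by (auto simp: smoothing_kernel_def)
  obtain K' K'' where K': "\<And>u. (K has_real_derivative K' u) (at u)"
    "\<And>u. (K' has_real_derivative K'' u) (at u)"
    using assms unfolding smoothing_kernel_def by blast
  show "0 \<le> K u" "integral\<^sup>L lborel K = 1" "K (- u) = K u" using K by auto
  \<comment> \<open>A non-integrable function has integral 0 by convention, so the value 1 forces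
    integrability.\<close>
  show "integrable lborel K" using K(2) not_integrable_integral_eq by fastforce
  have K0: "K u = 0" if "1 < \<bar>u\<bar>" for u
    using closure_subset[of "{u. K u \<noteq> 0}"] K(4) that by force
  have cont: "continuous_on UNIV K"
    using K'(1) by (meson DERIV_continuous_on has_field_derivative_at_within)
  have zero: "K u = 0" if "1 \<le> \<bar>u\<bar>" for u
  proof (cases "\<bar>u\<bar> = 1")
    case True
    have "closed {u. K u = 0}" using continuous_closed_preimage_constant[OF cont, of 0] by simp
    moreover have "{1<..} \<subseteq> {u. K u = 0}" using K0 by auto
    ultimately have "closure {1::real<..} \<subseteq> {u. K u = 0}" by (rule closure_minimal[rotated])
    then have "K 1 = 0" by (auto simp: closure_greaterThan)
    then show ?thesis using True K(3)[of 1] by (auto simp: abs_if split: if_splits)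
  qed (use K0 that in auto)
  then show "1 \<le> \<bar>u\<bar> \<Longrightarrow> K u = 0" .
  have "bounded (K' ` {-1..1})"
    by (intro compact_imp_bounded compact_continuous_image continuous_at_imp_continuous_on ballI
          DERIV_isCont[OF K'(2)]) auto
  then obtain B where B: "B > 0" "\<And>u. u \<in> {-1..1} \<Longrightarrow> \<bar>K' u\<bar> \<le> B"
    unfolding bounded_pos by auto
  define c :: "real \<Rightarrow> real" where "c u = max (-1) (min 1 u)" for u
  have Kc: "K u = K (c u)" for u
  proof (cases "\<bar>u\<bar> \<le> 1")
    case False
    then have "\<bar>c u\<bar> = 1" by (auto simp: c_def)
    then show ?thesis using zero[of u] zero[of "c u"] False by simp
  qed (auto simp: c_def)
  have lip: "\<bar>K u - K v\<bar> \<le> B * \<bar>u - v\<bar>" for u v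
  proof -
    have "norm (K (c u) - K (c v)) \<le> B * norm (c u - c v)"
    proof (rule field_differentiable_bound[where S = "{-1..1}" and f' = K'])
      show "(K has_field_derivative K' z) (at z within {-1..1})" for z
        using K'(1) by (rule has_field_derivative_at_within)
    qed (use B in \<open>auto simp: c_def\<close>)
    also have "\<dots> \<le> B * \<bar>u - v\<bar>" using B by (intro mult_left_mono) (auto simp: c_def)
    finally show ?thesis by (simp add: Kc[of u] Kc[of v])
  qed
  \<comment> \<open>Compare with the zero at 1, at distance at most 2 from any point of the support.
    Doubling \<open>B\<close> lets one constant serve as supremum and as Lipschitz bound.\<close>
  have "K u \<le> B * 2" for u
  proof (cases "\<bar>u\<bar> \<le> 1")
    case True
    have "\<bar>K u\<bar> \<le> B * \<bar>u - 1\<bar>" using lip[of u 1] zero[of 1] by simp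
    also have "\<dots> \<le> B * 2" using B True by (intro mult_left_mono) auto
    finally show ?thesis by simp
  qed (use zero B in auto)
  then show "\<exists>B>0. (\<forall>u. K u \<le> B) \<and> (\<forall>u v. \<bar>K u - K v\<bar> \<le> B * \<bar>u - v\<bar>)"
  proof (intro exI[of _ "B * 2"] conjI allI)
    show "\<bar>K u - K v\<bar> \<le> B * 2 * \<bar>u - v\<bar>" for u v
      using lip[of u v] B(1) by (auto intro: order_trans simp: mult_right_mono)
  qed (use B in auto)
qed

text \<open>Covers both \<open>mle\<close>, whose last slope may be below 1, and
  \<open>smle\<close>, which is smoothed again in the centring. Vanishing far to the left, rather
  than a mere limit, survives smoothing by a compactly supported kernel.\<close>

locale sub_distribution_function =
  fixes F :: "real \<Rightarrow> real"
  assumes F_mono: "x \<le> y \<Longrightarrow> F x \<le> F y"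
    and F_right_cont: "continuous (at_right x) F"
    and F_le_1: "F x \<le> 1"
    and F_zero_ex: "\<exists>x0. \<forall>x<x0. F x = 0"
begin

lemma F_nonneg: "0 \<le> F x"
proof -
  obtain x0 where "\<And>y. y < x0 \<Longrightarrow> F y = 0" using F_zero_ex by blast
  then have "F (min x (x0 - 1)) = 0" by auto
  then show ?thesis using F_mono[of "min x (x0 - 1)" x] by simp
qed

lemma F_lim: "(F \<longlongrightarrow> 0) at_bot"
proof -
  obtain x0 where "\<And>y. y < x0 \<Longrightarrow> F y = 0" using F_zero_ex by blast
  then have "\<forall>\<^sub>F x in at_bot. F x = 0" by (intro eventually_at_bot_dense[THEN iffD2]) auto
  then show ?thesis by (rule tendsto_eventually)
qed

lemma F_measurable [measurable]: "F \<in> borel_measurable borel"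
  using F_mono by (intro borel_measurable_mono) (simp add: mono_def)

lemma finite_measure_interval_measure: "finite_measure (interval_measure F)"
proof
  have "emeasure (interval_measure F) (\<Union>i::nat. {..real i}) = (SUP i. emeasure (interval_measure F) {..real i})"
    by (intro SUP_emeasure_incseq[symmetric]) (auto simp: incseq_def)
  also have "\<dots> = (SUP i. ennreal (F (real i)))"
    by (simp add: emeasure_interval_measure_Iic[OF F_mono F_right_cont F_lim])
  also have "\<dots> \<le> 1" using F_le_1 by (intro SUP_least) (simp add: ennreal_le_1)
  also have "(\<Union>i::nat. {..real i}) = UNIV" by (auto intro: real_arch_simple)
  finally show "emeasure (interval_measure F) (space (interval_measure F)) \<noteq> \<infinity>"
    by (auto simp: top_unique)
qed

lemma integrable_kernel_mult:
  assumes "integrable lborel K"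
  shows "integrable lborel (\<lambda>u. K u * F (x - h * u))"
proof (rule Bochner_Integration.integrable_bound[OF assms])
  show "AE u in lborel. norm (K u * F (x - h * u)) \<le> norm (K u)"
    using F_le_1 F_nonneg by (auto simp: abs_mult intro!: mult_left_le)
qed (use assms in simp)

text \<open>Fubini: \<open>integrated_kernel\<close> is an integral over
  \<open>u \<le> (x - y) / h\<close>, and this condition on \<open>y\<close> describes a set of
  measure \<open>F (x - h * u)\<close>. Written as a weighted average of values of \<open>F\<close>,
  smoothing passes on bounds, monotonicity and rates.\<close>

lemma kernel_smooth_eq:
  assumes K: "integrable lborel K" and h: "0 < h"
  shows "kernel_smooth K h F x = (LINT u|lborel. K u * F (x - h * u))"
proof -
  interpret \<mu>: finite_measure "interval_measure F" by (rule finite_measure_interval_measure)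
  interpret pair_sigma_finite "interval_measure F" lborel ..
  have [measurable]: "K \<in> borel_measurable borel" using K by simp
  let ?f = "\<lambda>y u. indicator {..(x - y) / h} u * K u"
  have int: "integrable (interval_measure F \<Otimes>\<^sub>M lborel) (\<lambda>(y, u). ?f y u)"
  proof (rule Fubini_integrable)
    have m: "(\<lambda>(y, u). indicator {..(x - y) / h} u * K u)
        = (\<lambda>(y, u). (if u \<le> (x - y) / h then 1 else 0) * K u)"
      by (auto simp: indicator_def fun_eq_iff)
    show meas: "(\<lambda>(y, u). ?f y u) \<in> borel_measurable (interval_measure F \<Otimes>\<^sub>M lborel)"
      unfolding m by measurable
    show "integrable (interval_measure F) (\<lambda>y. LINT u|lborel. norm (case (y, u) of (y, u) \<Rightarrow> ?f y u))"
    proof (rule \<mu>.integrable_const_bound[where B = "LINT u|lborel. norm (K u)"])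
      show "AE y in interval_measure F.
          norm (LINT u|lborel. norm (case (y, u) of (y, u) \<Rightarrow> ?f y u)) \<le> (LINT u|lborel. norm (K u))"
      proof (intro AE_I2)
        fix y
        have "integrable lborel (\<lambda>u. norm (K u) * indicator {..(x - y) / h} u)"
          using K by (intro integrable_real_mult_indicator integrable_norm) auto
        then have "integrable lborel (\<lambda>u. norm (?f y u))"
          by (simp add: abs_mult mult.commute)
        then have "(LINT u|lborel. norm (?f y u)) \<le> (LINT u|lborel. norm (K u))"
          by (rule Bochner_Integration.integral_mono) (use K in \<open>auto simp: indicator_def\<close>)
        then show "norm (LINT u|lborel. norm (case (y, u) of (y, u) \<Rightarrow> ?f y u)) \<le> (LINT u|lborel. norm (K u))"
          by (simp add: integral_nonneg_AE)
      qed
    qed (use meas in measurable)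
    show "AE y in interval_measure F. integrable lborel (\<lambda>u. case (y, u) of (y, u) \<Rightarrow> ?f y u)"
      using K by (auto intro!: integrable_real_mult_indicator simp: mult.commute)
  qed
  have "kernel_smooth K h F x = (LINT y|interval_measure F. LINT u|lborel. ?f y u)"
    by (simp add: kernel_smooth_def integrated_kernel_def set_lebesgue_integral_def)
  also have "\<dots> = (LINT u|lborel. LINT y|interval_measure F. ?f y u)"
    by (rule Fubini_integral[OF int, symmetric])
  also have "\<dots> = (LINT u|lborel. K u * F (x - h * u))"
  proof (intro Bochner_Integration.integral_cong refl)
    fix u
    have "(LINT y|interval_measure F. ?f y u) = (LINT y|interval_measure F. indicator {..x - h * u} y * K u)"
      using h by (intro Bochner_Integration.integral_cong refl) (auto simp: indicator_def field_simps)
    also have "\<dots> = measure (interval_measure F) {..x - h * u} * K u" by simp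
    also have "measure (interval_measure F) {..x - h * u} = F (x - h * u)"
      by (rule measure_interval_measure_Iic[OF F_mono F_right_cont F_lim])
    finally show "(LINT y|interval_measure F. ?f y u) = K u * F (x - h * u)" by (simp add: mult.commute)
  qed
  finally show ?thesis .
qed

text \<open>Makes the smoothed estimator a legitimate success probability for the bootstrap and
  allows it to be smoothed a second time.\<close>

lemma sub_distribution_function_smooth:
  assumes K: "smoothing_kernel K" and h: "0 < h"
  shows "sub_distribution_function (kernel_smooth K h F)"
proof -
  note int = smoothing_kernel_integrable[OF K]
  have [measurable]: "K \<in> borel_measurable borel" using int by simp
  note eq = kernel_smooth_eq[OF int h]
  note K0 = smoothing_kernel_nonneg[OF K]
  show ?thesis
  proof
    show "kernel_smooth K h F x \<le> kernel_smooth K h F y" if "x \<le> y" for x y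
      unfolding eq using that
      by (intro Bochner_Integration.integral_mono integrable_kernel_mult int mult_left_mono F_mono K0) auto
    have "kernel_smooth K h F x \<le> (LINT u|lborel. K u)" for x
      unfolding eq by (intro Bochner_Integration.integral_mono integrable_kernel_mult int mult_left_le F_le_1 K0)
    then show "kernel_smooth K h F x \<le> 1" for x by (simp add: smoothing_kernel_integral[OF K])
    show "continuous (at_right x) (kernel_smooth K h F)" for x
      unfolding continuous_within
    proof (rule tendsto_at_right_sequentially[of x "x + 1"])
      fix S :: "nat \<Rightarrow> real" assume S: "\<And>n. x < S n" "S \<longlonglongrightarrow> x"
      show "(\<lambda>n. kernel_smooth K h F (S n)) \<longlonglongrightarrow> kernel_smooth K h F x"
        unfolding eq
      proof (rule integral_dominated_convergence)
        show "integrable lborel (\<lambda>u. norm (K u))" using int by simp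
        show "AE u in lborel. norm (K u * F (S i - h * u)) \<le> norm (K u)" for i
          using F_le_1 F_nonneg by (auto simp: abs_mult intro!: mult_left_le)
        show "AE u in lborel. (\<lambda>i. K u * F (S i - h * u)) \<longlonglongrightarrow> K u * F (x - h * u)"
        proof (intro AE_I2 tendsto_mult tendsto_const)
          fix u
          have "(F \<longlongrightarrow> F (x - h * u)) (at_right (x - h * u))"
            using F_right_cont[of "x - h * u"] by (simp add: continuous_within)
          \<comment> \<open>The arguments approach their limit strictly from the right, so right
            continuity of \<open>F\<close> is enough under the integral.\<close>
          moreover have "filterlim (\<lambda>i. S i - h * u) (at_right (x - h * u)) sequentially"
            unfolding filterlim_at using S less_imp_neq[OF S(1)]
            by (auto intro!: tendsto_intros simp: eq_commute)
          ultimately show "(\<lambda>i. F (S i - h * u)) \<longlonglongrightarrow> F (x - h * u)" by (rule filterlim_compose)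
        qed
      qed auto
    qed simp
    obtain x0 where x0: "\<And>y. y < x0 \<Longrightarrow> F y = 0" using F_zero_ex by blast
    have "kernel_smooth K h F x = 0" if "x < x0 - h" for x
    proof -
      have "(\<lambda>u. K u * F (x - h * u)) = (\<lambda>u. 0)"
      proof
        fix u show "K u * F (x - h * u) = 0"
        proof (cases "1 \<le> \<bar>u\<bar>")
        case False
        then have "h * (-u) \<le> h * 1" using h by (intro mult_left_mono) auto
        then show ?thesis using x0[of "x - h * u"] that by simp
        qed (simp add: smoothing_kernel_zero[OF K])
      qed
      then show ?thesis unfolding eq by simp
    qed
    then show "\<exists>x0. \<forall>x<x0. kernel_smooth K h F x = 0" by blast
  qed
qed

end

section \<open>Integrals against the empirical measure\<close>

lemma integrable_lborel_indicator_interval [simp]: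
  "integrable lborel (indicator {a..b::real} :: real \<Rightarrow> real)"
  "integrable lborel (indicator {a..<b::real} :: real \<Rightarrow> real)"
   apply (rule integrable_real_indicator; simp add: emeasure_lborel_Icc_eq)
  apply (cases "a \<le> b")
   apply (rule integrable_real_indicator; simp)
  apply simp
  done

lemma set_integral_bounds:
  fixes f :: "real \<Rightarrow> real"
  assumes int: "set_integrable lborel {x..y} f" and xy: "x \<le> y"
    and b: "\<And>u. u \<in> {x..y} \<Longrightarrow> a \<le> f u" "\<And>u. u \<in> {x..y} \<Longrightarrow> f u \<le> b"
  shows "a * (y - x) \<le> (LINT u:{x..y}|lborel. f u)" "(LINT u:{x..y}|lborel. f u) \<le> b * (y - x)"
proof -
  have c: "set_integrable lborel {x..y} (\<lambda>_. d::real)" for d unfolding set_integrable_def by simp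
  have eq: "(LINT u:{x..y}|lborel. d) = d * (y - x)" for d :: real
    using xy by (simp add: set_lebesgue_integral_def)
  show "a * (y - x) \<le> (LINT u:{x..y}|lborel. f u)"
    using set_integral_mono[OF c int, of a] b unfolding eq by simp
  show "(LINT u:{x..y}|lborel. f u) \<le> b * (y - x)"
    using set_integral_mono[OF int c, of b] b unfolding eq by simp
qed

text \<open>\<open>\<psi> u\<close> is the length of the set of levels \<open>s\<close> with
  \<open>0 \<le> s < \<psi> u\<close>; interchanging the two integrals leaves measures of superlevel
  sets.\<close>

lemma integral_layer_cake:
  fixes \<psi> :: "real \<Rightarrow> real"
  assumes fin: "finite_measure \<nu>" and sets: "sets \<nu> = sets borel"
    and \<psi>: "mono \<psi>" "\<And>u. 0 \<le> \<psi> u" "\<And>u. \<psi> u \<le> A"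
  shows "integrable lborel (\<lambda>s. indicator {0..<A} s * measure \<nu> {u\<in>{l..r}. s < \<psi> u})"
    and "(LINT u|\<nu>. indicator {l..r} u * \<psi> u)
         = (LINT s|lborel. indicator {0..<A} s * measure \<nu> {u\<in>{l..r}. s < \<psi> u})"
proof -
  interpret \<nu>: finite_measure \<nu> by fact
  interpret pair_sigma_finite \<nu> "lborel :: real measure" ..
  note sets[measurable_cong]
  have space: "space \<nu> = UNIV" using sets_eq_imp_space_eq[OF sets] by simp
  have [measurable]: "\<psi> \<in> borel_measurable borel" using \<psi>(1) by (rule borel_measurable_mono)
  let ?f = "\<lambda>u s. (if l \<le> u \<and> u \<le> r \<and> 0 \<le> s \<and> s < \<psi> u then 1 else 0 :: real)"
  have meas: "(\<lambda>(u, s). ?f u s) \<in> borel_measurable (\<nu> \<Otimes>\<^sub>M lborel)" by measurable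
  have f1: "?f u s = indicator {l..r} u * indicator {0..<\<psi> u} s" for u s by (auto simp: indicator_def)
  have f2: "?f u s = indicator {0..<A} s * indicator {u\<in>{l..r}. s < \<psi> u} u" for u s
    using \<psi>(3)[of u] by (auto simp: indicator_def)
  have int_u: "(LINT s|lborel. ?f u s) = indicator {l..r} u * \<psi> u" for u
    unfolding f1 using \<psi>(2) by simp
  have int: "integrable (\<nu> \<Otimes>\<^sub>M lborel) (\<lambda>(u, s). ?f u s)"
  proof (rule Fubini_integrable[OF meas])
    have "norm (?f u s) = ?f u s" for u s by simp
    then have eq: "(LINT s|lborel. norm (case (u, s) of (u, s) \<Rightarrow> ?f u s)) = indicator {l..r} u * \<psi> u" for u
      using int_u[of u] by simp
    show "integrable \<nu> (\<lambda>u. LINT s|lborel. norm (case (u, s) of (u, s) \<Rightarrow> ?f u s))"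
      unfolding eq using \<psi>
      by (intro \<nu>.integrable_const_bound[where B = A]) (auto simp: indicator_def intro: order_trans)
    show "AE u in \<nu>. integrable lborel (\<lambda>s. case (u, s) of (u, s) \<Rightarrow> ?f u s)"
      unfolding prod.case f1 by (intro AE_I2 integrable_mult_right) simp
  qed
  have int_s: "(LINT u|\<nu>. ?f u s) = indicator {0..<A} s * measure \<nu> {u\<in>{l..r}. s < \<psi> u}" for s
    unfolding f2 using space by simp
  show "integrable lborel (\<lambda>s. indicator {0..<A} s * measure \<nu> {u\<in>{l..r}. s < \<psi> u})"
    using integrable_snd[OF int] unfolding int_s .
  show "(LINT u|\<nu>. indicator {l..r} u * \<psi> u)
      = (LINT s|lborel. indicator {0..<A} s * measure \<nu> {u\<in>{l..r}. s < \<psi> u})"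
    using Fubini_integral[OF int] unfolding int_u int_s by simp
qed

text \<open>Only superlevel sets matter, and those of a nondecreasing function are closed upwards in
  \<open>{l..r}\<close>. Closeness of the measures on such sets is integrated over levels in
  \<open>{0..<A}\<close>.\<close>

lemma integral_mono_diff_le:
  fixes \<psi> :: "real \<Rightarrow> real"
  assumes fin: "finite_measure \<nu>1" "finite_measure \<nu>2" and sets: "sets \<nu>1 = sets borel" "sets \<nu>2 = sets borel"
    and \<psi>: "mono \<psi>" "\<And>u. 0 \<le> \<psi> u" "\<And>u. \<psi> u \<le> A"
    and up: "\<And>H. H \<subseteq> {l..r} \<Longrightarrow> H \<in> sets borel \<Longrightarrow> (\<And>u v. u \<in> H \<Longrightarrow> u \<le> v \<Longrightarrow> v \<le> r \<Longrightarrow> v \<in> H) \<Longrightarrow>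
              \<bar>measure \<nu>1 H - measure \<nu>2 H\<bar> \<le> \<gamma>"
  shows "\<bar>(LINT u|\<nu>1. indicator {l..r} u * \<psi> u) - (LINT u|\<nu>2. indicator {l..r} u * \<psi> u)\<bar> \<le> A * \<gamma>"
proof -
  have [measurable]: "\<psi> \<in> borel_measurable borel" using \<psi>(1) by (rule borel_measurable_mono)
  have A: "0 \<le> A" using \<psi>(2,3) order_trans by blast
  note 1 = integral_layer_cake[OF fin(1) sets(1) \<psi>, of l r]
  note 2 = integral_layer_cake[OF fin(2) sets(2) \<psi>, of l r]
  have eq: "(LINT u|\<nu>1. indicator {l..r} u * \<psi> u) - (LINT u|\<nu>2. indicator {l..r} u * \<psi> u)
     = (LINT s|lborel. indicator {0..<A} s * measure \<nu>1 {u\<in>{l..r}. s < \<psi> u}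
          - indicator {0..<A} s * measure \<nu>2 {u\<in>{l..r}. s < \<psi> u})"
    unfolding 1(2) 2(2) by (rule Bochner_Integration.integral_diff[OF 1(1) 2(1), symmetric])
  have "\<bar>LINT s|lborel. indicator {0..<A} s * measure \<nu>1 {u\<in>{l..r}. s < \<psi> u}
          - indicator {0..<A} s * measure \<nu>2 {u\<in>{l..r}. s < \<psi> u}\<bar> \<le> (LINT s|lborel. indicator {0..<A} s * \<gamma>)"
    unfolding real_norm_def[symmetric]
  proof (rule integral_norm_bound[THEN order_trans], rule Bochner_Integration.integral_mono)
    show "integrable lborel (\<lambda>s. norm (indicator {0..<A} s * measure \<nu>1 {u\<in>{l..r}. s < \<psi> u}
          - indicator {0..<A} s * measure \<nu>2 {u\<in>{l..r}. s < \<psi> u}))"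
      by (intro integrable_norm Bochner_Integration.integrable_diff 1(1) 2(1))
    show "integrable lborel (\<lambda>s. indicator {0..<A} s * \<gamma>)" by simp
    fix s
    have "\<bar>measure \<nu>1 {u\<in>{l..r}. s < \<psi> u} - measure \<nu>2 {u\<in>{l..r}. s < \<psi> u}\<bar> \<le> \<gamma>"
      by (rule up) (use monoD[OF \<psi>(1)] in \<open>force+\<close>)
    then show "norm (indicator {0..<A} s * measure \<nu>1 {u\<in>{l..r}. s < \<psi> u}
          - indicator {0..<A} s * measure \<nu>2 {u\<in>{l..r}. s < \<psi> u}) \<le> indicator {0..<A} s * \<gamma>"
      by (simp add: indicator_def)
  qed
  also have "\<dots> = A * \<gamma>" using A by simp
  finally show ?thesis unfolding eq .
qed

definition empirical_error :: "nat \<Rightarrow> (nat \<Rightarrow> real) \<Rightarrow> (real \<Rightarrow> real) \<Rightarrow> real \<Rightarrow> real \<Rightarrow> real" where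
  "empirical_error n T g x y =
     \<bar>(real (count_le n T y) - real (count_le n T x)) / real n - (LINT u:{x..y}|lborel. g u)\<bar>"

text \<open>The point \<open>l0\<close> to the left of \<open>l\<close> leaves room to enclose a set
  containing its left end point in a slightly larger half-open interval.\<close>

locale empirical_close =
  fixes n :: nat and T :: "nat \<Rightarrow> real" and g :: "real \<Rightarrow> real" and l0 l r L \<gamma> :: real
  assumes n: "0 < n" and l0: "l0 < l" and lr: "l \<le> r"
    and g_meas [measurable]: "g \<in> borel_measurable borel"
    and g_nonneg: "\<And>x. x \<in> {l0..r} \<Longrightarrow> 0 \<le> g x" and g_le: "\<And>x. x \<in> {l0..r} \<Longrightarrow> g x \<le> L"
    and \<gamma>: "0 < \<gamma>"
    and close: "\<And>x y. l0 \<le> x \<Longrightarrow> x \<le> y \<Longrightarrow> y \<le> r \<Longrightarrow>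
      empirical_error n T g x y \<le> \<gamma>"
begin

text \<open>The empirical measure of the times, and the measure with density \<open>g\<close> cut
  down to \<open>{l0..r}\<close>, where \<open>g\<close> is known to be bounded. The two are
  compared only on sets inside this region.\<close>

definition \<nu>1 :: "real measure" where "\<nu>1 = distr (uniform_count_measure {..<n}) borel T"
definition \<nu>2 :: "real measure" where "\<nu>2 = density lborel (\<lambda>u. ennreal (indicator {l0..r} u * g u))"

abbreviation g_integral :: "(real \<Rightarrow> real) \<Rightarrow> real" where
  "g_integral \<psi> \<equiv> (LINT u|lborel. indicator {l..r} u * (\<psi> u * g u))"

abbreviation g_integrable :: "(real \<Rightarrow> real) \<Rightarrow> bool" where
  "g_integrable \<psi> \<equiv> integrable lborel (\<lambda>u. indicator {l..r} u * (\<psi> u * g u))"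

definition discrepancy :: "(real \<Rightarrow> real) \<Rightarrow> real" where
  "discrepancy \<psi> = (\<Sum>i<n. indicator {l..r} (T i) * \<psi> (T i)) / real n
     - g_integral \<psi>"

lemma gi_nonneg: "0 \<le> indicator {l0..r} u * g u"
  using g_nonneg[of u] by (auto simp: indicator_def)

lemma integrable_gi: "integrable lborel (\<lambda>u. indicator {l0..r} u * g u)"
proof (rule Bochner_Integration.integrable_bound)
  show "integrable lborel (\<lambda>u. indicator {l0..r} u * L)" by simp
  show "AE u in lborel. norm (indicator {l0..r} u * g u) \<le> norm (indicator {l0..r} u * L)"
    using g_nonneg g_le by (intro AE_I2) (force simp: indicator_def)
qed simp

lemma finite_\<nu>: "finite_measure \<nu>1" "finite_measure \<nu>2"
proof -
  interpret u: prob_space "uniform_count_measure {..<n}"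
    using n by (intro prob_space_uniform_count_measure) auto
  have T: "T \<in> uniform_count_measure {..<n} \<rightarrow>\<^sub>M borel" by (simp add: measurable_def space_uniform_count_measure sets_uniform_count_measure)
  show "finite_measure \<nu>1" unfolding \<nu>1_def by (intro u.finite_measure_distr T)
  show "finite_measure \<nu>2"
    unfolding \<nu>2_def using integrable_gi gi_nonneg
    by (intro finite_measureI) (simp add: emeasure_density nn_integral_eq_integral)
qed

lemma sets_\<nu>: "sets \<nu>1 = sets borel" "sets \<nu>2 = sets borel"
  by (auto simp: \<nu>1_def \<nu>2_def)

lemma integral_\<nu>1: "f \<in> borel_measurable borel \<Longrightarrow> (LINT u|\<nu>1. f u) = (\<Sum>i<n. f (T i)) / real n"
  unfolding \<nu>1_def
  by (subst integral_distr) (auto simp: integral_uniform_count_measure measurable_def space_uniform_count_measure sets_uniform_count_measure)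

lemma integral_\<nu>2: "f \<in> borel_measurable borel \<Longrightarrow> (LINT u|\<nu>2. f u) = (LINT u|lborel. (indicator {l0..r} u * g u) * f u)"
  unfolding \<nu>2_def using gi_nonneg by (subst integral_density) auto

lemma measure_\<nu>1_Ioc: "x \<le> y \<Longrightarrow> measure \<nu>1 {x<..y} = (real (count_le n T y) - real (count_le n T x)) / real n"
proof -
  assume xy: "x \<le> y"
  interpret finite_measure \<nu>1 by (rule finite_\<nu>)
  have "measure \<nu>1 {x<..y} = (LINT u|\<nu>1. indicator {x<..y} u)" by (simp add: \<nu>1_def)
  also have "\<dots> = (\<Sum>i<n. indicator {x<..y} (T i)) / real n" by (rule integral_\<nu>1) simp
  also have "(\<Sum>i<n. indicator {x<..y} (T i)) = (\<Sum>i<n. indicator {i. T i \<le> y} i - indicator {i. T i \<le> x} i :: real)"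
    using xy by (intro sum.cong) (auto simp: indicator_def)
  also have "\<dots> = real (count_le n T y) - real (count_le n T x)"
    unfolding sum_subtractf count_le_def
    by (simp add: sum.If_cases indicator_def Int_def lessThan_def)
  finally show ?thesis .
qed

lemma measure_\<nu>2_Ioc: "l0 \<le> x \<Longrightarrow> x \<le> y \<Longrightarrow> y \<le> r \<Longrightarrow> measure \<nu>2 {x<..y} = (LINT u:{x..y}|lborel. g u)"
proof -
  assume xy: "l0 \<le> x" "x \<le> y" "y \<le> r"
  have "measure \<nu>2 {x<..y} = (LINT u|\<nu>2. indicator {x<..y} u)" by (simp add: \<nu>2_def)
  also have "\<dots> = (LINT u|lborel. (indicator {l0..r} u * g u) * indicator {x<..y} u)" by (rule integral_\<nu>2) simp
  also have "\<dots> = (LINT u|lborel. indicator {x..y} u * g u)"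
  proof (rule integral_cong_AE)
    show "AE u in lborel. (indicator {l0..r} u * g u) * indicator {x<..y} u = indicator {x..y} u * g u"
      using AE_lborel_singleton[of x] by eventually_elim (use xy in \<open>auto simp: indicator_def\<close>)
  qed auto
  finally show ?thesis by (simp add: set_lebesgue_integral_def)
qed

lemma close_Ioc: "l0 \<le> x \<Longrightarrow> x \<le> y \<Longrightarrow> y \<le> r \<Longrightarrow> \<bar>measure \<nu>1 {x<..y} - measure \<nu>2 {x<..y}\<bar> \<le> \<gamma>"
  using close by (simp add: measure_\<nu>1_Ioc measure_\<nu>2_Ioc empirical_error_def)

lemma measure_\<nu>2_Ioc_le: "l0 \<le> x \<Longrightarrow> x \<le> y \<Longrightarrow> y \<le> r \<Longrightarrow> measure \<nu>2 {x<..y} \<le> L * (y - x)"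
proof -
  assume xy: "l0 \<le> x" "x \<le> y" "y \<le> r"
  have "set_integrable lborel {l0..r} g" using integrable_gi by (simp add: set_integrable_def)
  then have "set_integrable lborel {x..y} g" by (rule set_integrable_subset) (use xy in auto)
  from set_integral_bounds(2)[OF this xy(2), of 0 L] show ?thesis
    using xy g_nonneg g_le by (simp add: measure_\<nu>2_Ioc)
qed

text \<open>Such a set is an interval with right end \<open>r\<close> whose left end
  \<open>v\<close> may or may not belong to it. It is squeezed between \<open>{v<..r}\<close> and a
  half-open interval starting slightly earlier; the extra mass under \<open>\<nu>2\<close> costs the
  second \<gamma>.\<close>

lemma close_up:
  assumes H: "H \<subseteq> {l..r}" "H \<in> sets borel" "\<And>u v. u \<in> H \<Longrightarrow> u \<le> v \<Longrightarrow> v \<le> r \<Longrightarrow> v \<in> H"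
  shows "\<bar>measure \<nu>1 H - measure \<nu>2 H\<bar> \<le> 2 * \<gamma>"
proof (cases "H = {}")
  case False
  interpret \<nu>1: finite_measure \<nu>1 by (rule finite_\<nu>)
  interpret \<nu>2: finite_measure \<nu>2 by (rule finite_\<nu>)
  note [simp] = sets_\<nu>
  define v where "v = Inf H"
  have bdd: "bdd_below H" using H(1) by (meson bdd_below_Icc bdd_below_mono)
  have v: "l \<le> v" "v \<le> r"
    using H(1) False bdd unfolding v_def by (force intro: cInf_greatest cInf_lower2)+
  have L0: "0 \<le> L" using g_nonneg[of l] g_le[of l] l0 lr by simp
  \<comment> \<open>Short enough to stay to the right of \<open>l0\<close> and to carry mass at most
    \<gamma>; \<open>L + 1\<close> avoids a division by zero.\<close>
  define \<eta> where "\<eta> = min (l - l0) (\<gamma> / (L + 1))"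
  have \<eta>: "0 < \<eta>" "\<eta> \<le> l - l0" using l0 \<gamma> L0 by (auto simp: \<eta>_def)
  have "L * \<eta> \<le> L * (\<gamma> / (L + 1))" using L0 by (intro mult_left_mono) (auto simp: \<eta>_def)
  also have "\<dots> \<le> \<gamma>" using L0 \<gamma> by (simp add: field_simps)
  finally have L\<eta>: "L * \<eta> \<le> \<gamma>" .
  have sub1: "{v<..r} \<subseteq> H"
  proof
    fix u assume u: "u \<in> {v<..r}"
    then obtain h where "h \<in> H" "h < u" using cInf_less_iff[OF False bdd, of u] by (auto simp: v_def)
    then show "u \<in> H" using H(3)[of h u] u by auto
  qed
  have sub2: "H \<subseteq> {v - \<eta><..r}"
  proof
    fix u assume "u \<in> H"
    then show "u \<in> {v - \<eta><..r}" using cInf_lower[OF _ bdd, of u] H(1) \<eta> by (auto simp: v_def)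
  qed
  have split: "measure \<nu>2 {v - \<eta><..r} = measure \<nu>2 {v - \<eta><..v} + measure \<nu>2 {v<..r}"
  proof -
    have "{v - \<eta><..r} = {v - \<eta><..v} \<union> {v<..r}" using v \<eta> by auto
    then show ?thesis by (simp, intro \<nu>2.finite_measure_Union) auto
  qed
  have "measure \<nu>2 {v - \<eta><..v} \<le> \<gamma>"
    using measure_\<nu>2_Ioc_le[of "v - \<eta>" v] v \<eta> L\<eta> by auto
  moreover have "measure \<nu>1 {v<..r} \<le> measure \<nu>1 H" "measure \<nu>2 {v<..r} \<le> measure \<nu>2 H"
    "measure \<nu>1 H \<le> measure \<nu>1 {v - \<eta><..r}" "measure \<nu>2 H \<le> measure \<nu>2 {v - \<eta><..r}"
    using sub1 sub2 H(2) by (auto intro: \<nu>1.finite_measure_mono \<nu>2.finite_measure_mono)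
  moreover have "\<bar>measure \<nu>1 {v<..r} - measure \<nu>2 {v<..r}\<bar> \<le> \<gamma>"
    "\<bar>measure \<nu>1 {v - \<eta><..r} - measure \<nu>2 {v - \<eta><..r}\<bar> \<le> \<gamma>"
    using v \<eta> l0 by (auto intro!: close_Ioc)
  ultimately show ?thesis using split by linarith
qed (use \<gamma> in simp)

text \<open>A globally monotone extension is automatically Borel measurable, which monotonicity on
  the interval alone would not give.\<close>

lemma mono_on_cong_clamp:
  assumes "mono_on {l..r} \<psi>"
  obtains \<psi>' where "mono \<psi>'" "\<And>u. u \<in> {l..r} \<Longrightarrow> \<psi>' u = \<psi> u" "\<And>u. \<exists>v\<in>{l..r}. \<psi>' u = \<psi> v"
proof
  let ?c = "\<lambda>u. max l (min r u)"
  show "mono (\<lambda>u. \<psi> (?c u))"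
    using lr by (intro monoI mono_onD[OF assms]) auto
  show "\<psi> (?c u) = \<psi> u" if "u \<in> {l..r}" for u using that by simp
  show "\<exists>v\<in>{l..r}. \<psi> (?c u) = \<psi> v" for u using lr by (intro bexI[of _ "?c u"]) auto
qed

lemma integrable_mono_on:
  assumes "mono_on {l..r} \<psi>" "\<And>u. u \<in> {l..r} \<Longrightarrow> \<psi> u \<in> {0..A}"
  shows "g_integrable \<psi>"
proof -
  obtain \<psi>' where \<psi>': "mono \<psi>'" "\<And>u. u \<in> {l..r} \<Longrightarrow> \<psi>' u = \<psi> u" using mono_on_cong_clamp[OF assms(1)] by metis
  have [measurable]: "\<psi>' \<in> borel_measurable borel" using \<psi>'(1) by (rule borel_measurable_mono)
  have "g_integrable \<psi>'"
  proof (rule Bochner_Integration.integrable_bound)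
    show "integrable lborel (\<lambda>u. A * (indicator {l0..r} u * g u))" using integrable_gi by simp
    show "AE u in lborel. norm (indicator {l..r} u * (\<psi>' u * g u)) \<le> norm (A * (indicator {l0..r} u * g u))"
    proof (intro AE_I2)
      fix u show "norm (indicator {l..r} u * (\<psi>' u * g u)) \<le> norm (A * (indicator {l0..r} u * g u))"
        using assms(2)[of u] \<psi>'(2)[of u] l0 by (auto simp: indicator_def abs_mult intro!: mult_right_mono)
    qed
  qed simp
  also have "(\<lambda>u. indicator {l..r} u * (\<psi>' u * g u)) = (\<lambda>u. indicator {l..r} u * (\<psi> u * g u))"
    using \<psi>'(2) by (auto simp: indicator_def fun_eq_iff)
  finally show ?thesis .
qed

lemma discrepancy_mono_le:
  assumes "mono_on {l..r} \<psi>" "\<And>u. u \<in> {l..r} \<Longrightarrow> \<psi> u \<in> {0..A}"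
  shows "\<bar>discrepancy \<psi>\<bar> \<le> 2 * A * \<gamma>"
proof -
  obtain \<psi>' where \<psi>': "mono \<psi>'" "\<And>u. u \<in> {l..r} \<Longrightarrow> \<psi>' u = \<psi> u" "\<And>u. \<exists>v\<in>{l..r}. \<psi>' u = \<psi> v"
    using mono_on_cong_clamp[OF assms(1)] by metis
  have [measurable]: "\<psi>' \<in> borel_measurable borel" using \<psi>'(1) by (rule borel_measurable_mono)
  have bounds: "0 \<le> \<psi>' u" "\<psi>' u \<le> A" for u using \<psi>'(3)[of u] assms(2) by auto
  have "\<bar>(LINT u|\<nu>1. indicator {l..r} u * \<psi>' u) - (LINT u|\<nu>2. indicator {l..r} u * \<psi>' u)\<bar> \<le> A * (2 * \<gamma>)"
    by (rule integral_mono_diff_le[OF finite_\<nu> sets_\<nu> \<psi>'(1) bounds close_up])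
  moreover have "(LINT u|\<nu>1. indicator {l..r} u * \<psi>' u) = (\<Sum>i<n. indicator {l..r} (T i) * \<psi> (T i)) / real n"
  proof -
    have "(\<Sum>i<n. indicator {l..r} (T i) * \<psi>' (T i)) = (\<Sum>i<n. indicator {l..r} (T i) * \<psi> (T i))"
      by (intro sum.cong) (auto simp: indicator_def \<psi>'(2))
    then show ?thesis by (simp add: integral_\<nu>1)
  qed
  moreover have "(LINT u|\<nu>2. indicator {l..r} u * \<psi>' u) = g_integral \<psi>"
    by (subst integral_\<nu>2) (use l0 \<psi>'(2) in \<open>auto simp: indicator_def intro!: Bochner_Integration.integral_cong\<close>)
  ultimately show ?thesis by (simp add: discrepancy_def mult_ac)
qed

lemma discrepancy_diff:
  assumes "g_integrable \<psi>1"
    "g_integrable \<psi>2"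
  shows "discrepancy (\<lambda>u. \<psi>1 u - \<psi>2 u) = discrepancy \<psi>1 - discrepancy \<psi>2"
proof -
  have "g_integral (\<lambda>u. \<psi>1 u - \<psi>2 u)
     = (LINT u|lborel. indicator {l..r} u * (\<psi>1 u * g u) - indicator {l..r} u * (\<psi>2 u * g u))"
    by (intro Bochner_Integration.integral_cong) (auto simp: algebra_simps)
  also have "\<dots> = g_integral \<psi>1 - g_integral \<psi>2"
    by (rule Bochner_Integration.integral_diff[OF assms])
  finally show ?thesis
    by (simp add: discrepancy_def right_diff_distrib sum_subtractf diff_divide_distrib)
qed

lemma integrable_diff_mult_g:
  assumes "g_integrable \<psi>1"
    "g_integrable \<psi>2"
  shows "g_integrable (\<lambda>u. \<psi>1 u - \<psi>2 u)"
proof -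
  have "(\<lambda>u. indicator {l..r} u * ((\<psi>1 u - \<psi>2 u) * g u))
      = (\<lambda>u. indicator {l..r} u * (\<psi>1 u * g u) - indicator {l..r} u * (\<psi>2 u * g u))"
    by (auto simp: algebra_simps)
  then show ?thesis using Bochner_Integration.integrable_diff[OF assms] by simp
qed

text \<open>
  Adding \<open>\<Lambda> * (u - l)\<close> makes \<open>\<phi>\<close> nondecreasing, so the product is a combination of four nonnegative
  nondecreasing functions.
\<close>
lemma discrepancy_lipschitz_mult_le:
  assumes \<phi>: "\<And>u. u \<in> {l..r} \<Longrightarrow> \<phi> u \<in> {0..\<Phi>}"
      "\<And>u v. u \<in> {l..r} \<Longrightarrow> v \<in> {l..r} \<Longrightarrow> u \<le> v \<Longrightarrow> \<phi> u - \<phi> v \<le> \<Lambda> * (v - u)" "0 \<le> \<Lambda>"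
    and U: "mono_on {l..r} U1" "mono_on {l..r} U2"
      "\<And>u. u \<in> {l..r} \<Longrightarrow> U1 u \<in> {0..V}" "\<And>u. u \<in> {l..r} \<Longrightarrow> U2 u \<in> {0..V}"
  shows "\<bar>discrepancy (\<lambda>u. \<phi> u * (U1 u - U2 u))\<bar> \<le> 8 * (\<Phi> + \<Lambda> * (r - l)) * V * \<gamma>"
    and "g_integrable (\<lambda>u. \<phi> u * (U1 u - U2 u))"
proof -
  define \<phi>1 \<phi>2 where "\<phi>1 u = \<phi> u + \<Lambda> * (u - l)" and "\<phi>2 u = \<Lambda> * (u - l)" for u
  define A where "A = \<Phi> + \<Lambda> * (r - l)"
  have b1: "\<phi>1 u \<in> {0..A}" if "u \<in> {l..r}" for u
    using \<phi>(1)[OF that] \<phi>(3) that unfolding \<phi>1_def A_def by (auto intro!: add_mono mult_left_mono)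
  have b2: "\<phi>2 u \<in> {0..A}" if "u \<in> {l..r}" for u
    using \<phi>(1)[OF that] \<phi>(3) that unfolding \<phi>2_def A_def
    by (auto intro!: add_increasing mult_left_mono)
  have m1: "mono_on {l..r} \<phi>1" using \<phi>(2) by (intro mono_onI) (force simp: \<phi>1_def algebra_simps)
  have m2: "mono_on {l..r} \<phi>2" using \<phi>(3) by (intro mono_onI) (auto simp: \<phi>2_def intro!: mult_left_mono)
  have main: "mono_on {l..r} (\<lambda>u. p u * U u)" "\<And>u. u \<in> {l..r} \<Longrightarrow> p u * U u \<in> {0..A * V}"
    if "mono_on {l..r} p" "\<And>u. u \<in> {l..r} \<Longrightarrow> p u \<in> {0..A}" "mono_on {l..r} U" "\<And>u. u \<in> {l..r} \<Longrightarrow> U u \<in> {0..V}" for p U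
  proof -
    show "mono_on {l..r} (\<lambda>u. p u * U u)"
    proof (rule mono_onI)
      fix u v assume uv: "u \<in> {l..r}" "v \<in> {l..r}" "u \<le> v"
      show "p u * U u \<le> p v * U v"
        using mono_onD[OF that(1) uv] mono_onD[OF that(3) uv] that(2)[OF uv(1)] that(2)[OF uv(2)] that(4)[OF uv(1)]
        by (intro mult_mono) auto
    qed
    show "p u * U u \<in> {0..A * V}" if u: "u \<in> {l..r}" for u
      using \<open>\<And>u. u \<in> {l..r} \<Longrightarrow> p u \<in> {0..A}\<close>[OF u] \<open>\<And>u. u \<in> {l..r} \<Longrightarrow> U u \<in> {0..V}\<close>[OF u] by (auto intro!: mult_mono)
  qed
  note m11 = main[OF m1 b1 U(1,3)] and m12 = main[OF m1 b1 U(2,4)]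
    and m21 = main[OF m2 b2 U(1,3)] and m22 = main[OF m2 b2 U(2,4)]
  note i11 = integrable_mono_on[OF m11] and i12 = integrable_mono_on[OF m12]
    and i21 = integrable_mono_on[OF m21] and i22 = integrable_mono_on[OF m22]
  have eq: "\<phi> u * (U1 u - U2 u) = (\<phi>1 u * U1 u - \<phi>1 u * U2 u) - (\<phi>2 u * U1 u - \<phi>2 u * U2 u)" for u
    by (simp add: \<phi>1_def \<phi>2_def algebra_simps)
  note d1 = integrable_diff_mult_g[OF i11 i12] and d2 = integrable_diff_mult_g[OF i21 i22]
  show "g_integrable (\<lambda>u. \<phi> u * (U1 u - U2 u))"
    unfolding eq by (rule integrable_diff_mult_g[OF d1 d2])
  have "discrepancy (\<lambda>u. \<phi> u * (U1 u - U2 u)) =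
     (discrepancy (\<lambda>u. \<phi>1 u * U1 u) - discrepancy (\<lambda>u. \<phi>1 u * U2 u))
      - (discrepancy (\<lambda>u. \<phi>2 u * U1 u) - discrepancy (\<lambda>u. \<phi>2 u * U2 u))"
    unfolding eq by (simp only: discrepancy_diff[OF d1 d2] discrepancy_diff[OF i11 i12] discrepancy_diff[OF i21 i22])
  moreover note discrepancy_mono_le[OF m11] discrepancy_mono_le[OF m12]
    discrepancy_mono_le[OF m21] discrepancy_mono_le[OF m22]
  \<comment> \<open>Four monotone pieces with error \<open>2 * (A * V) * \<gamma>\<close> each: the
    origin of the factor 8.\<close>
  ultimately have "\<bar>discrepancy (\<lambda>u. \<phi> u * (U1 u - U2 u))\<bar> \<le> 4 * (2 * (A * V) * \<gamma>)" by linarith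
  then show "\<bar>discrepancy (\<lambda>u. \<phi> u * (U1 u - U2 u))\<bar> \<le> 8 * (\<Phi> + \<Lambda> * (r - l)) * V * \<gamma>"
    by (simp add: A_def mult_ac)
qed

end

section \<open>Weighted sums of Bernoulli variables\<close>

lemma exp_minus_affine_error:
  fixes x :: real
  assumes "0 \<le> x"
  shows "\<bar>(1 - x) - exp (- x)\<bar> \<le> x\<^sup>2"
proof -
  have "1 - x \<le> exp (- x)" using exp_ge_add_one_self[of "-x"] by simp
  moreover have "exp (- x) \<le> 1 - x + x\<^sup>2"
  proof -
    have "exp (- x) * (1 + x) \<le> exp (- x) * exp x" using exp_ge_add_one_self[of x] by (intro mult_left_mono) auto
    then have "exp (- x) \<le> 1 / (1 + x)" using assms by (simp add: exp_minus field_simps)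
    also have "\<dots> \<le> 1 - x + x\<^sup>2" using assms by (simp add: field_simps power2_eq_square)
    finally show ?thesis .
  qed
  ultimately show ?thesis by auto
qed

definition bernoulli_product :: "(nat \<Rightarrow> real) \<Rightarrow> nat \<Rightarrow> (nat \<Rightarrow> bool) pmf" where
  "bernoulli_product p n = Pi_pmf {..<n} False (\<lambda>i. bernoulli_pmf (p i))"

context
  fixes p :: "nat \<Rightarrow> real" and n :: nat
  assumes p: "\<And>i. i < n \<Longrightarrow> p i \<in> {0..1}"
begin

lemma indep_vars_bernoulli_product:
  "prob_space.indep_vars (measure_pmf (bernoulli_product p n)) (\<lambda>_. borel)
     (\<lambda>i \<Delta>. (f i (\<Delta> i) :: real)) {..<n}"
  unfolding bernoulli_product_def
  by (rule prob_space.indep_vars_compose2[OF measure_pmf.prob_space_axioms indep_vars_Pi_pmf]) auto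

lemma expectation_bernoulli_product:
  assumes "i < n"
  shows "measure_pmf.expectation (bernoulli_product p n) (\<lambda>\<Delta>. f (\<Delta> i)) = p i * f True + (1 - p i) * (f False :: real)"
proof -
  have "measure_pmf.expectation (bernoulli_product p n) (\<lambda>\<Delta>. f (\<Delta> i))
      = measure_pmf.expectation (map_pmf (\<lambda>\<Delta>. \<Delta> i) (bernoulli_product p n)) f" by simp
  also have "map_pmf (\<lambda>\<Delta>. \<Delta> i) (bernoulli_product p n) = bernoulli_pmf (p i)"
    unfolding bernoulli_product_def using assms by (subst Pi_pmf_component) auto
  also have "measure_pmf.expectation (bernoulli_pmf (p i)) f = p i * f True + (1 - p i) * f False"
    using p[OF assms] by simp
  finally show ?thesis .
qed

text \<open>The summands have variance \<open>a i\<^sup>2 * p i * (1 - p i)\<close>, so this is Lindeberg's comparison with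
  the Gaussian for summands bounded by \<open>b\<close>.\<close>
lemma char_bernoulli_sum:
  fixes a :: "nat \<Rightarrow> real" and t b :: real
  assumes b: "\<And>i. i < n \<Longrightarrow> \<bar>a i\<bar> \<le> b" and v: "v = (\<Sum>i<n. (a i)\<^sup>2 * (p i * (1 - p i)))"
    and small: "t\<^sup>2 * b\<^sup>2 \<le> 2"
  shows "cmod (char (distr (measure_pmf (bernoulli_product p n)) borel (\<lambda>\<Delta>. \<Sum>i<n. a i * (of_bool (\<Delta> i) - p i))) t
            - exp (- (t\<^sup>2 * v / 2))) \<le> (\<bar>t\<bar> ^ 3 * b + t ^ 4 * b\<^sup>2) * v"
proof (cases "n = 0")
  case True
  have "char (distr (measure_pmf (bernoulli_product p n)) borel (\<lambda>\<Delta>. 0)) t = 1"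
    unfolding char_def by (subst integral_distr) auto
  with True show ?thesis by (simp add: v)
next
  case False
  have b0: "0 \<le> b" using b[of 0] False by simp
  define Y where "Y i \<Delta> = a i * (of_bool (\<Delta> i) - p i)" for i and \<Delta> :: "nat \<Rightarrow> bool"
  define w where "w i = (a i)\<^sup>2 * (p i * (1 - p i))" for i
  have w0: "0 \<le> w i" if "i < n" for i using p[OF that] by (simp add: w_def)
  have Y_bound: "\<bar>Y i \<Delta>\<bar> \<le> b" if "i < n" for i \<Delta>
  proof -
    have "\<bar>of_bool (\<Delta> i) - p i\<bar> \<le> (1::real)" using p[OF that] by (cases "\<Delta> i") auto
    then have "\<bar>a i\<bar> * \<bar>of_bool (\<Delta> i) - p i\<bar> \<le> b * 1" using b[OF that] by (intro mult_mono) auto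
    then show ?thesis by (simp add: Y_def abs_mult)
  qed
  have E1: "measure_pmf.expectation (bernoulli_product p n) (Y i) = 0" if "i < n" for i
    using expectation_bernoulli_product[OF that, of "\<lambda>x. a i * (of_bool x - p i)"]
    by (simp add: Y_def[abs_def] algebra_simps)
  have E2: "measure_pmf.expectation (bernoulli_product p n) (\<lambda>\<Delta>. (Y i \<Delta>)\<^sup>2) = w i" if "i < n" for i
    using expectation_bernoulli_product[OF that, of "\<lambda>x. (a i * (of_bool x - p i))\<^sup>2"]
    by (simp add: Y_def w_def algebra_simps power2_eq_square)
  have int: "integrable (measure_pmf (bernoulli_product p n)) (f :: (nat \<Rightarrow> bool) \<Rightarrow> real)" for f
  proof (rule integrable_measure_pmf_finite)
    show "finite (set_pmf (bernoulli_product p n))"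
      unfolding bernoulli_product_def by (rule finite_subset[OF set_Pi_pmf_subset']) (auto intro: finite_PiE_dflt)
  qed
  have w_le: "w i \<le> b\<^sup>2" if "i < n" for i
  proof -
    have "p i * (1 - p i) \<le> 1 * 1" using p[OF that] by (intro mult_mono) auto
    then have "w i \<le> (a i)\<^sup>2 * 1" unfolding w_def by (intro mult_left_mono) auto
    also have "(a i)\<^sup>2 \<le> b\<^sup>2" using b[OF that] by (metis abs_ge_zero power2_abs power_mono)
    finally show ?thesis by simp
  qed
  let ?ch = "\<lambda>i. char (distr (measure_pmf (bernoulli_product p n)) borel (Y i)) t"
  let ?q = "\<lambda>i. complex_of_real (1 - t\<^sup>2 * w i / 2)"
  let ?e = "\<lambda>i. complex_of_real (exp (- (t\<^sup>2 * w i / 2)))"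
  have ch: "char (distr (measure_pmf (bernoulli_product p n)) borel (\<lambda>\<Delta>. \<Sum>i<n. a i * (of_bool (\<Delta> i) - p i))) t
      = (\<Prod>i<n. ?ch i)"
    unfolding Y_def[abs_def]
    by (rule prob_space.char_distr_sum[OF measure_pmf.prob_space_axioms
          indep_vars_bernoulli_product[of "\<lambda>i x. a i * (of_bool x - p i)"]])
  \<comment> \<open>Comparing two products factor by factor needs all factors of modulus at most 1;
    the hypothesis \<open>small\<close> is there for this.\<close>
  have q1: "\<bar>1 - t\<^sup>2 * w i / 2\<bar> \<le> 1" if "i < n" for i
  proof -
    have "t\<^sup>2 * w i \<le> t\<^sup>2 * b\<^sup>2" using w_le[OF that] by (intro mult_left_mono) auto
    moreover have "0 \<le> t\<^sup>2 * w i" using w0[OF that] by simp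
    ultimately show ?thesis using small by (auto simp: abs_le_iff)
  qed
  have "cmod ((\<Prod>i<n. ?ch i) - (\<Prod>i<n. ?q i)) \<le> (\<Sum>i<n. cmod (?ch i - ?q i))"
  proof (rule norm_prod_diff)
    show "cmod (?ch i) \<le> 1" for i
      by (rule real_distribution.cmod_char_le_1) (auto intro!: prob_space.real_distribution_distr measure_pmf.prob_space_axioms)
    show "cmod (?q i) \<le> 1" if "i \<in> {..<n}" for i using q1[of i] that by (simp only: norm_of_real) simp
  qed
  also have "\<dots> \<le> (\<Sum>i<n. \<bar>t\<bar> ^ 3 * b * w i)"
  proof (rule sum_mono)
    fix i assume "i \<in> {..<n}"
    then have i: "i < n" by simp
    have "cmod (?ch i - (1 - t\<^sup>2 * w i / 2)) \<le> (t\<^sup>2 / 6) * measure_pmf.expectation (bernoulli_product p n) (\<lambda>x. min (6 * (Y i x)\<^sup>2) (\<bar>t\<bar> * \<bar>Y i x\<bar> ^ 3))"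
      by (rule prob_space.char_approx3'[OF measure_pmf.prob_space_axioms, where X = "Y i"]) (auto simp: int E1[OF i] E2[OF i])
    also have "measure_pmf.expectation (bernoulli_product p n) (\<lambda>x. min (6 * (Y i x)\<^sup>2) (\<bar>t\<bar> * \<bar>Y i x\<bar> ^ 3)) \<le> measure_pmf.expectation (bernoulli_product p n) (\<lambda>x. \<bar>t\<bar> * b * (Y i x)\<^sup>2)"
    proof (rule Bochner_Integration.integral_mono[OF int int])
      fix x
      have "\<bar>Y i x\<bar> ^ 3 = \<bar>Y i x\<bar> * (Y i x)\<^sup>2" by (simp add: power3_eq_cube power2_eq_square)
      also have "\<dots> \<le> b * (Y i x)\<^sup>2" using Y_bound[OF i] by (intro mult_right_mono) auto
      finally have "\<bar>t\<bar> * \<bar>Y i x\<bar> ^ 3 \<le> \<bar>t\<bar> * (b * (Y i x)\<^sup>2)" by (intro mult_left_mono) auto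
      then show "min (6 * (Y i x)\<^sup>2) (\<bar>t\<bar> * \<bar>Y i x\<bar> ^ 3) \<le> \<bar>t\<bar> * b * (Y i x)\<^sup>2" by (simp add: mult.assoc)
    qed
    also have "\<dots> = \<bar>t\<bar> * b * w i" using E2[OF i] by simp
    finally have "cmod (?ch i - (1 - t\<^sup>2 * w i / 2)) \<le> t\<^sup>2 / 6 * (\<bar>t\<bar> * b * w i)"
      by (simp add: mult_left_mono)
    also have "\<dots> = \<bar>t\<bar> ^ 3 * b * w i / 6"
      by (simp add: power3_eq_cube power2_eq_square flip: abs_mult)
    also have "\<dots> \<le> \<bar>t\<bar> ^ 3 * b * w i" using b0 w0[OF i] by simp
    finally show "cmod (?ch i - ?q i) \<le> \<bar>t\<bar> ^ 3 * b * w i" by simp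
  qed
  finally have 1: "cmod ((\<Prod>i<n. ?ch i) - (\<Prod>i<n. ?q i)) \<le> \<bar>t\<bar> ^ 3 * b * v"
    by (simp add: v w_def sum_distrib_left)
  have "cmod ((\<Prod>i<n. ?q i) - (\<Prod>i<n. ?e i)) \<le> (\<Sum>i<n. cmod (?q i - ?e i))"
  proof (rule norm_prod_diff)
    show "cmod (?q i) \<le> 1" if "i \<in> {..<n}" for i using q1[of i] that by (simp only: norm_of_real) simp
    show "cmod (?e i) \<le> 1" if "i \<in> {..<n}" for i using w0[of i] that by (simp only: norm_of_real) simp
  qed
  also have "\<dots> \<le> (\<Sum>i<n. t ^ 4 * b\<^sup>2 * w i)"
  proof (rule sum_mono)
    fix i assume "i \<in> {..<n}"
    then have i: "i < n" by simp
    have "cmod (?q i - ?e i) = \<bar>(1 - t\<^sup>2 * w i / 2) - exp (- (t\<^sup>2 * w i / 2))\<bar>"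
      by (simp only: norm_of_real flip: of_real_diff)
    also have "\<dots> \<le> (t\<^sup>2 * w i / 2)\<^sup>2" using w0[OF i] by (intro exp_minus_affine_error) simp
    also have "\<dots> = t ^ 4 * (w i * w i) / 4" by (simp add: power2_eq_square power4_eq_xxxx)
    also have "\<dots> \<le> t ^ 4 * (b\<^sup>2 * w i) / 1"
      using w0[OF i] w_le[OF i] by (intro frac_le mult_left_mono mult_right_mono) auto
    finally show "cmod (?q i - ?e i) \<le> t ^ 4 * b\<^sup>2 * w i" by (simp add: mult.assoc)
  qed
  finally have 2: "cmod ((\<Prod>i<n. ?q i) - (\<Prod>i<n. ?e i)) \<le> t ^ 4 * b\<^sup>2 * v"
    by (simp add: v w_def sum_distrib_left)
  have "(\<Prod>i<n. ?e i) = complex_of_real (exp (\<Sum>i<n. - (t\<^sup>2 * w i / 2)))"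
    by (simp add: exp_sum)
  also have "(\<Sum>i<n. - (t\<^sup>2 * w i / 2)) = - (t\<^sup>2 * v / 2)"
    by (simp add: v w_def sum_negf sum_distrib_left sum_divide_distrib)
  finally have 3: "(\<Prod>i<n. ?e i) = complex_of_real (exp (- (t\<^sup>2 * v / 2)))" .
  have "cmod ((\<Prod>i<n. ?ch i) - (\<Prod>i<n. ?e i))
      \<le> cmod ((\<Prod>i<n. ?ch i) - (\<Prod>i<n. ?q i)) + cmod ((\<Prod>i<n. ?q i) - (\<Prod>i<n. ?e i))"
    by (rule order_trans[OF _ norm_triangle_ineq]) simp
  also have "\<dots> \<le> (\<bar>t\<bar> ^ 3 * b + t ^ 4 * b\<^sup>2) * v" using 1 2 by (simp add: distrib_right)
  finally show ?thesis unfolding ch 3 .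
qed

end

text \<open>The linearization holds only on an event: there \<open>iexp\<close> is 1-Lipschitz, and
  elsewhere two numbers of modulus 1 differ by at most 2.\<close>

lemma char_diff_le:
  fixes Z Z' :: "'a \<Rightarrow> real"
  assumes close: "\<And>x. x \<in> A \<Longrightarrow> \<bar>Z x - Z' x\<bar> \<le> \<rho>" and \<rho>: "0 \<le> \<rho>"
  shows "cmod (char (distr (measure_pmf q) borel Z) t - char (distr (measure_pmf q) borel Z') t)
         \<le> \<bar>t\<bar> * \<rho> + 2 * measure_pmf.prob q (- A)"
proof -
  have int: "integrable (measure_pmf q) (\<lambda>x. iexp (t * W x))" for W
    by (rule measure_pmf.integrable_const_bound[where B = 1]) auto
  have "char (distr (measure_pmf q) borel Z) t - char (distr (measure_pmf q) borel Z') t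
      = measure_pmf.expectation q (\<lambda>x. iexp (t * Z x) - iexp (t * Z' x))"
    unfolding char_def by (simp add: integral_distr Bochner_Integration.integral_diff int[simplified])
  also have "cmod \<dots> \<le> measure_pmf.expectation q (\<lambda>x. \<bar>t\<bar> * \<rho> + 2 * indicator (- A) x)"
  proof (rule order_trans[OF integral_norm_bound Bochner_Integration.integral_mono])
    show "integrable (measure_pmf q) (\<lambda>x. cmod (iexp (t * Z x) - iexp (t * Z' x)))"
      by (intro integrable_norm Bochner_Integration.integrable_diff int)
    show "integrable (measure_pmf q) (\<lambda>x. \<bar>t\<bar> * \<rho> + 2 * indicator (- A) x)"
      by (rule measure_pmf.integrable_const_bound[where B = "\<bar>t\<bar> * \<rho> + 2"]) (use \<rho> in \<open>auto simp: indicator_def\<close>)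
    fix x
    show "cmod (iexp (t * Z x) - iexp (t * Z' x)) \<le> \<bar>t\<bar> * \<rho> + 2 * indicator (- A) x"
    proof (cases "x \<in> A")
      case True
      have "iexp (t * Z x) - iexp (t * Z' x) = iexp (t * Z' x) * (iexp (t * (Z x - Z' x)) - 1)"
        by (simp add: algebra_simps flip: exp_add)
      also have "cmod \<dots> = cmod (iexp (t * (Z x - Z' x)) - 1)" by (simp add: norm_mult)
      also have "\<dots> \<le> \<bar>t * (Z x - Z' x)\<bar>" using iexp_approx1[of "t * (Z x - Z' x)" 0] by simp
      also have "\<dots> \<le> \<bar>t\<bar> * \<rho>" using close[OF True] by (simp add: abs_mult mult_left_mono)
      finally show ?thesis using True by simp
    next
      case False
      have "cmod (iexp (t * Z x) - iexp (t * Z' x)) \<le> 1 + 1"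
        by (rule order_trans[OF norm_triangle_ineq4]) simp
      then show ?thesis using False \<rho> by (simp add: add_increasing)
    qed
  qed
  also have "\<dots> = \<bar>t\<bar> * \<rho> + 2 * measure_pmf.prob q (- A)"
  proof -
    have "integrable (measure_pmf q) (\<lambda>x. 2 * indicator (- A) x :: real)"
      by (rule measure_pmf.integrable_const_bound[where B = 2]) (auto simp: indicator_def)
    then show ?thesis by (subst Bochner_Integration.integral_add) auto
  qed
  finally show ?thesis .
qed

lemma char_normal:
  assumes "0 < \<sigma>"
  shows "char (density lborel (normal_density 0 \<sigma>)) t = exp (- (t\<^sup>2 * \<sigma>\<^sup>2 / 2))"
proof -
  have "density lborel (normal_density 0 \<sigma>) = distr std_normal_distribution borel (\<lambda>x. \<sigma> * x)"
  proof -
    have "distributed std_normal_distribution lborel (\<lambda>x. x) std_normal_density"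
      by (simp add: distributed_def distr_id2)
    from prob_space.normal_density_affine[OF prob_space_normal_density[of 1 0] this, of \<sigma> 0] assms
    have "distributed std_normal_distribution lborel (\<lambda>x. 0 + \<sigma> * x) (normal_density 0 \<sigma>)" by simp
    then have "distr std_normal_distribution lborel (\<lambda>x. \<sigma> * x) = density lborel (normal_density 0 \<sigma>)"
      by (simp add: distributed_def)
    then show ?thesis by (simp cong: distr_cong)
  qed
  then have "char (density lborel (normal_density 0 \<sigma>)) t = (CLINT x|std_normal_distribution. iexp (t * (\<sigma> * x)))"
    by (simp add: char_def integral_distr)
  also have "\<dots> = char std_normal_distribution (t * \<sigma>)" by (simp add: char_def mult.assoc)
  also have "\<dots> = exp (- (t\<^sup>2 * \<sigma>\<^sup>2 / 2))" by (simp add: char_std_normal_distribution power_mult_distrib)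
  finally show ?thesis .
qed

section \<open>Almost sure properties of the observations\<close>

lemma (in prob_space) borel_cantelli_eventually:
  assumes meas: "\<And>n. {\<omega>\<in>space M. \<not> Q n \<omega>} \<in> sets M"
    and bound: "\<And>n. prob {\<omega>\<in>space M. \<not> Q n \<omega>} \<le> b n" and summable: "summable b"
  shows "AE \<omega> in M. \<forall>\<^sub>F n in sequentially. Q n \<omega>"
proof -
  have "AE \<omega> in M. \<forall>\<^sub>F n in sequentially. \<omega> \<in> space M - {\<omega>\<in>space M. \<not> Q n \<omega>}"
  proof (rule borel_cantelli_AE1)
    show "summable (\<lambda>n. prob {\<omega>\<in>space M. \<not> Q n \<omega>})"
      by (rule summable_comparison_test'[OF summable, of 0]) (use bound in auto)
  qed (use meas in \<open>auto simp: less_top[symmetric]\<close>)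
  then show ?thesis
    by (rule AE_mp) (auto elim!: eventually_mono)
qed

text \<open>With the threshold scaled by the square root of the number of summands, the bound no
  longer depends on that number, so a union over all blocks costs only their count.\<close>

lemma (in prob_space) hoeffding_unit_interval:
  fixes Y :: "'i \<Rightarrow> 'a \<Rightarrow> real"
  assumes A: "finite A" and indep: "indep_vars (\<lambda>_. borel) Y A"
    and Y: "\<And>i \<omega>. i \<in> A \<Longrightarrow> Y i \<omega> \<in> {0..1}" and q: "\<And>i. i \<in> A \<Longrightarrow> expectation (Y i) = q i" and L: "0 \<le> L"
  shows "prob {\<omega>\<in>space M. L * sqrt (real (card A)) < \<bar>\<Sum>i\<in>A. Y i \<omega> - q i\<bar>} \<le> 2 * exp (- 2 * L\<^sup>2)"
proof (cases "A = {}")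
  case False
  interpret Hoeffding_ineq M A Y "\<lambda>_. 0" "\<lambda>_. 1" "\<Sum>i\<in>A. expectation (Y i)"
    by unfold_locales (use A indep Y in auto)
  have c: "0 < real (card A)" using A False by (simp add: card_gt_0_iff)
  have rv [measurable]: "i \<in> A \<Longrightarrow> random_variable borel (Y i)" for i by (rule random_variable)
  have "prob {\<omega>\<in>space M. L * sqrt (real (card A)) < \<bar>\<Sum>i\<in>A. Y i \<omega> - q i\<bar>}
      \<le> prob {\<omega>\<in>space M. L * sqrt (real (card A)) \<le> \<bar>(\<Sum>i\<in>A. Y i \<omega>) - (\<Sum>i\<in>A. expectation (Y i))\<bar>}"
    by (intro finite_measure_mono) (use q in \<open>auto simp: sum_subtractf\<close>)
  also have "\<dots> \<le> 2 * exp (- 2 * (L * sqrt (real (card A)))\<^sup>2 / (\<Sum>i\<in>A. (1 - 0)\<^sup>2))"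
    by (rule Hoeffding_ineq_abs_ge) (use L c in auto)
  also have "\<dots> = 2 * exp (- 2 * L\<^sup>2)" using c by (simp add: power_mult_distrib)
  finally show ?thesis .
qed simp

text \<open>A union bound over at most \<open>(n + 1)\<^sup>2\<close> pairs of ranks. It serves
  twice: for the data with the times frozen, and under the bootstrap law.\<close>

lemma (in prob_space) prob_not_rank_deviation_le:
  fixes Y :: "nat \<Rightarrow> 'a \<Rightarrow> real"
  assumes inj: "inj_on T {..<n}" and indep: "indep_vars (\<lambda>_. borel) Y {..<n}"
    and Y: "\<And>i \<omega>. i < n \<Longrightarrow> Y i \<omega> \<in> {0..1}" and q: "\<And>i. i < n \<Longrightarrow> expectation (Y i) = q i" and L: "0 \<le> L"
  shows "{\<omega>\<in>space M. \<not> rank_deviation_le n T (\<lambda>i. Y i \<omega> - q i) L} \<in> sets M"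
    and "prob {\<omega>\<in>space M. \<not> rank_deviation_le n T (\<lambda>i. Y i \<omega> - q i) L} \<le> 2 * (real n + 1)\<^sup>2 * exp (- 2 * L\<^sup>2)"
proof -
  interpret distinct_times n T by unfold_locales (rule inj)
  define S where "S a b = {k. k < n \<and> a \<le> time_rank n T k \<and> time_rank n T k < b}" for a b
  define B where "B = (\<lambda>(a, b). {\<omega>\<in>space M. L * sqrt (real b - real a) < \<bar>\<Sum>i\<in>S a b. Y i \<omega> - q i\<bar>})"
  define I where "I = {(a, b). a < b \<and> b \<le> n}"
  have fin: "finite I" by (rule finite_subset[of _ "{..n} \<times> {..n}"]) (auto simp: I_def)
  have S: "S a b \<subseteq> {..<n}" for a b by (auto simp: S_def)
  have rv: "random_variable borel (Y i)" if "i < n" for i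
    using indep that by (auto simp: indep_vars_def)
  have meas: "B ab \<in> sets M" for ab
  proof (cases ab)
    case (Pair a b)
    have "(\<lambda>\<omega>. \<bar>\<Sum>i\<in>S a b. Y i \<omega> - q i\<bar>) \<in> borel_measurable M"
      using rv S[of a b] by (intro borel_measurable_abs borel_measurable_sum borel_measurable_diff) auto
    then show ?thesis by (simp add: Pair B_def)
  qed
  have eq: "{\<omega>\<in>space M. \<not> rank_deviation_le n T (\<lambda>i. Y i \<omega> - q i) L} = (\<Union>ab\<in>I. B ab)"
    by (auto simp: rank_deviation_le_def I_def B_def S_def not_le)
  show "{\<omega>\<in>space M. \<not> rank_deviation_le n T (\<lambda>i. Y i \<omega> - q i) L} \<in> sets M"
    unfolding eq using fin meas by (intro sets.finite_UN) auto
  have "prob (\<Union>ab\<in>I. B ab) \<le> (\<Sum>ab\<in>I. prob (B ab))"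
    using fin meas by (intro finite_measure_subadditive_finite) auto
  also have "\<dots> \<le> (\<Sum>ab\<in>I. 2 * exp (- 2 * L\<^sup>2))"
  proof (rule sum_mono)
    fix ab assume "ab \<in> I"
    then obtain a b where ab: "ab = (a, b)" "a < b" "b \<le> n" by (auto simp: I_def)
    have card: "real (card (S a b)) = real b - real a"
      using card_rank[OF ab(3), of a] ab(2) by (simp add: S_def of_nat_diff)
    have "prob {\<omega>\<in>space M. L * sqrt (real (card (S a b))) < \<bar>\<Sum>i\<in>S a b. Y i \<omega> - q i\<bar>} \<le> 2 * exp (- 2 * L\<^sup>2)"
      by (rule hoeffding_unit_interval)
        (use S[of a b] Y q L indep_vars_subset[OF indep S[of a b]] in \<open>auto intro: finite_subset\<close>)
    then show "prob (B ab) \<le> 2 * exp (- 2 * L\<^sup>2)" by (simp add: ab B_def card)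
  qed
  also have "\<dots> = real (card I) * (2 * exp (- 2 * L\<^sup>2))" by simp
  also have "\<dots> \<le> real ((n + 1) * (n + 1)) * (2 * exp (- 2 * L\<^sup>2))"
  proof (intro mult_right_mono of_nat_mono)
    have "card I \<le> card ({..n} \<times> {..n})" by (rule card_mono) (auto simp: I_def)
    then show "card I \<le> (n + 1) * (n + 1)" by (simp add: card_cartesian_product)
  qed simp
  finally show "prob {\<omega>\<in>space M. \<not> rank_deviation_le n T (\<lambda>i. Y i \<omega> - q i) L} \<le> 2 * (real n + 1)\<^sup>2 * exp (- 2 * L\<^sup>2)"
    unfolding eq by (simp add: power2_eq_square algebra_simps)
qed

text \<open>\<open>exp (- 2 * (ln n)\<^sup>2)\<close> is \<open>n powr (- 2 * ln n)\<close> and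
  beats every power of \<open>n\<close>; hence the choice of \<open>ln n\<close> as noise
  level.\<close>

lemma summable_log_deviation: "summable (\<lambda>n. 2 * (real n + 1)\<^sup>2 * exp (- 2 * (ln (real n))\<^sup>2))"
proof (rule summable_comparison_test_bigo)
  show "summable (\<lambda>n. norm (real n powr (-2)))" by (simp add: summable_real_powr_iff)
  show "(\<lambda>n. 2 * (real n + 1)\<^sup>2 * exp (- 2 * (ln (real n))\<^sup>2)) \<in> O(\<lambda>n. real n powr (-2))"
    by real_asymp
qed

lemma (in prob_space) expectation_le_eq_cdf:
  fixes X :: "'a \<Rightarrow> real"
  assumes [measurable]: "X \<in> borel_measurable M"
  shows "expectation (\<lambda>\<omega>. of_bool (X \<omega> \<le> x)) = cdf (distr M borel X) x"
proof -
  have "expectation (\<lambda>\<omega>. of_bool (X \<omega> \<le> x)) = expectation (indicator {\<omega>\<in>space M. X \<omega> \<le> x})"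
    by (intro Bochner_Integration.integral_cong) (auto simp: indicator_def)
  also have "\<dots> = prob {\<omega>\<in>space M. X \<omega> \<le> x}" by simp
  also have "\<dots> = cdf (distr M borel X) x"
    unfolding cdf_def by (subst measure_distr) (auto intro!: arg_cong[where f = prob])
  finally show ?thesis .
qed

text \<open>Conditioning on the times: for each fixed sequence of times Hoeffding and Borel-Cantelli
  apply to \<open>X\<close>, and independence of the two sequences transfers the result by Fubini. A
  fixed sequence may have ties, hence the premise \<open>inj_on\<close>.\<close>

lemma (in prob_space) AE_rank_deviation:
  fixes X T :: "nat \<Rightarrow> 'a \<Rightarrow> real" and F :: "real \<Rightarrow> real"
  assumes X: "indep_vars (\<lambda>_. borel) X UNIV"
    and XT: "indep_var (\<Pi>\<^sub>M i\<in>UNIV. borel) (\<lambda>\<omega> i. X i \<omega>) (\<Pi>\<^sub>M i\<in>UNIV. borel) (\<lambda>\<omega> i. T i \<omega>)"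
    and F: "\<And>i. cdf (distr M borel (X i)) = F"
  shows "AE \<omega> in M. \<forall>\<^sub>F n in sequentially. inj_on (\<lambda>i. T i \<omega>) {..<n} \<longrightarrow>
     rank_deviation_le n (\<lambda>i. T i \<omega>) (\<lambda>i. of_bool (X i \<omega> \<le> T i \<omega>) - F (T i \<omega>)) (ln (real n))"
proof -
  let ?S = "\<Pi>\<^sub>M i\<in>(UNIV::nat set). (borel :: real measure)"
  let ?PX = "distr M ?S (\<lambda>\<omega> i. X i \<omega>)" and ?PT = "distr M ?S (\<lambda>\<omega> i. T i \<omega>)"
  have rvX [measurable]: "X i \<in> borel_measurable M" for i using X by (auto simp: indep_vars_def)
  note rvs = indep_var_rv1[OF XT] indep_var_rv2[OF XT]
  define R where "R \<tau> x n \<longleftrightarrow> (inj_on \<tau> {..<n} \<longrightarrow>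
     rank_deviation_le n \<tau> (\<lambda>i. of_bool (x i \<le> \<tau> i) - F (\<tau> i)) (ln (real n)))" for \<tau> x :: "nat \<Rightarrow> real" and n
  have "mono F"
  proof -
    interpret X0: real_distribution "distr M borel (X 0)" by (rule real_distribution_distr) simp
    show ?thesis using X0.cdf_nondecreasing F[of 0] by (auto simp: mono_def)
  qed
  then have [measurable]: "F \<in> borel_measurable borel" by (rule borel_measurable_mono)
  \<comment> \<open>Fubini requires joint measurability in times and values. Rank sums become sums
    over all \<open>k < n\<close> under conditions on ranks, and ranks become finite sums of
    comparisons.\<close>
  have R_meas: "{z \<in> space (?S \<Otimes>\<^sub>M ?S). \<forall>\<^sub>F n in sequentially. R (fst z) (snd z) n} \<in> sets (?S \<Otimes>\<^sub>M ?S)"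
  proof -
    have sum_eq: "(\<Sum>k | k < n \<and> a \<le> time_rank n \<tau> k \<and> time_rank n \<tau> k < b. f k)
        = (\<Sum>k<n. if a \<le> time_rank n \<tau> k \<and> time_rank n \<tau> k < b then f k else 0)"
      for n a b \<tau> and f :: "nat \<Rightarrow> real"
      by (subst sum.inter_filter[symmetric]) auto
    have rank_eq: "time_rank n \<tau> k = (\<Sum>i<n. if \<tau> i < \<tau> k then 1 else 0)" for n \<tau> k
      by (simp add: time_rank_def sum.If_cases Int_def)
    have [measurable]: "(\<lambda>z. fst z i) \<in> borel_measurable (?S \<Otimes>\<^sub>M ?S)" "(\<lambda>z. snd z i) \<in> borel_measurable (?S \<Otimes>\<^sub>M ?S)" for i
      by measurable
    have [measurable]: "(\<lambda>z. time_rank n (fst z) k) \<in> ?S \<Otimes>\<^sub>M ?S \<rightarrow>\<^sub>M count_space UNIV" for n k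
      unfolding rank_eq by measurable
    show ?thesis
      unfolding R_def rank_deviation_le_def inj_on_def sum_eq eventually_sequentially of_bool_def Ball_def lessThan_iff
      by measurable
  qed
  have fixed: "AE \<omega> in M. \<forall>\<^sub>F n in sequentially. R \<tau> (\<lambda>i. X i \<omega>) n" for \<tau>
  proof (rule borel_cantelli_eventually[OF _ _ summable_log_deviation])
    fix n
    let ?Y = "\<lambda>i \<omega>. of_bool (X i \<omega> \<le> \<tau> i) :: real"
    have indep: "indep_vars (\<lambda>_. borel) ?Y {..<n}"
      by (rule indep_vars_compose2[OF indep_vars_subset[OF X]]) auto
    have q: "expectation (?Y i) = F (\<tau> i)" for i
      using expectation_le_eq_cdf[OF rvX] F by simp
    have "{\<omega>\<in>space M. \<not> R \<tau> (\<lambda>i. X i \<omega>) n} \<in> sets M \<and>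
      prob {\<omega>\<in>space M. \<not> R \<tau> (\<lambda>i. X i \<omega>) n} \<le> 2 * (real n + 1)\<^sup>2 * exp (- 2 * (ln (real n))\<^sup>2)"
    proof (cases "inj_on \<tau> {..<n}")
      case True
      have "0 \<le> ln (real n)" by (cases "n = 0") auto
      from prob_not_rank_deviation_le[OF True indep _ q this] True show ?thesis by (simp add: R_def)
    qed (simp add: R_def)
    then show "{\<omega>\<in>space M. \<not> R \<tau> (\<lambda>i. X i \<omega>) n} \<in> sets M"
      "prob {\<omega>\<in>space M. \<not> R \<tau> (\<lambda>i. X i \<omega>) n} \<le> 2 * (real n + 1)\<^sup>2 * exp (- 2 * (ln (real n))\<^sup>2)" by auto
  qed
  interpret pX: prob_space "?PX" by (rule prob_space_distr) (rule rvs)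
  interpret pT: prob_space "?PT" by (rule prob_space_distr) (rule rvs)
  interpret PP: pair_prob_space "?PX" "?PT" ..
  have meas2: "Measurable.pred (?S \<Otimes>\<^sub>M ?S) (\<lambda>z. \<forall>\<^sub>F n in sequentially. R (fst z) (snd z) n)"
    using R_meas by (simp add: pred_def)
  have meas3: "{z \<in> space (?S \<Otimes>\<^sub>M ?S). \<forall>\<^sub>F n in sequentially. R (snd z) (fst z) n} \<in> sets (?S \<Otimes>\<^sub>M ?S)"
    using measurable_compose[OF measurable_pair_swap' meas2]
    by (simp add: pred_def split_beta')
  have fixed_x: "AE x in ?PX. \<forall>\<^sub>F n in sequentially. R \<tau> x n" for \<tau>
  proof (subst AE_distr_iff[OF rvs(1)])
    have "(\<lambda>x. (\<tau>, x)) \<in> ?S \<rightarrow>\<^sub>M ?S \<Otimes>\<^sub>M ?S"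
      by (intro measurable_Pair1') (simp add: space_PiM)
    from measurable_compose[OF this meas2] show "{x \<in> space ?S. \<forall>\<^sub>F n in sequentially. R \<tau> x n} \<in> sets ?S"
      by (simp add: pred_def)
  qed (rule fixed)
  \<comment> \<open>\<open>fixed_x\<close> holds for every \<open>\<tau>\<close>; interchanging the
    quantifiers matches the order of the factors in the joint law of \<open>X\<close> and
    \<open>T\<close>.\<close>
  have "AE x in ?PX. AE \<tau> in ?PT. \<forall>\<^sub>F n in sequentially. R \<tau> x n"
    by (subst PP.AE_commute) (use meas3 fixed_x in \<open>auto simp: space_pair_measure\<close>)
  then have "AE z in ?PX \<Otimes>\<^sub>M ?PT. \<forall>\<^sub>F n in sequentially. R (snd z) (fst z) n"
    by (intro PP.AE_pair_measure) (use meas3 in \<open>auto simp: space_pair_measure\<close>)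
  also have "?PX \<Otimes>\<^sub>M ?PT = distr M (?S \<Otimes>\<^sub>M ?S) (\<lambda>\<omega>. (\<lambda>i. X i \<omega>, \<lambda>i. T i \<omega>))"
    using XT by (simp add: indep_var_distribution_eq)
  finally have "AE \<omega> in M. \<forall>\<^sub>F n in sequentially. R (snd (\<lambda>i. X i \<omega>, \<lambda>i. T i \<omega>)) (fst (\<lambda>i. X i \<omega>, \<lambda>i. T i \<omega>)) n"
    by (rule AE_distrD[rotated]) (intro measurable_Pair rvs)
  then show ?thesis by (simp add: R_def)
qed

text \<open>Two independent times with a density have a joint law that does not charge the diagonal,
  and there are only countably many pairs.\<close>

lemma (in prob_space) AE_inj_times:
  fixes T :: "nat \<Rightarrow> 'a \<Rightarrow> real"
  assumes T: "indep_vars (\<lambda>_. borel) T UNIV" and g: "\<And>i. distributed M lborel (T i) g"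
  shows "AE \<omega> in M. inj (\<lambda>i. T i \<omega> :: real)"
proof -
  have rv [measurable]: "T i \<in> borel_measurable M" for i using T by (auto simp: indep_vars_def)
  have "AE \<omega> in M. i \<noteq> j \<longrightarrow> T i \<omega> \<noteq> T j \<omega>" for i j :: nat
  proof (cases "i = j")
    case False
    \<comment> \<open>Independence of a pair is obtained from independence of \<open>T i\<close> and
      a sum over a singleton.\<close>
    have "indep_var borel (T i) borel (\<lambda>\<omega>. \<Sum>k\<in>{j}. T k \<omega>)"
      using False by (intro indep_vars_sum indep_vars_subset[OF T]) auto
    then have ind: "indep_var borel (T i) borel (T j)" by simp
    have eq: "distr M borel (T i) \<Otimes>\<^sub>M distr M borel (T j) = distr M (borel \<Otimes>\<^sub>M borel) (\<lambda>\<omega>. (T i \<omega>, T j \<omega>))"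
      using ind by (simp add: indep_var_distribution_eq)
    interpret pi: prob_space "distr M borel (T i)" by (rule prob_space_distr) simp
    interpret pj: prob_space "distr M borel (T j)" by (rule prob_space_distr) simp
    interpret PP: pair_prob_space "distr M borel (T i)" "distr M borel (T j)" ..
    have dens: "distr M borel (T k) = density lborel g" for k
      using distributed_distr_eq_density[OF g[of k]] by (simp cong: distr_cong)
    have [measurable]: "g \<in> borel_measurable lborel" using g[of 0] by (auto simp: distributed_def)
    have "AE x in distr M borel (T i). AE y in distr M borel (T j). x \<noteq> y"
    proof (rule AE_I2)
      fix x :: real
      have "AE y in density lborel g. x \<noteq> y"
        by (subst AE_density) (use AE_lborel_singleton[of x] in \<open>auto elim!: eventually_mono\<close>)
      then show "AE y in distr M borel (T j). x \<noteq> y" unfolding dens .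
    qed
    moreover have "{z \<in> space (borel \<Otimes>\<^sub>M borel). fst z \<noteq> (snd z :: real)} \<in> sets (borel \<Otimes>\<^sub>M borel)"
      by measurable
    ultimately have "AE z in distr M borel (T i) \<Otimes>\<^sub>M distr M borel (T j). fst z \<noteq> snd z"
      by (intro PP.AE_pair_measure) (auto simp: space_pair_measure)
    then show ?thesis unfolding eq by (subst (asm) AE_distr_iff) auto
  qed simp
  then have "AE \<omega> in M. \<forall>i j. i \<noteq> j \<longrightarrow> T i \<omega> \<noteq> T j \<omega>" by (simp add: AE_all_countable)
  then show ?thesis by (rule AE_mp) (auto simp: inj_on_def)
qed

text \<open>Uniformity comes from a grid of mesh \<open>(\<beta> - \<alpha>) / n\<close>. Hoeffding
  controls its \<open>n + 1\<close> points; between neighbours the counts are monotone and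
  \<open>n * G\<close> grows by at most \<open>L * (\<beta> - \<alpha>)\<close>.\<close>

lemma (in prob_space) AE_count_close:
  fixes T :: "nat \<Rightarrow> 'a \<Rightarrow> real"
  assumes T: "indep_vars (\<lambda>_. borel) T UNIV" and G: "\<And>i. cdf (distr M borel (T i)) = G"
    and lip: "\<And>x y. \<alpha> \<le> x \<Longrightarrow> x \<le> y \<Longrightarrow> y \<le> \<beta> \<Longrightarrow> G y - G x \<le> L * (y - x)" and \<alpha>\<beta>: "\<alpha> < \<beta>" and L: "0 \<le> L"
  shows "AE \<omega> in M. \<forall>\<^sub>F n in sequentially. \<forall>x\<in>{\<alpha>..\<beta>}.
     \<bar>real (count_le n (\<lambda>i. T i \<omega>) x) - real n * G x\<bar> \<le> ln (real n) * sqrt (real n) + L * (\<beta> - \<alpha>)"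
proof -
  have rv [measurable]: "T i \<in> borel_measurable M" for i using T by (auto simp: indep_vars_def)
  define x where "x n j = \<alpha> + real j * ((\<beta> - \<alpha>) / real n)" for n j :: nat
  define Q where "Q n \<omega> \<longleftrightarrow> (\<forall>j\<le>n. \<bar>\<Sum>i<n. of_bool (T i \<omega> \<le> x n j) - G (x n j)\<bar> \<le> ln (real n) * sqrt (real n))" for n \<omega>
  have ae: "AE \<omega> in M. \<forall>\<^sub>F n in sequentially. Q n \<omega>"
  proof (rule borel_cantelli_eventually[OF _ _ summable_log_deviation])
    fix n
    define B where "B j = {\<omega>\<in>space M. ln (real n) * sqrt (real n) < \<bar>\<Sum>i<n. of_bool (T i \<omega> \<le> x n j) - G (x n j)\<bar>}" for j
    have meas: "B j \<in> sets M" for j unfolding B_def by measurable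
    have eq: "{\<omega>\<in>space M. \<not> Q n \<omega>} = (\<Union>j\<in>{..n}. B j)"
      by (auto simp: Q_def B_def not_le)
    show "{\<omega>\<in>space M. \<not> Q n \<omega>} \<in> sets M"
      unfolding eq using meas by (intro sets.finite_UN) auto
    have "prob (\<Union>j\<in>{..n}. B j) \<le> (\<Sum>j\<in>{..n}. prob (B j))"
      using meas by (intro finite_measure_subadditive_finite) auto
    also have "\<dots> \<le> (\<Sum>j\<in>{..n}. 2 * exp (- 2 * (ln (real n))\<^sup>2))"
    proof (rule sum_mono)
      fix j
      let ?Y = "\<lambda>i \<omega>. of_bool (T i \<omega> \<le> x n j) :: real"
      have indep: "indep_vars (\<lambda>_. borel) ?Y {..<n}"
        by (rule indep_vars_compose2[OF indep_vars_subset[OF T]]) auto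
      have q: "expectation (?Y i) = G (x n j)" for i
        using expectation_le_eq_cdf[OF rv] G by simp
      have "0 \<le> ln (real n)" by (cases "n = 0") auto
      then show "prob (B j) \<le> 2 * exp (- 2 * (ln (real n))\<^sup>2)"
        using hoeffding_unit_interval[OF _ indep _ q, of "ln (real n)"] by (simp add: B_def)
    qed
    also have "\<dots> = 2 * (real n + 1) * exp (- 2 * (ln (real n))\<^sup>2)" by simp
    \<comment> \<open>Enlarged only to reuse the sequence already known to be summable.\<close>
    also have "\<dots> \<le> 2 * (real n + 1)\<^sup>2 * exp (- 2 * (ln (real n))\<^sup>2)"
      by (simp add: power2_eq_square algebra_simps)
    finally show "prob {\<omega>\<in>space M. \<not> Q n \<omega>} \<le> 2 * (real n + 1)\<^sup>2 * exp (- 2 * (ln (real n))\<^sup>2)"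
      unfolding eq .
  qed
  have step: "\<forall>y\<in>{\<alpha>..\<beta>}. \<bar>real (count_le n (\<lambda>i. T i \<omega>) y) - real n * G y\<bar> \<le> ln (real n) * sqrt (real n) + L * (\<beta> - \<alpha>)"
    if Q: "Q n \<omega>" and n: "0 < n" for n \<omega>
  proof
    fix y assume y: "y \<in> {\<alpha>..\<beta>}"
    let ?c = "\<lambda>y. real (count_le n (\<lambda>i. T i \<omega>) y)"
    have c: "(\<Sum>i<n. of_bool (T i \<omega> \<le> z) - G z) = ?c z - real n * G z" for z
    proof -
      have "?c z = (\<Sum>i<n. if T i \<omega> \<le> z then 1 else 0)"
        by (simp add: count_le_def sum.If_cases Int_def)
      also have "\<dots> = (\<Sum>i<n. of_bool (T i \<omega> \<le> z))" by (intro sum.cong) auto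
      finally show ?thesis by (simp only: sum_subtractf sum_constant card_lessThan)
    qed
    have grid: "\<bar>?c (x n j) - real n * G (x n j)\<bar> \<le> ln (real n) * sqrt (real n)" if "j \<le> n" for j
      using Q that by (simp only: Q_def c)
    define d where "d = (\<beta> - \<alpha>) / real n"
    have d: "0 < d" "real n * d = \<beta> - \<alpha>" using \<alpha>\<beta> n by (auto simp: d_def)
    have x_eq: "x n j = \<alpha> + real j * d" for j by (simp add: x_def d_def)
    \<comment> \<open>The right end point is treated apart, since the floor would give
      \<open>j = n\<close> there.\<close>
    have "\<exists>j<n. x n j \<le> y \<and> y \<le> x n (Suc j)"
    proof (cases "y = \<beta>")
      case True
      have "real (n - 1) * d \<le> real n * d" using d by (intro mult_right_mono) auto
      then show ?thesis using n d True by (intro exI[of _ "n - 1"]) (auto simp: x_eq)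
    next
      case False
      define j where "j = nat \<lfloor>(y - \<alpha>) / d\<rfloor>"
      have pos: "0 \<le> (y - \<alpha>) / d" using y d by simp
      have j: "real j \<le> (y - \<alpha>) / d" "(y - \<alpha>) / d < real j + 1" using pos by (auto simp: j_def)
      have "(y - \<alpha>) / d < real n" using d y False by (simp add: divide_less_eq)
      then have "j < n" using j by linarith
      moreover have "x n j \<le> y" "y \<le> x n (Suc j)" using j d(1) by (auto simp: x_eq field_simps)
      ultimately show ?thesis by blast
    qed
    then obtain j where j: "j < n" "x n j \<le> y" "y \<le> x n (Suc j)" by blast
    have in_range: "\<alpha> \<le> x n j" "x n (Suc j) \<le> \<beta>"
    proof -
      show "\<alpha> \<le> x n j" using d by (simp add: x_eq)
      have "real (Suc j) * d \<le> real n * d" using j d by (intro mult_right_mono) auto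
      then show "x n (Suc j) \<le> \<beta>" using d by (simp add: x_eq)
    qed
    have step: "real n * (L * (x n (Suc j) - x n j)) = L * (\<beta> - \<alpha>)"
    proof -
      have "x n (Suc j) - x n j = d" by (simp add: x_eq algebra_simps)
      then show ?thesis using d(2) by (simp add: mult.left_commute)
    qed
    have "G y - G (x n j) \<le> L * (y - x n j)" "G (x n (Suc j)) - G y \<le> L * (x n (Suc j) - y)"
      using j in_range y by (auto intro!: lip)
    moreover have "L * (y - x n j) \<le> L * (x n (Suc j) - x n j)" "L * (x n (Suc j) - y) \<le> L * (x n (Suc j) - x n j)"
      using j L by (auto intro!: mult_left_mono)
    ultimately have "G y - G (x n j) \<le> L * (x n (Suc j) - x n j)" "G (x n (Suc j)) - G y \<le> L * (x n (Suc j) - x n j)"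
      by linarith+
    then have "real n * (G y - G (x n j)) \<le> L * (\<beta> - \<alpha>)" "real n * (G (x n (Suc j)) - G y) \<le> L * (\<beta> - \<alpha>)"
      unfolding step[symmetric] by (auto intro!: mult_left_mono)
    moreover have "?c (x n j) \<le> ?c y" "?c y \<le> ?c (x n (Suc j))" using j by (auto intro!: count_le_mono)
    ultimately show "\<bar>?c y - real n * G y\<bar> \<le> ln (real n) * sqrt (real n) + L * (\<beta> - \<alpha>)"
      using grid[of j] grid[of "Suc j"] j(1) unfolding right_diff_distrib abs_le_iff by linarith
  qed
  from ae show ?thesis
  proof eventually_elim
    case (elim \<omega>)
    then show ?case using eventually_gt_at_top[of "0::nat"] by eventually_elim (rule step)
  qed
qed

section \<open>Rates of convergence along a fixed data sequence\<close>

text \<open>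
  \<open>close\<close> and \<open>dev\<close> are the properties that hold for almost every sequence of observations; \<open>L\<close> is one
  bound for the densities, the Lipschitz constant of \<open>g\<close> and twice that of the density of \<open>F0\<close>.
\<close>
locale current_status_path =
  fixes T :: "nat \<Rightarrow> real" and \<Delta> :: "nat \<Rightarrow> bool" and F0 g K :: "real \<Rightarrow> real" and h :: "nat \<Rightarrow> real"
    and t c \<eta> \<delta> L :: real
  assumes inj: "inj T" and \<eta>: "0 < \<eta>" and \<delta>: "0 < \<delta>" and c: "0 < c"
    and F0_mono: "mono F0" and F0_nonneg: "\<And>x. 0 \<le> F0 x" and F0_le_1: "\<And>x. F0 x \<le> 1"
    and F0_lower: "\<And>x y. t - 4 * \<eta> \<le> x \<Longrightarrow> x \<le> y \<Longrightarrow> y \<le> t + 4 * \<eta> \<Longrightarrow> \<delta> * (y - x) \<le> F0 y - F0 x"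
    and F0_upper: "\<And>x y. t - 4 * \<eta> \<le> x \<Longrightarrow> x \<le> y \<Longrightarrow> y \<le> t + 4 * \<eta> \<Longrightarrow> F0 y - F0 x \<le> L * (y - x)"
    and F0_second: "\<And>x d. \<bar>x - t\<bar> \<le> 2 * \<eta> \<Longrightarrow> \<bar>d\<bar> \<le> \<eta> \<Longrightarrow> \<bar>F0 (x + d) + F0 (x - d) - 2 * F0 x\<bar> \<le> L * d\<^sup>2"
    and g_meas [measurable]: "g \<in> borel_measurable borel"
    and g_lower: "\<And>x. \<bar>x - t\<bar> \<le> 4 * \<eta> \<Longrightarrow> \<delta> \<le> g x"
    and g_upper: "\<And>x. \<bar>x - t\<bar> \<le> 4 * \<eta> \<Longrightarrow> g x \<le> L"
    and g_lip: "\<And>x y. \<bar>x - t\<bar> \<le> 4 * \<eta> \<Longrightarrow> \<bar>y - t\<bar> \<le> 4 * \<eta> \<Longrightarrow> \<bar>g x - g y\<bar> \<le> L * \<bar>x - y\<bar>"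
    and close: "\<forall>\<^sub>F n in sequentially. \<forall>x\<ge>t - 4 * \<eta>. \<forall>y\<le>t + 4 * \<eta>. x \<le> y \<longrightarrow>
       empirical_error n T g x y \<le> real n powr (-9/20)"
    and dev: "\<forall>\<^sub>F n in sequentially. rank_deviation_le n T (\<lambda>i. of_bool (\<Delta> i) - F0 (T i)) (ln (real n))"
    and K: "smoothing_kernel K"
    and h_equiv: "h \<sim>[sequentially] (\<lambda>n. c * real n powr (-1/5))"
    and F0_t: "0 < F0 t" "F0 t < 1"
begin

text \<open>\<open>rate\<close> is the crude error of the isotonic fits, \<open>scale\<close> the
  order of the bandwidth, \<open>gap\<close> the error of the empirical distribution. The exponent
  of \<open>gap\<close> lies between -1/2, reached by Hoeffding up to a logarithm, and -2/5, the
  normalization to be beaten.\<close>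

abbreviation rate :: "nat \<Rightarrow> real" where "rate n \<equiv> real n powr (-1/4)"
abbreviation scale :: "nat \<Rightarrow> real" where "scale n \<equiv> real n powr (-1/5)"
abbreviation gap :: "nat \<Rightarrow> real" where "gap n \<equiv> real n powr (-9/20)"
text \<open>
  Over this distance \<open>F0\<close>, of slope at least \<open>\<delta>\<close>, gains more than twice the error \<open>(2 * L + 3) * rate n\<close>
  of the bootstrap MLE, so no block of the latter is longer.
\<close>
definition block_radius :: "nat \<Rightarrow> real" where "block_radius n = (4 * L + 7) / \<delta> * rate n"

text \<open>Gathers, for a single \<open>n\<close>, the eventual inequalities used for the rates and
  the linearization, so that the arguments for these are non-asymptotic.\<close>

definition regular :: "nat \<Rightarrow> bool" where
  "regular n \<longleftrightarrow> 0 < n \<and>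
     (\<forall>x\<ge>t - 4 * \<eta>. \<forall>y\<le>t + 4 * \<eta>. x \<le> y \<longrightarrow>
       empirical_error n T g x y \<le> gap n) \<and>
     rank_deviation_le n T (\<lambda>i. of_bool (\<Delta> i) - F0 (T i)) (ln (real n)) \<and>
     c / 2 * scale n \<le> h n \<and> h n \<le> 2 * c * scale n \<and>
     gap n \<le> \<delta> / 2 * rate n \<and> ln (real n) / sqrt (\<delta> / 2 * (real n * rate n)) \<le> rate n \<and> rate n \<le> \<eta> \<and>
     2 * c * scale n \<le> \<eta> \<and> 2 * c * scale n \<le> 1 \<and>
     L * (2 * c * scale n)\<^sup>2 \<le> rate n \<and> 2 * c * scale n + block_radius n \<le> \<eta>"

lemma L_pos: "0 < L"
  using g_lower[of t] g_upper[of t] \<delta> \<eta> by simp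

lemma h_ratio: "(\<lambda>n. h n / scale n) \<longlonglongrightarrow> c"
proof -
  have "(\<lambda>n. h n / (c * scale n)) \<longlonglongrightarrow> 1"
    by (rule asymp_equivD_strong[OF h_equiv]) (use c in \<open>auto intro!: eventually_mono[OF eventually_gt_at_top[of 0]]\<close>)
  then have "(\<lambda>n. c * (h n / (c * scale n))) \<longlonglongrightarrow> c * 1" by (intro tendsto_intros)
  then show ?thesis using c by simp
qed

lemma eventually_regular: "\<forall>\<^sub>F n in sequentially. regular n"
proof -
  have "\<forall>\<^sub>F n in sequentially. c / 2 < h n / scale n" "\<forall>\<^sub>F n in sequentially. h n / scale n < 2 * c"
    using order_tendstoD(1)[OF h_ratio, of "c / 2"] order_tendstoD(2)[OF h_ratio, of "2 * c"] c by auto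
  then have h: "\<forall>\<^sub>F n in sequentially. c / 2 * scale n \<le> h n \<and> h n \<le> 2 * c * scale n"
    using eventually_gt_at_top[of 0]
  proof eventually_elim
    case (elim n)
    then show ?case by (simp add: field_simps)
  qed
  have n1: "\<forall>\<^sub>F n in sequentially. gap n \<le> \<delta> / 2 * rate n" using \<delta> by real_asymp
  have n2: "\<forall>\<^sub>F n in sequentially. ln (real n) / sqrt (\<delta> / 2 * (real n * rate n)) \<le> rate n" using \<delta> by real_asymp
  have n3: "\<forall>\<^sub>F n in sequentially. rate n \<le> \<eta>" using \<eta> by real_asymp
  have n4: "\<forall>\<^sub>F n in sequentially. 2 * c * scale n \<le> \<eta>" using \<eta> c by real_asymp
  have n5: "\<forall>\<^sub>F n in sequentially. 2 * c * scale n \<le> 1" using c by real_asymp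
  have n6: "\<forall>\<^sub>F n in sequentially. L * (2 * c * scale n)\<^sup>2 \<le> rate n" using c L_pos by real_asymp
  define C where "C = (4 * L + 7) / \<delta>"
  have C: "0 < C" using L_pos \<delta> by (simp add: C_def)
  have n7: "\<forall>\<^sub>F n in sequentially. 2 * c * scale n + C * rate n \<le> \<eta>" using c C \<eta> by real_asymp
  show ?thesis
    using close dev h n1 n2 n3 n4 n5 n6 n7 eventually_gt_at_top[of 0]
    unfolding regular_def block_radius_def C_def[symmetric] by eventually_elim blast
qed

end

locale regular_path = current_status_path +
  fixes n :: nat
  assumes regular: "regular n"
begin

lemma n_pos: "0 < n" using regular by (simp add: regular_def)

lemma rate_pos: "0 < rate n" using n_pos by simp
lemma gap_pos: "0 < gap n" using n_pos by simp

lemma h_bounds: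
  "c / 2 * scale n \<le> h n" "h n \<le> 2 * c * scale n" "0 < h n" "h n \<le> \<eta>" "h n \<le> 1"
  "h n + block_radius n \<le> \<eta>" "L * (h n)\<^sup>2 \<le> rate n"
proof -
  show 1: "c / 2 * scale n \<le> h n" and 2: "h n \<le> 2 * c * scale n"
    using regular by (auto simp: regular_def)
  have "0 < c / 2 * scale n" using c n_pos by simp
  then show 3: "0 < h n" using 1 by linarith
  show "h n \<le> \<eta>" "h n \<le> 1" "h n + block_radius n \<le> \<eta>" using regular 2 by (auto simp: regular_def)
  have "L * (h n)\<^sup>2 \<le> L * (2 * c * scale n)\<^sup>2"
    using 2 3 L_pos by (intro mult_left_mono power_mono) auto
  then show "L * (h n)\<^sup>2 \<le> rate n" using regular by (auto simp: regular_def)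
qed

sublocale distinct_times n T
  by unfold_locales (rule inj_on_subset[OF inj]; simp)

lemma close_n: "t - 4 * \<eta> \<le> x \<Longrightarrow> x \<le> y \<Longrightarrow> y \<le> t + 4 * \<eta> \<Longrightarrow>
   empirical_error n T g x y \<le> gap n"
  using regular by (auto simp: regular_def)

lemma integral_g_bounds:
  assumes "t - 4 * \<eta> \<le> x" "x \<le> y" "y \<le> t + 4 * \<eta>"
  shows "\<delta> * (y - x) \<le> (LINT u:{x..y}|lborel. g u)" "(LINT u:{x..y}|lborel. g u) \<le> L * (y - x)"
proof -
  have g: "\<delta> \<le> g u" "g u \<le> L" if "u \<in> {x..y}" for u
    using that assms by (auto intro!: g_lower g_upper)
  have "set_integrable lborel {x..y} g"
    unfolding set_integrable_def
  proof (rule Bochner_Integration.integrable_bound)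
    show "integrable lborel (\<lambda>u. indicator {x..y} u * L)" by simp
    show "AE u in lborel. norm (indicator {x..y} u *\<^sub>R g u) \<le> norm (indicator {x..y} u * L)"
      using g \<delta> by (intro AE_I2) (force simp: indicator_def)
  qed simp
  from set_integral_bounds[OF this assms(2) g]
  show "\<delta> * (y - x) \<le> (LINT u:{x..y}|lborel. g u)" "(LINT u:{x..y}|lborel. g u) \<le> L * (y - x)" by auto
qed

lemma count_bounds:
  assumes "t - 4 * \<eta> \<le> x" "x \<le> y" "y \<le> t + 4 * \<eta>"
  shows "real n * (\<delta> * (y - x) - gap n) \<le> real (count_le n T y) - real (count_le n T x)"
    "real (count_le n T y) - real (count_le n T x) \<le> real n * (L * (y - x) + gap n)"
proof -
  have "\<delta> * (y - x) - gap n \<le> (real (count_le n T y) - real (count_le n T x)) / real n"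
    "(real (count_le n T y) - real (count_le n T x)) / real n \<le> L * (y - x) + gap n"
    using close_n[OF assms] integral_g_bounds[OF assms] unfolding empirical_error_def by linarith+
  then show "real n * (\<delta> * (y - x) - gap n) \<le> real (count_le n T y) - real (count_le n T x)"
    "real (count_le n T y) - real (count_le n T x) \<le> real n * (L * (y - x) + gap n)"
    using n_pos by (simp_all add: field_simps)
qed

text \<open>An interval of length \<open>rate n\<close> next to \<open>x\<close> holds enough
  observations to average the noise below \<open>rate n\<close>, while \<open>F0\<close> changes by
  at most \<open>L * rate n\<close> on it. The parameter \<open>r\<close> is the distance of the
  generating \<open>Q\<close> from \<open>F0\<close>: 0 for the data,
  \<open>(L + 2) * rate n\<close> for the bootstrap.\<close>

lemma mle_rate:
  assumes Q: "mono Q" "\<And>u. 0 \<le> Q u"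
    and dev: "rank_deviation_le n T (\<lambda>i. of_bool (\<Delta>' i) - Q (T i)) (ln (real n))"
    and x: "t - 4 * \<eta> \<le> x - rate n" "x + rate n \<le> t + 4 * \<eta>"
    and r: "\<bar>Q (x - rate n) - F0 (x - rate n)\<bar> \<le> r" "\<bar>Q (x + rate n) - F0 (x + rate n)\<bar> \<le> r"
  shows "\<bar>mle n T \<Delta>' x - F0 x\<bar> \<le> (L + 1) * rate n + r"
proof -
  have ln0: "0 \<le> ln (real n)" using n_pos by simp
  \<comment> \<open>Half of the guaranteed expected count; the other half absorbs
    \<open>gap n\<close>.\<close>
  define m0 where "m0 = \<delta> / 2 * (real n * rate n)"
  have m0: "0 < m0" using \<delta> n_pos by (simp add: m0_def)
  have "real n * (\<delta> * rate n - gap n) \<ge> real n * (\<delta> * rate n - \<delta> / 2 * rate n)"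
    using regular by (intro mult_left_mono) (auto simp: regular_def)
  then have base: "real n * (\<delta> * rate n - gap n) \<ge> m0" by (simp add: m0_def algebra_simps)
  have sq: "ln (real n) / sqrt (real m) \<le> rate n" if "m0 \<le> real m" for m
  proof -
    have "ln (real n) / sqrt (real m) \<le> ln (real n) / sqrt m0"
      using that m0 ln0 by (intro divide_left_mono) auto
    also have "\<dots> \<le> rate n" using regular by (auto simp: regular_def m0_def)
    finally show ?thesis .
  qed
  have "mle n T \<Delta>' x \<le> F0 x + (L + 1) * rate n + r"
  proof -
    define m where "m = count_le n T (x + rate n) - count_le n T x"
    have le: "count_le n T x \<le> count_le n T (x + rate n)" using rate_pos by (intro count_le_mono) simp
    have m: "m0 \<le> real m"
      using count_bounds(1)[of x "x + rate n"] x rate_pos base le by (simp add: m_def of_nat_diff)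
    then have "0 < m" using m0 by (cases m) auto
    then have "mle n T \<Delta>' x \<le> Q (x + rate n) + ln (real n) / sqrt (real m)"
      using le by (intro mle_upper Q dev ln0) (auto simp: m_def)
    also have "Q (x + rate n) \<le> F0 (x + rate n) + r" using r by linarith
    also have "F0 (x + rate n) \<le> F0 x + L * rate n" using F0_upper[of x "x + rate n"] x rate_pos by simp
    finally show ?thesis using sq[OF m] by (simp add: algebra_simps)
  qed
  moreover have "mle n T \<Delta>' x \<ge> F0 x - (L + 1) * rate n - r"
  proof -
    define m where "m = count_le n T x - count_le n T (x - rate n)"
    have le: "count_le n T (x - rate n) \<le> count_le n T x" using rate_pos by (intro count_le_mono) simp
    have m: "m0 \<le> real m"
      using count_bounds(1)[of "x - rate n" x] x rate_pos base le by (simp add: m_def of_nat_diff)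
    then have "0 < m" using m0 by (cases m) auto
    then have "Q (x - rate n) - ln (real n) / sqrt (real m) \<le> mle n T \<Delta>' x"
      using le by (intro mle_lower Q dev ln0) (auto simp: m_def)
    moreover have "Q (x - rate n) \<ge> F0 (x - rate n) - r" using r by linarith
    moreover have "F0 (x - rate n) \<ge> F0 x - L * rate n" using F0_upper[of "x - rate n" x] x rate_pos by simp
    ultimately show ?thesis using sq[OF m] by (simp add: algebra_simps)
  qed
  ultimately show ?thesis by linarith
qed

lemma rate_le: "rate n \<le> \<eta>" using regular by (simp add: regular_def)

text \<open>The assumptions hold within \<open>4 * \<eta>\<close> of \<open>t\<close>, and each
  estimate consumes one \<eta>: this rate holds within \<open>3 * \<eta>\<close>, that of its
  smoothing within \<open>2 * \<eta>\<close>, and that of the bootstrap MLE within \<eta>.\<close>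

lemma original_mle_rate:
  assumes "\<bar>x - t\<bar> \<le> 3 * \<eta>"
  shows "\<bar>mle n T \<Delta> x - F0 x\<bar> \<le> (L + 1) * rate n"
proof -
  have "\<bar>mle n T \<Delta> x - F0 x\<bar> \<le> (L + 1) * rate n + 0"
    by (rule mle_rate[where Q = F0]) (use F0_mono F0_nonneg rate_le assms regular in \<open>auto simp: regular_def\<close>)
  then show ?thesis by simp
qed

sublocale mle: sub_distribution_function "mle n T \<Delta>'" for \<Delta>'
  by unfold_locales (auto intro: mle_mono mle_right_continuous mle_le_1 mle_at_bot)

sublocale smle: sub_distribution_function "smle K (h n) n T \<Delta>"
  unfolding smle_def by (rule mle.sub_distribution_function_smooth[OF K h_bounds(3)])

lemma integrable_K_F0: "integrable lborel (\<lambda>u. K u * F0 (x + s * u))"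
proof (rule Bochner_Integration.integrable_bound)
  have [measurable]: "F0 \<in> borel_measurable borel" using F0_mono by (rule borel_measurable_mono)
  show "integrable lborel K" by (rule smoothing_kernel_integrable[OF K])
  then show "(\<lambda>u. K u * F0 (x + s * u)) \<in> borel_measurable lborel" by simp
  show "AE u in lborel. norm (K u * F0 (x + s * u)) \<le> norm (K u)"
    using F0_le_1 F0_nonneg by (auto simp: abs_mult intro!: mult_left_le)
qed

text \<open>As \<open>K\<close> is symmetric, the bias is controlled by second differences.\<close>
lemma smoothing_bias:
  assumes "\<bar>x - t\<bar> \<le> 2 * \<eta>"
  shows "\<bar>(LINT u|lborel. K u * F0 (x - h n * u)) - F0 x\<bar> \<le> rate n"
proof -
  note intK = smoothing_kernel_integrable[OF K] and K0 = smoothing_kernel_nonneg[OF K]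
  have minus: "(LINT u|lborel. K u * F0 (x - h n * u)) = (LINT u|lborel. K u * F0 (x + h n * u))"
    using lborel_integral_real_affine[of "-1" "\<lambda>u. K u * F0 (x - h n * u)" 0]
    by (simp add: smoothing_kernel_symmetric[OF K])
  have int1: "integrable lborel (\<lambda>u. K u * F0 (x - h n * u))" "integrable lborel (\<lambda>u. K u * F0 (x + h n * u))"
    using integrable_K_F0[of x "- h n"] integrable_K_F0[of x "h n"] by simp_all
  have "(LINT u|lborel. K u * (F0 (x + h n * u) + F0 (x - h n * u) - 2 * F0 x))
      = (LINT u|lborel. (K u * F0 (x + h n * u) + K u * F0 (x - h n * u)) - K u * (2 * F0 x))"
    by (intro Bochner_Integration.integral_cong) (auto simp: algebra_simps)
  also have "\<dots> = 2 * ((LINT u|lborel. K u * F0 (x - h n * u)) - F0 x)"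
    using int1 intK by (simp add: minus smoothing_kernel_integral[OF K])
  finally have eq: "2 * ((LINT u|lborel. K u * F0 (x - h n * u)) - F0 x)
      = (LINT u|lborel. K u * (F0 (x + h n * u) + F0 (x - h n * u) - 2 * F0 x))" by simp
  have "norm (LINT u|lborel. K u * (F0 (x + h n * u) + F0 (x - h n * u) - 2 * F0 x)) \<le> (LINT u|lborel. K u * rate n)"
  proof (rule order_trans[OF integral_norm_bound Bochner_Integration.integral_mono])
    have "integrable lborel (\<lambda>u. (K u * F0 (x + h n * u) + K u * F0 (x - h n * u)) - K u * (2 * F0 x))"
      using int1 intK by auto
    then show "integrable lborel (\<lambda>u. norm (K u * (F0 (x + h n * u) + F0 (x - h n * u) - 2 * F0 x)))"
      by (intro integrable_norm) (simp add: algebra_simps)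
    show "integrable lborel (\<lambda>u. K u * rate n)" using intK by simp
    fix u
    show "norm (K u * (F0 (x + h n * u) + F0 (x - h n * u) - 2 * F0 x)) \<le> K u * rate n"
    proof (cases "1 \<le> \<bar>u\<bar>")
      case False
      then have hu: "\<bar>h n * u\<bar> \<le> h n" using h_bounds(3) by (simp add: abs_mult mult_left_le)
      then have "\<bar>F0 (x + h n * u) + F0 (x - h n * u) - 2 * F0 x\<bar> \<le> L * (h n * u)\<^sup>2"
        using assms h_bounds(4) by (intro F0_second) auto
      also have "\<dots> \<le> L * (h n)\<^sup>2" using hu L_pos by (intro mult_left_mono) (auto simp: abs_le_square_iff[symmetric])
      also have "\<dots> \<le> rate n" by (rule h_bounds)
      finally show ?thesis using K0[of u] by (simp add: abs_mult mult_left_mono)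
    qed (simp add: smoothing_kernel_zero[OF K])
  qed
  also have "\<dots> = rate n" by (simp add: smoothing_kernel_integral[OF K])
  finally have "2 * \<bar>(LINT u|lborel. K u * F0 (x - h n * u)) - F0 x\<bar> \<le> rate n"
    unfolding eq[symmetric] real_norm_def by linarith
  moreover have "0 \<le> \<bar>(LINT u|lborel. K u * F0 (x - h n * u)) - F0 x\<bar>" by (rule abs_ge_zero)
  ultimately show ?thesis by argo
qed

text \<open>A kernel average of the errors of the MLE, plus the bias of smoothing \<open>F0\<close>
  itself.\<close>

lemma smle_rate:
  assumes x: "\<bar>x - t\<bar> \<le> 2 * \<eta>"
  shows "\<bar>smle K (h n) n T \<Delta> x - F0 x\<bar> \<le> (L + 2) * rate n"
proof -
  note intK = smoothing_kernel_integrable[OF K] and K0 = smoothing_kernel_nonneg[OF K]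
  have int: "integrable lborel (\<lambda>u. K u * F0 (x - h n * u))"
    using integrable_K_F0[of x "- h n"] by simp
  note int2 = mle.integrable_kernel_mult[OF intK, of \<Delta> x "h n"]
  have "smle K (h n) n T \<Delta> x - (LINT u|lborel. K u * F0 (x - h n * u))
      = (LINT u|lborel. K u * mle n T \<Delta> (x - h n * u) - K u * F0 (x - h n * u))"
    unfolding smle_def mle.kernel_smooth_eq[OF intK h_bounds(3)]
    by (rule Bochner_Integration.integral_diff[OF int2 int, symmetric])
  also have "norm \<dots> \<le> (LINT u|lborel. K u * ((L + 1) * rate n))"
  proof (rule order_trans[OF integral_norm_bound Bochner_Integration.integral_mono])
    show "integrable lborel (\<lambda>u. norm (K u * mle n T \<Delta> (x - h n * u) - K u * F0 (x - h n * u)))"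
      by (intro integrable_norm Bochner_Integration.integrable_diff int int2)
    show "integrable lborel (\<lambda>u. K u * ((L + 1) * rate n))" using intK by simp
    fix u
    show "norm (K u * mle n T \<Delta> (x - h n * u) - K u * F0 (x - h n * u)) \<le> K u * ((L + 1) * rate n)"
    proof (cases "1 \<le> \<bar>u\<bar>")
      case False
      then have hu: "\<bar>h n * u\<bar> \<le> h n" using h_bounds(3) by (simp add: abs_mult mult_left_le)
      then have "\<bar>mle n T \<Delta> (x - h n * u) - F0 (x - h n * u)\<bar> \<le> (L + 1) * rate n"
        using x h_bounds(4) by (intro original_mle_rate) auto
      then show ?thesis using K0[of u] by (simp add: abs_mult mult_left_mono right_diff_distrib[symmetric])
    qed (simp add: smoothing_kernel_zero[OF K])
  qed
  also have "\<dots> = (L + 1) * rate n" by (simp add: smoothing_kernel_integral[OF K])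
  finally have "\<bar>smle K (h n) n T \<Delta> x - (LINT u|lborel. K u * F0 (x - h n * u))\<bar> \<le> (L + 1) * rate n" by simp
  then show ?thesis using smoothing_bias[OF x] by (simp add: algebra_simps)
qed

end

section \<open>Linearization of the bootstrap estimator\<close>

context current_status_path
begin

definition kernel_bound :: real where
  "kernel_bound = (SOME B. B > 0 \<and> (\<forall>u. K u \<le> B) \<and> (\<forall>u v. \<bar>K u - K v\<bar> \<le> B * \<bar>u - v\<bar>))"

lemma kernel_bound: "0 < kernel_bound" "K u \<le> kernel_bound" "\<bar>K u - K v\<bar> \<le> kernel_bound * \<bar>u - v\<bar>"
  using someI_ex[OF smoothing_kernel_lipschitz[OF K]] unfolding kernel_bound_def by blast+

text \<open>After division by \<open>(h n)\<^sup>2\<close> a Lipschitz constant of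
  \<open>kernel_weight n\<close> on the window: the first term stems from varying \<open>K\<close>,
  the second from varying \<open>1 / g\<close>.\<close>

definition slope_const :: real where "slope_const = kernel_bound / \<delta> + kernel_bound * L / \<delta>\<^sup>2"

lemma slope_const: "0 < slope_const"
  unfolding slope_const_def using kernel_bound \<delta> L_pos by (intro add_pos_nonneg divide_pos_pos) auto

definition kernel_weight :: "nat \<Rightarrow> real \<Rightarrow> real" where
  "kernel_weight n u = K ((t - u) / h n) / (h n * g u)"

text \<open>Bounds the height of the cumulative sums over their minorant: \<open>ln n\<close> times
  the root of the largest number of times that an interval of radius \<open>block_radius n\<close>
  can hold.\<close>

definition excess :: "nat \<Rightarrow> real" where
  "excess n = ln (real n) * sqrt (real n * (2 * L * block_radius n + gap n))"

end

context regular_path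
begin

abbreviation \<phi> :: "real \<Rightarrow> real" where "\<phi> \<equiv> kernel_weight n"

abbreviation window :: "real set" where "window \<equiv> {t - h n..t + h n}"

lemma \<phi>_zero: "u \<notin> {t - h n<..<t + h n} \<Longrightarrow> \<phi> u = 0"
proof -
  assume "u \<notin> {t - h n<..<t + h n}"
  then have "1 \<le> \<bar>(t - u) / h n\<bar>" using h_bounds(3) by (auto simp: abs_if field_simps)
  then show ?thesis by (simp add: kernel_weight_def smoothing_kernel_zero[OF K])
qed

lemma window_near: "u \<in> window \<Longrightarrow> \<bar>u - t\<bar> \<le> \<eta>"
  using h_bounds(4) by auto

lemma g_window: "u \<in> window \<Longrightarrow> \<delta> \<le> g u" "u \<in> window \<Longrightarrow> g u \<le> L"
  using g_lower[of u] g_upper[of u] window_near[of u] \<eta> by auto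

lemma \<phi>_range: "u \<in> window \<Longrightarrow> \<phi> u \<in> {0..kernel_bound / (h n * \<delta>)}"
proof -
  assume u: "u \<in> window"
  have "\<phi> u \<le> kernel_bound / (h n * \<delta>)"
    unfolding kernel_weight_def using kernel_bound(2) g_window[OF u] h_bounds(3) \<delta> smoothing_kernel_nonneg[OF K] kernel_bound(1)
    by (intro frac_le mult_left_mono) auto
  moreover have "0 \<le> \<phi> u"
    unfolding kernel_weight_def using g_window[OF u] h_bounds(3) \<delta> smoothing_kernel_nonneg[OF K] by auto
  ultimately show ?thesis by simp
qed

lemma \<phi>_lipschitz:
  assumes u: "u \<in> window" and v: "v \<in> window"
  shows "\<bar>\<phi> u - \<phi> v\<bar> \<le> slope_const / (h n)\<^sup>2 * \<bar>u - v\<bar>"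
proof -
  define a b where "a = K ((t - u) / h n)" and "b = K ((t - v) / h n)"
  have pos: "0 < g u" "0 < g v" "0 < h n" using g_window[OF u] g_window[OF v] \<delta> h_bounds(3) by auto
  have ab: "\<bar>a - b\<bar> \<le> kernel_bound * (\<bar>u - v\<bar> / h n)"
  proof -
    have "\<bar>(t - u) / h n - (t - v) / h n\<bar> = \<bar>u - v\<bar> / h n"
      using pos by (simp add: abs_divide abs_minus_commute flip: diff_divide_distrib)
    then show ?thesis using kernel_bound(3)[of "(t - u) / h n" "(t - v) / h n"] by (simp add: a_def b_def)
  qed
  have b: "0 \<le> b" "b \<le> kernel_bound" using kernel_bound(2) smoothing_kernel_nonneg[OF K] by (auto simp: b_def)
  have "\<phi> u - \<phi> v = (a - b) / (h n * g u) + b * (g v - g u) / (h n * (g u * g v))"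
    using pos by (simp add: kernel_weight_def a_def[symmetric] b_def[symmetric] field_simps)
  also have "\<bar>\<dots>\<bar> \<le> \<bar>a - b\<bar> / (h n * g u) + b * \<bar>g v - g u\<bar> / (h n * (g u * g v))"
    using pos b by (intro order_trans[OF abs_triangle_ineq]) (simp add: abs_mult)
  also have "\<bar>a - b\<bar> / (h n * g u) \<le> kernel_bound * (\<bar>u - v\<bar> / h n) / (h n * \<delta>)"
    using ab g_window[OF u] pos \<delta> kernel_bound(1) by (intro frac_le mult_left_mono) auto
  also have "b * \<bar>g v - g u\<bar> / (h n * (g u * g v)) \<le> kernel_bound * (L * \<bar>u - v\<bar>) / (h n * (\<delta> * \<delta>))"
  proof (intro frac_le mult_mono mult_left_mono)
    show "\<bar>g v - g u\<bar> \<le> L * \<bar>u - v\<bar>"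
      using g_lip[of v u] window_near[OF u] window_near[OF v] \<eta> by (simp add: abs_minus_commute)
  qed (use b pos g_window[OF u] g_window[OF v] \<delta> kernel_bound(1) L_pos in auto)
  \<comment> \<open>Varying \<open>1 / g\<close> costs only one power of \<open>1 / h n\<close>; as
    \<open>h n \<le> 1\<close>, it can be put over the same denominator as the kernel term.\<close>
  also have "\<dots> \<le> kernel_bound * (L * \<bar>u - v\<bar>) / ((h n)\<^sup>2 * (\<delta> * \<delta>))"
  proof -
    have "(h n)\<^sup>2 \<le> h n" using h_bounds(3,5) by (simp add: power2_eq_square mult_left_le)
    then show ?thesis using pos \<delta> kernel_bound(1) L_pos by (intro divide_left_mono mult_right_mono) auto
  qed
  finally show ?thesis
    using pos \<delta> by (simp add: slope_const_def power2_eq_square field_simps)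
qed

text \<open>The weight vanishes at both ends of the window and beyond, so clamping the argument does
  not change it. This is the form required by the summation by parts.\<close>

lemma \<phi>_clamp:
  assumes "u \<le> v"
  shows "\<bar>\<phi> u - \<phi> v\<bar> \<le> slope_const / (h n)\<^sup>2 * (max (t - h n) (min (t + h n) v) - max (t - h n) (min (t + h n) u))"
proof -
  let ?c = "\<lambda>u. max (t - h n) (min (t + h n) u)"
  have c: "\<phi> u = \<phi> (?c u)" for u
  proof (cases "u \<in> window")
    case False
    then have "?c u = t - h n \<or> ?c u = t + h n" using h_bounds(3) by auto
    then show ?thesis using False \<phi>_zero[of u] \<phi>_zero[of "?c u"] by auto
  qed auto
  have "\<bar>\<phi> (?c u) - \<phi> (?c v)\<bar> \<le> slope_const / (h n)\<^sup>2 * \<bar>?c u - ?c v\<bar>"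
    by (rule \<phi>_lipschitz) (use h_bounds(3) in auto)
  also have "\<bar>?c u - ?c v\<bar> = ?c v - ?c u" using assms by auto
  finally show ?thesis by (simp add: c[symmetric])
qed

sublocale ec: empirical_close n T g "t - 4 * \<eta>" "t - h n" "t + h n" L "gap n"
proof
  show "0 \<le> g x" "g x \<le> L" if "x \<in> {t - 4 * \<eta>..t + h n}" for x
  proof -
    have "\<bar>x - t\<bar> \<le> 4 * \<eta>" using that h_bounds(4) \<eta> by auto
    then show "0 \<le> g x" "g x \<le> L" using g_lower[of x] g_upper[of x] \<delta> by auto
  qed
  show "empirical_error n T g x y \<le> gap n"
    if "t - 4 * \<eta> \<le> x" "x \<le> y" "y \<le> t + h n" for x y
    using that h_bounds(4) \<eta> by (intro close_n) auto
qed (use n_pos gap_pos h_bounds \<eta> in auto)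

lemma sum_window: "(\<Sum>i<n. indicator window (T i) * (\<phi> (T i) * f (T i))) = (\<Sum>i<n. \<phi> (T i) * f (T i))"
proof (intro sum.cong refl)
  fix i
  show "indicator window (T i) * (\<phi> (T i) * f (T i)) = \<phi> (T i) * f (T i)"
    by (cases "T i \<in> window") (auto simp: \<phi>_zero)
qed

text \<open>Substituting \<open>t - h * u\<close> for \<open>u\<close>, the division by
  \<open>g\<close> in the weight cancels the density: integrals against the law of the times become
  kernel averages.\<close>

lemma integral_kernel_eq:
  fixes f :: "real \<Rightarrow> real"
  shows "(LINT u|lborel. indicator window u * (\<phi> u * f u * g u)) = (LINT u|lborel. K u * f (t - h n * u))"
proof -
  have "(LINT u|lborel. indicator window u * (\<phi> u * f u * g u))
     = h n * (LINT u|lborel. indicator window (t - h n * u) * (\<phi> (t - h n * u) * f (t - h n * u) * g (t - h n * u)))"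
    using lborel_integral_real_affine[of "- h n" "\<lambda>u. indicator window u * (\<phi> u * f u * g u)" t] h_bounds(3)
    by simp
  also have "\<dots> = (LINT u|lborel. h n * (indicator window (t - h n * u) * (\<phi> (t - h n * u) * f (t - h n * u) * g (t - h n * u))))"
    by simp
  also have "\<dots> = (LINT u|lborel. K u * f (t - h n * u))"
  proof (intro Bochner_Integration.integral_cong refl)
    fix u
    show "h n * (indicator window (t - h n * u) * (\<phi> (t - h n * u) * f (t - h n * u) * g (t - h n * u)))
        = K u * f (t - h n * u)"
    proof (cases "1 \<le> \<bar>u\<bar>")
      case True
      then have "h n \<le> \<bar>h n * u\<bar>" using h_bounds(3) by (simp add: abs_mult)
      then have "t - h n * u \<notin> {t - h n<..<t + h n}" unfolding greaterThanLessThan_iff by linarith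
      then have "\<phi> (t - h n * u) = 0" by (rule \<phi>_zero)
      then show ?thesis using True by (simp add: smoothing_kernel_zero[OF K])
    next
      case False
      then have "\<bar>h n * u\<bar> \<le> h n" using h_bounds(3) by (simp add: abs_mult mult_left_le)
      then have u: "t - h n * u \<in> window" by auto
      then have "0 < g (t - h n * u)" using g_window(1)[OF u] \<delta> by linarith
      then show ?thesis using u h_bounds(3) by (simp add: kernel_weight_def)
    qed
  qed
  finally show ?thesis .
qed

text \<open>The maximum of the weight and its Lipschitz constant times the window length are both of
  order \<open>1 / h n\<close>, so the error is of order \<open>V * gap n / h n\<close>. What
  matters is the size of \<open>V\<close>.\<close>

lemma sum_\<phi>_mult_diff:
  fixes U1 U2 :: "real \<Rightarrow> real"
  assumes "mono_on window U1" "mono_on window U2"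
    and "\<And>u. u \<in> window \<Longrightarrow> U1 u \<in> {0..V}" "\<And>u. u \<in> window \<Longrightarrow> U2 u \<in> {0..V}"
  shows "\<bar>(\<Sum>i<n. \<phi> (T i) * (U1 (T i) - U2 (T i))) / real n - (LINT u|lborel. K u * (U1 (t - h n * u) - U2 (t - h n * u)))\<bar>
     \<le> 8 * ((kernel_bound / \<delta> + 2 * slope_const) / h n) * V * gap n"
proof -
  have "\<bar>ec.discrepancy (\<lambda>u. \<phi> u * (U1 u - U2 u))\<bar>
      \<le> 8 * (kernel_bound / (h n * \<delta>) + slope_const / (h n)\<^sup>2 * ((t + h n) - (t - h n))) * V * gap n"
  proof (rule ec.discrepancy_lipschitz_mult_le(1)[OF \<phi>_range _ _ assms])
    fix u v assume uv: "u \<in> window" "v \<in> window" "u \<le> v"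
    then show "\<phi> u - \<phi> v \<le> slope_const / (h n)\<^sup>2 * (v - u)"
      using \<phi>_lipschitz[OF uv(1,2)] by (simp add: abs_if split: if_splits)
  qed (use slope_const in auto)
  also have "kernel_bound / (h n * \<delta>) + slope_const / (h n)\<^sup>2 * ((t + h n) - (t - h n)) = (kernel_bound / \<delta> + 2 * slope_const) / h n"
    using h_bounds(3) \<delta> by (simp add: power2_eq_square field_simps)
  finally show ?thesis
    unfolding ec.discrepancy_def sum_window[of "\<lambda>u. U1 u - U2 u"] integral_kernel_eq .
qed

lemma sum_\<phi>_sq:
  "\<bar>(\<Sum>i<n. (\<phi> (T i))\<^sup>2) / real n - (LINT u|lborel. (K u)\<^sup>2 / (h n * g (t - h n * u)))\<bar>
     \<le> 8 * ((kernel_bound / \<delta>)\<^sup>2 + 4 * kernel_bound / \<delta> * slope_const) / (h n)\<^sup>2 * gap n"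
proof -
  define \<Phi> \<Lambda> where "\<Phi> = kernel_bound / (h n * \<delta>)" and "\<Lambda> = slope_const / (h n)\<^sup>2"
  have \<Phi>0: "0 \<le> \<Phi>" using kernel_bound(1) h_bounds(3) \<delta> by (simp add: \<Phi>_def)
  \<comment> \<open>The constants 1 and 0 play the two monotone functions; factoring a difference of
    squares gives the Lipschitz constant \<open>2 * \<Phi> * \<Lambda>\<close>.\<close>
  have "\<bar>ec.discrepancy (\<lambda>u. (\<phi> u)\<^sup>2 * (1 - 0))\<bar>
      \<le> 8 * (\<Phi>\<^sup>2 + (2 * \<Phi> * \<Lambda>) * ((t + h n) - (t - h n))) * 1 * gap n"
  proof (rule ec.discrepancy_lipschitz_mult_le(1))
    show "(\<phi> u)\<^sup>2 \<in> {0..\<Phi>\<^sup>2}" if "u \<in> window" for u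
      using \<phi>_range[OF that] by (auto simp: \<Phi>_def intro!: power_mono)
    show "(\<phi> u)\<^sup>2 - (\<phi> v)\<^sup>2 \<le> 2 * \<Phi> * \<Lambda> * (v - u)" if uv: "u \<in> window" "v \<in> window" "u \<le> v" for u v
    proof -
      have "(\<phi> u)\<^sup>2 - (\<phi> v)\<^sup>2 = (\<phi> u + \<phi> v) * (\<phi> u - \<phi> v)" by (simp add: power2_eq_square algebra_simps)
      also have "\<dots> \<le> (\<phi> u + \<phi> v) * (\<Lambda> * (v - u))"
        using \<phi>_lipschitz[OF uv(1,2)] \<phi>_range[OF uv(1)] \<phi>_range[OF uv(2)] uv(3)
        by (intro mult_left_mono) (auto simp: \<Lambda>_def)
      also have "\<dots> \<le> (2 * \<Phi>) * (\<Lambda> * (v - u))"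
      proof (rule mult_right_mono)
        have "\<phi> u \<le> \<Phi>" "\<phi> v \<le> \<Phi>" using \<phi>_range[OF uv(1)] \<phi>_range[OF uv(2)] by (auto simp: \<Phi>_def)
        then show "\<phi> u + \<phi> v \<le> 2 * \<Phi>" by simp
      qed (use uv(3) slope_const in \<open>simp add: \<Lambda>_def\<close>)
      finally show ?thesis by (simp add: mult.assoc)
    qed
    show "0 \<le> 2 * \<Phi> * \<Lambda>" using \<Phi>0 slope_const by (simp add: \<Lambda>_def)
  qed (auto simp: mono_on_def)
  also have "\<Phi>\<^sup>2 + (2 * \<Phi> * \<Lambda>) * ((t + h n) - (t - h n)) = ((kernel_bound / \<delta>)\<^sup>2 + 4 * kernel_bound / \<delta> * slope_const) / (h n)\<^sup>2"
    using h_bounds(3) \<delta> by (simp add: \<Phi>_def \<Lambda>_def power2_eq_square field_simps)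
  finally have 1: "\<bar>ec.discrepancy (\<lambda>u. \<phi> u * \<phi> u)\<bar> \<le> 8 * (((kernel_bound / \<delta>)\<^sup>2 + 4 * kernel_bound / \<delta> * slope_const) / (h n)\<^sup>2) * gap n"
    by (simp add: power2_eq_square)
  have "(LINT u|lborel. K u * \<phi> (t - h n * u)) = (LINT u|lborel. (K u)\<^sup>2 / (h n * g (t - h n * u)))"
    using h_bounds(3) by (intro Bochner_Integration.integral_cong) (auto simp: kernel_weight_def power2_eq_square)
  with 1 show ?thesis
    unfolding ec.discrepancy_def sum_window[of \<phi>] integral_kernel_eq by (simp add: power2_eq_square)
qed

lemma ln_nonneg: "0 \<le> ln (real n)" using n_pos by simp

lemma smle_mono: "mono (smle K (h n) n T \<Delta>)"
  using smle.F_mono by (auto simp: mono_def)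

lemma excess_nonneg: "0 \<le> excess n"
  using n_pos L_pos \<delta> rate_pos gap_pos by (auto simp: excess_def block_radius_def intro!: mult_nonneg_nonneg add_nonneg_nonneg)

context
  fixes \<Delta>' :: "nat \<Rightarrow> bool"
  assumes dev': "rank_deviation_le n T (\<lambda>i. of_bool (\<Delta>' i) - smle K (h n) n T \<Delta> (T i)) (ln (real n))"
begin

lemma bootstrap_mle_rate:
  assumes "\<bar>x - t\<bar> \<le> \<eta>"
  shows "\<bar>mle n T \<Delta>' x - F0 x\<bar> \<le> (2 * L + 3) * rate n"
proof -
  have "\<bar>mle n T \<Delta>' x - F0 x\<bar> \<le> (L + 1) * rate n + (L + 2) * rate n"
  proof (rule mle_rate[OF smle_mono smle.F_nonneg dev'])
    show "\<bar>smle K (h n) n T \<Delta> (x - rate n) - F0 (x - rate n)\<bar> \<le> (L + 2) * rate n"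
      "\<bar>smle K (h n) n T \<Delta> (x + rate n) - F0 (x + rate n)\<bar> \<le> (L + 2) * rate n"
      by (rule smle_rate; use assms rate_le rate_pos in linarith)+
  qed (use assms rate_le rate_pos \<eta> in auto)
  then show ?thesis by (simp add: algebra_simps)
qed

lemma bootstrap_excess:
  assumes j: "j < n" "T (ix j) \<in> window" "k = j \<or> k = Suc j"
  shows "cusum n T \<Delta>' k - gcm n (cusum n T \<Delta>') (real k) \<le> excess n"
proof -
  define x z where "x = T (ix j)" and "z = block_radius n"
  have z: "0 < z" using L_pos \<delta> rate_pos by (simp add: z_def block_radius_def)
  have xz: "\<bar>x - z - t\<bar> \<le> \<eta>" "\<bar>x - t\<bar> \<le> \<eta>" "\<bar>x + z - t\<bar> \<le> \<eta>"
    using j(2) h_bounds(6) z by (auto simp: x_def z_def)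
  have dz: "\<delta> * z = (4 * L + 7) * rate n" using \<delta> by (simp add: z_def block_radius_def)
  have "F0 (x + z) - F0 x \<ge> \<delta> * z" "F0 x - F0 (x - z) \<ge> \<delta> * z"
    using F0_lower[of x "x + z"] F0_lower[of "x - z" x] xz z \<eta> by auto
  then have up: "F0 (x + z) - F0 x \<ge> (4 * L + 7) * rate n" "F0 x - F0 (x - z) \<ge> (4 * L + 7) * rate n"
    unfolding dz by auto
  \<comment> \<open>One \<open>rate n\<close> is left over after two bootstrap errors, which makes
    the inequalities strict.\<close>
  have "(4 * L + 7) * rate n = 2 * ((2 * L + 3) * rate n) + rate n" by (simp add: algebra_simps)
  then have less: "mle n T \<Delta>' (x - z) < mle n T \<Delta>' x" "mle n T \<Delta>' x < mle n T \<Delta>' (x + z)"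
    using up bootstrap_mle_rate[OF xz(1)] bootstrap_mle_rate[OF xz(2)] bootstrap_mle_rate[OF xz(3)] rate_pos
    unfolding abs_le_iff by linarith+
  have "cusum n T \<Delta>' k - gcm n (cusum n T \<Delta>') (real k)
      \<le> ln (real n) * sqrt (real (count_le n T (x + z)) - real (count_le n T (x - z)))"
    unfolding x_def
    by (rule cusum_minus_gcm_le[OF smle_mono ln_nonneg dev' j(1,3)]) (use z less in \<open>auto simp: x_def\<close>)
  also have "\<dots> \<le> excess n"
    unfolding excess_def
  proof (intro mult_left_mono real_sqrt_le_mono ln_nonneg)
    have "real (count_le n T (x + z)) - real (count_le n T (x - z)) \<le> real n * (L * ((x + z) - (x - z)) + gap n)"
      using xz z \<eta> by (intro count_bounds) auto
    then show "real (count_le n T (x + z)) - real (count_le n T (x - z)) \<le> real n * (2 * L * block_radius n + gap n)"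
      by (simp add: z_def mult_ac)
  qed
  finally show ?thesis .
qed

lemma bootstrap_residual_sum:
  "\<bar>\<Sum>i<n. \<phi> (T i) * (of_bool (\<Delta>' i) - mle n T \<Delta>' (T i))\<bar> \<le> 2 * slope_const / h n * excess n"
proof -
  have "\<bar>\<Sum>i<n. \<phi> (T i) * (of_bool (\<Delta>' i) - mle n T \<Delta>' (T i))\<bar>
      \<le> slope_const / (h n)\<^sup>2 * ((t + h n) - (t - h n)) * excess n"
  proof (rule sum_weighted_residuals_le[OF \<phi>_clamp])
    show "\<phi> u = 0" if "u \<notin> window" for u using that by (intro \<phi>_zero) auto
  qed (use slope_const h_bounds(3) excess_nonneg bootstrap_excess in auto)
  also have "slope_const / (h n)\<^sup>2 * ((t + h n) - (t - h n)) = 2 * slope_const / h n"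
    using h_bounds(3) by (simp add: power2_eq_square)
  finally show ?thesis .
qed

lemma bootstrap_linearization:
  "\<bar>(smle K (h n) n T \<Delta>' t - kernel_smooth K (h n) (smle K (h n) n T \<Delta>) t)
      - (\<Sum>i<n. \<phi> (T i) * (of_bool (\<Delta>' i) - smle K (h n) n T \<Delta> (T i))) / real n\<bar>
   \<le> 8 * ((kernel_bound / \<delta> + 2 * slope_const) / h n) * (2 * L * h n + 2 * ((2 * L + 3) * rate n)) * gap n
     + 2 * slope_const / h n * excess n / real n"
proof -
  note intK = smoothing_kernel_integrable[OF K]
  let ?F = "mle n T \<Delta>'" and ?Q = "smle K (h n) n T \<Delta>"
  define e where "e = (2 * L + 3) * rate n"
  have "(L + 2) * rate n \<le> e" using L_pos rate_pos unfolding e_def by (intro mult_right_mono) auto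
  then have F: "\<bar>?F u - F0 u\<bar> \<le> e" and Q: "\<bar>?Q u - F0 u\<bar> \<le> e" if "u \<in> window" for u
    using bootstrap_mle_rate[of u] smle_rate[of u] window_near[OF that] \<eta> unfolding e_def by auto
  \<comment> \<open>Subtracting the same constant from both functions keeps their difference and
    brings both into \<open>{0..V}\<close> with \<open>V\<close> of order \<open>h n\<close>. With
    the trivial range \<open>{0..1}\<close> the normalized error bound would grow like
    \<open>n powr (3/20)\<close>.\<close>
  define \<kappa> where "\<kappa> = F0 (t - h n) - e"
  define V where "V = 2 * L * h n + 2 * e"
  have F0V: "F0 u \<ge> F0 (t - h n)" "F0 u \<le> F0 (t - h n) + 2 * L * h n" if u: "u \<in> window" for u
  proof -
    show "F0 u \<ge> F0 (t - h n)" using u by (intro monoD[OF F0_mono]) auto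
    have "F0 u - F0 (t - h n) \<le> L * (u - (t - h n))" using u h_bounds(4) \<eta> by (intro F0_upper) auto
    also have "\<dots> \<le> L * (2 * h n)" using u L_pos by (intro mult_left_mono) auto
    finally show "F0 u \<le> F0 (t - h n) + 2 * L * h n" by simp
  qed
  have main: "\<bar>(\<Sum>i<n. \<phi> (T i) * ((?F (T i) - \<kappa>) - (?Q (T i) - \<kappa>))) / real n
      - (LINT u|lborel. K u * ((?F (t - h n * u) - \<kappa>) - (?Q (t - h n * u) - \<kappa>)))\<bar>
     \<le> 8 * ((kernel_bound / \<delta> + 2 * slope_const) / h n) * V * gap n"
  proof (rule sum_\<phi>_mult_diff)
    show "mono_on window (\<lambda>u. ?F u - \<kappa>)" "mono_on window (\<lambda>u. ?Q u - \<kappa>)"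
      by (auto intro!: mono_onI mle.F_mono smle.F_mono)
    fix u assume u: "u \<in> window"
    show "?F u - \<kappa> \<in> {0..V}" "?Q u - \<kappa> \<in> {0..V}"
      using F[OF u] Q[OF u] F0V[OF u] by (auto simp: \<kappa>_def V_def abs_le_iff)
  qed
  have "smle K (h n) n T \<Delta>' t - kernel_smooth K (h n) ?Q t
      = (LINT u|lborel. K u * ?F (t - h n * u) - K u * ?Q (t - h n * u))"
    unfolding smle_def[of K "h n" n T \<Delta>'] mle.kernel_smooth_eq[OF intK h_bounds(3)] smle.kernel_smooth_eq[OF intK h_bounds(3)]
    by (intro Bochner_Integration.integral_diff[symmetric] mle.integrable_kernel_mult smle.integrable_kernel_mult intK)
  also have "\<dots> = (LINT u|lborel. K u * ((?F (t - h n * u) - \<kappa>) - (?Q (t - h n * u) - \<kappa>)))"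
    by (simp add: right_diff_distrib)
  finally have eq1: "smle K (h n) n T \<Delta>' t - kernel_smooth K (h n) ?Q t
    = (LINT u|lborel. K u * ((?F (t - h n * u) - \<kappa>) - (?Q (t - h n * u) - \<kappa>)))" .
  \<comment> \<open>The bootstrap noise splits into the difference of the two estimators, which
    yields the integral, and the residuals of the isotonic fit.\<close>
  have eq2: "(\<Sum>i<n. \<phi> (T i) * (of_bool (\<Delta>' i) - ?Q (T i)))
     = (\<Sum>i<n. \<phi> (T i) * ((?F (T i) - \<kappa>) - (?Q (T i) - \<kappa>))) + (\<Sum>i<n. \<phi> (T i) * (of_bool (\<Delta>' i) - ?F (T i)))"
    unfolding sum.distrib[symmetric] by (intro sum.cong) (auto simp: algebra_simps)
  have "\<bar>(\<Sum>i<n. \<phi> (T i) * (of_bool (\<Delta>' i) - ?F (T i))) / real n\<bar> \<le> 2 * slope_const / h n * excess n / real n"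
    unfolding abs_divide abs_of_nat by (rule divide_right_mono[OF bootstrap_residual_sum]) simp
  then show ?thesis
    using main unfolding eq1 eq2 V_def e_def add_divide_distrib by linarith
qed

end

end

section \<open>Weak convergence of the bootstrap law\<close>

context current_status_path
begin

abbreviation boot_prob :: "nat \<Rightarrow> nat \<Rightarrow> real" where "boot_prob n i \<equiv> smle K (h n) n T \<Delta> (T i)"

definition coefficient :: "nat \<Rightarrow> nat \<Rightarrow> real" where
  "coefficient n i = real n powr (2/5) / real n * kernel_weight n (T i)"

definition boot_variance :: "nat \<Rightarrow> real" where
  "boot_variance n = (\<Sum>i<n. (coefficient n i)\<^sup>2 * (boot_prob n i * (1 - boot_prob n i)))"

text \<open>The normalized linearization error with \<open>h n\<close> replaced by its explicit
  bounds, so that only powers and logarithms of \<open>n\<close> remain; likewise for the next two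
  definitions.\<close>

definition remainder :: "nat \<Rightarrow> real" where
  "remainder n = real n powr (2/5) *
     (8 * ((kernel_bound / \<delta> + 2 * slope_const) / (c / 2 * scale n))
        * (2 * L * (2 * c * scale n) + 2 * ((2 * L + 3) * rate n)) * gap n
      + 2 * slope_const / (c / 2 * scale n) * excess n / real n)"

definition max_coefficient :: "nat \<Rightarrow> real" where
  "max_coefficient n = real n powr (2/5) / real n * (kernel_bound / (c / 2 * scale n * \<delta>))"

definition variance_rate :: "nat \<Rightarrow> real" where
  "variance_rate n = scale n *
     (8 * ((kernel_bound / \<delta>)\<^sup>2 + 4 * kernel_bound / \<delta> * slope_const) / (c / 2 * scale n)\<^sup>2 * gap n)"

text \<open>The empirical part is of order \<open>n powr (-1/20)\<close>, the summation by parts of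
  order \<open>ln n * n powr (-1/40)\<close>.\<close>

lemma remainder_tendsto: "remainder \<longlonglongrightarrow> 0"
proof -
  define C1 C2 D where "C1 = kernel_bound / \<delta> + 2 * slope_const" and "C2 = slope_const" and "D = (4 * L + 7) / \<delta>"
  have pos: "0 < C1" "0 < C2" "0 < D" "0 < L" "0 < c"
    using kernel_bound(1) \<delta> slope_const L_pos c by (auto simp: C1_def C2_def D_def intro!: add_pos_pos)
  have "(\<lambda>n. real n powr (2/5) *
     (8 * (C1 / (c / 2 * scale n))
        * (2 * L * (2 * c * scale n) + 2 * ((2 * L + 3) * rate n)) * gap n
      + 2 * C2 / (c / 2 * scale n) * (ln (real n) * sqrt (real n * (2 * L * (D * rate n) + gap n))) / real n)) \<longlonglongrightarrow> 0"
    using pos by real_asymp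
  then show ?thesis
    unfolding remainder_def excess_def block_radius_def C1_def C2_def D_def .
qed

lemma max_coefficient_tendsto: "max_coefficient \<longlonglongrightarrow> 0"
proof -
  define B where "B = kernel_bound / (c / 2 * \<delta>)"
  have "0 < B" using kernel_bound(1) c \<delta> by (simp add: B_def)
  then have "(\<lambda>n. real n powr (2/5) / real n * (B / scale n)) \<longlonglongrightarrow> 0" by real_asymp
  then show ?thesis unfolding max_coefficient_def B_def by (simp add: mult_ac)
qed

lemma variance_rate_tendsto: "variance_rate \<longlonglongrightarrow> 0"
proof -
  define C where "C = 8 * ((kernel_bound / \<delta>)\<^sup>2 + 4 * kernel_bound / \<delta> * slope_const)"
  have "(\<lambda>n. scale n * (C / (c / 2 * scale n)\<^sup>2 * gap n)) \<longlonglongrightarrow> 0"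
    using c by real_asymp
  then show ?thesis unfolding variance_rate_def C_def .
qed

lemma regular_pathI: "regular n \<Longrightarrow> regular_path T \<Delta> F0 g K h t c \<eta> \<delta> L n"
  by unfold_locales

lemma integrable_K_sq: "integrable lborel (\<lambda>u. (K u)\<^sup>2)"
proof (rule Bochner_Integration.integrable_bound)
  show "integrable lborel (\<lambda>u. kernel_bound * K u)" using smoothing_kernel_integrable[OF K] by simp
  show "AE u in lborel. norm ((K u)\<^sup>2) \<le> norm (kernel_bound * K u)"
    using kernel_bound(1,2) smoothing_kernel_nonneg[OF K] by (auto simp: power2_eq_square intro!: mult_right_mono)
qed (use smoothing_kernel_integrable[OF K] in simp)

text \<open>Makes the limit variance positive, as a normal density requires: otherwise
  \<open>K\<close> would vanish almost everywhere.\<close>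

lemma integral_K_sq_pos: "0 < (LINT u|lborel. (K u)\<^sup>2)"
proof -
  have "(LINT u|lborel. (K u)\<^sup>2) \<noteq> 0"
  proof
    assume "(LINT u|lborel. (K u)\<^sup>2) = 0"
    then have "AE u in lborel. (K u)\<^sup>2 = 0"
      using integral_nonneg_eq_0_iff_AE[OF integrable_K_sq] by simp
    then have "AE u in lborel. K u = 0" by (rule AE_mp) simp
    then have "integral\<^sup>L lborel K = 0" by (rule integral_eq_zero_AE)
    then show False by (simp add: smoothing_kernel_integral[OF K])
  qed
  moreover have "0 \<le> (LINT u|lborel. (K u)\<^sup>2)" by (rule Bochner_Integration.integral_nonneg) simp
  ultimately show ?thesis by linarith
qed

lemma g_t_pos: "0 < g t"
  using g_lower[of t] \<delta> \<eta> by simp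

text \<open>The ratio of \<open>scale n\<close> to \<open>h n\<close> tends to \<open>1 / c\<close>,
  and the Lipschitz bound on \<open>g\<close> lets \<open>g t\<close> replace the values of
  \<open>g\<close> in the window at a cost of order \<open>h n\<close>.\<close>

lemma local_variance_integral_tendsto:
  "(\<lambda>n. scale n * (LINT u|lborel. (K u)\<^sup>2 / (h n * g (t - h n * u))))
     \<longlonglongrightarrow> (LINT u|lborel. (K u)\<^sup>2) / (c * g t)"
proof -
  have [measurable]: "K \<in> borel_measurable borel" using smoothing_kernel_integrable[OF K] by simp
  define I where "I n = (LINT u|lborel. (K u)\<^sup>2 / g (t - h n * u))" for n
  define I0 where "I0 = (LINT u|lborel. (K u)\<^sup>2 / g t)"
  have bound: "\<forall>\<^sub>F n in sequentially. norm (I n - I0) \<le> (LINT u|lborel. (K u)\<^sup>2) * L / \<delta>\<^sup>2 * (2 * c * scale n)"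
    using eventually_regular
  proof eventually_elim
    case (elim n)
    interpret regular_path T \<Delta> F0 g K h t c \<eta> \<delta> L n using elim by (rule regular_pathI)
    have pt: "\<bar>(K u)\<^sup>2 / g (t - h n * u) - (K u)\<^sup>2 / g t\<bar> \<le> (K u)\<^sup>2 * (L * h n / \<delta>\<^sup>2)" for u
    proof (cases "1 \<le> \<bar>u\<bar>")
      case False
      then have hu: "\<bar>h n * u\<bar> \<le> h n" using h_bounds(3) by (simp add: abs_mult mult_left_le)
      then have near: "\<bar>(t - h n * u) - t\<bar> \<le> 4 * \<eta>" using h_bounds(4) \<eta> by linarith
      have g1: "\<delta> \<le> g (t - h n * u)" "\<delta> \<le> g t" using g_lower[OF near] g_lower[of t] \<eta> by auto
      then have pos: "0 < g (t - h n * u)" "0 < g t" using \<delta> by linarith+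
      have "\<bar>1 / g (t - h n * u) - 1 / g t\<bar> = \<bar>g t - g (t - h n * u)\<bar> / (g (t - h n * u) * g t)"
        using pos by (simp add: field_simps abs_mult)
      also have "\<dots> \<le> (L * h n) / (\<delta> * \<delta>)"
      proof (intro frac_le mult_mono)
        have "\<bar>g t - g (t - h n * u)\<bar> \<le> L * \<bar>t - (t - h n * u)\<bar>" using g_lip[OF _ near, of t] \<eta> by simp
        also have "\<dots> \<le> L * h n" using hu L_pos by (intro mult_left_mono) auto
        finally show "\<bar>g t - g (t - h n * u)\<bar> \<le> L * h n" .
      qed (use g1 \<delta> L_pos h_bounds(3) in auto)
      finally have "(K u)\<^sup>2 * \<bar>1 / g (t - h n * u) - 1 / g t\<bar> \<le> (K u)\<^sup>2 * (L * h n / \<delta>\<^sup>2)"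
        by (intro mult_left_mono) (auto simp: power2_eq_square)
      moreover have "(K u)\<^sup>2 / g (t - h n * u) - (K u)\<^sup>2 / g t = (K u)\<^sup>2 * (1 / g (t - h n * u) - 1 / g t)"
        by (simp add: right_diff_distrib)
      ultimately show ?thesis by (simp only: abs_mult abs_power2)
    qed (simp add: smoothing_kernel_zero[OF K])
    have int0: "integrable lborel (\<lambda>u. (K u)\<^sup>2 / g t)" using integrable_K_sq by simp
    have intd: "integrable lborel (\<lambda>u. (K u)\<^sup>2 / g (t - h n * u) - (K u)\<^sup>2 / g t)"
    proof (rule Bochner_Integration.integrable_bound)
      show "integrable lborel (\<lambda>u. (K u)\<^sup>2 * (L * h n / \<delta>\<^sup>2))" using integrable_K_sq by (rule integrable_mult_left)
      show "AE u in lborel. norm ((K u)\<^sup>2 / g (t - h n * u) - (K u)\<^sup>2 / g t) \<le> norm ((K u)\<^sup>2 * (L * h n / \<delta>\<^sup>2))"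
        unfolding real_norm_def by (intro AE_I2 order_trans[OF pt abs_ge_self])
    qed simp
    have intn: "integrable lborel (\<lambda>u. (K u)\<^sup>2 / g (t - h n * u))"
      using Bochner_Integration.integrable_add[OF intd int0] by simp
    have "I n - I0 = (LINT u|lborel. (K u)\<^sup>2 / g (t - h n * u) - (K u)\<^sup>2 / g t)"
      unfolding I_def I0_def by (rule Bochner_Integration.integral_diff[OF intn int0, symmetric])
    also have "norm \<dots> \<le> (LINT u|lborel. (K u)\<^sup>2 * (L * h n / \<delta>\<^sup>2))"
      by (rule order_trans[OF integral_norm_bound Bochner_Integration.integral_mono])
        (use pt intd integrable_mult_left[OF integrable_K_sq] in \<open>auto\<close>)
    also have "\<dots> = (LINT u|lborel. (K u)\<^sup>2) * L / \<delta>\<^sup>2 * h n" by simp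
    also have "\<dots> \<le> (LINT u|lborel. (K u)\<^sup>2) * L / \<delta>\<^sup>2 * (2 * c * scale n)"
      using h_bounds(2) L_pos \<delta> integral_K_sq_pos by (intro mult_left_mono) auto
    finally show ?case .
  qed
  have "(\<lambda>n. (LINT u|lborel. (K u)\<^sup>2) * L / \<delta>\<^sup>2 * (2 * c * scale n)) \<longlonglongrightarrow> 0"
  proof -
    have "(\<lambda>n. scale n) \<longlonglongrightarrow> 0" by real_asymp
    then show ?thesis by (intro tendsto_mult_right_zero)
  qed
  with bound have "(\<lambda>n. I n - I0) \<longlonglongrightarrow> 0" by (rule Lim_null_comparison)
  then have I: "I \<longlonglongrightarrow> I0" by (simp add: LIM_zero_iff)
  have "(\<lambda>n. inverse (h n / scale n) * I n) \<longlonglongrightarrow> inverse c * I0"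
    using c by (intro tendsto_mult tendsto_inverse h_ratio I) auto
  also have "(\<lambda>n. inverse (h n / scale n) * I n)
      = (\<lambda>n. scale n * (LINT u|lborel. (K u)\<^sup>2 / (h n * g (t - h n * u))))"
  proof
    fix n
    have "(LINT u|lborel. (K u)\<^sup>2 / (h n * g (t - h n * u))) = (LINT u|lborel. (K u)\<^sup>2 / g (t - h n * u) / h n)"
      by (simp add: mult.commute)
    also have "\<dots> = I n / h n" unfolding I_def by (rule integral_divide_zero)
    finally show "inverse (h n / scale n) * I n
      = scale n * (LINT u|lborel. (K u)\<^sup>2 / (h n * g (t - h n * u)))"
      unfolding inverse_divide by simp
  qed
  also have "inverse c * I0 = (LINT u|lborel. (K u)\<^sup>2) / (c * g t)"
    by (simp add: I0_def field_simps)
  finally show ?thesis .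
qed

text \<open>Squared coefficients vanish outside the window, and inside it \<open>boot_prob\<close>
  is uniformly close to \<open>F0 t\<close>. The variance is therefore nearly
  \<open>F0 t * (1 - F0 t)\<close> times the sum of squared coefficients, an empirical version of
  the local integral.\<close>

lemma boot_variance_tendsto:
  "boot_variance \<longlonglongrightarrow> F0 t * (1 - F0 t) / (c * g t) * (LINT u|lborel. (K u)\<^sup>2)"
proof -
  define w where "w n = scale n * ((\<Sum>i<n. (kernel_weight n (T i))\<^sup>2) / real n)" for n
  define d where "d n = (L + 2) * rate n + L * (2 * c * scale n)" for n
  define W where "W = (LINT u|lborel. (K u)\<^sup>2) / (c * g t)"
  have "\<forall>\<^sub>F n in sequentially. norm (w n - scale n * (LINT u|lborel. (K u)\<^sup>2 / (h n * g (t - h n * u)))) \<le> variance_rate n"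
    using eventually_regular
  proof eventually_elim
    case (elim n)
    interpret regular_path T \<Delta> F0 g K h t c \<eta> \<delta> L n using elim by (rule regular_pathI)
    have "norm (w n - scale n * (LINT u|lborel. (K u)\<^sup>2 / (h n * g (t - h n * u))))
        = scale n * \<bar>(\<Sum>i<n. (kernel_weight n (T i))\<^sup>2) / real n - (LINT u|lborel. (K u)\<^sup>2 / (h n * g (t - h n * u)))\<bar>"
      unfolding w_def real_norm_def right_diff_distrib[symmetric] abs_mult by simp
    also have "\<dots> \<le> scale n * (8 * ((kernel_bound / \<delta>)\<^sup>2 + 4 * kernel_bound / \<delta> * slope_const) / (h n)\<^sup>2 * gap n)"
      by (intro mult_left_mono sum_\<phi>_sq) auto
    also have "\<dots> \<le> variance_rate n"
      unfolding variance_rate_def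
    proof (intro mult_left_mono mult_right_mono frac_le)
      have low: "0 < c / 2 * scale n" using c n_pos by simp
      then show "0 < (c / 2 * scale n)\<^sup>2" by (rule zero_less_power)
      show "(c / 2 * scale n)\<^sup>2 \<le> (h n)\<^sup>2" using h_bounds(1) low by (intro power_mono) auto
    qed (use kernel_bound(1) \<delta> slope_const in auto)
    finally show ?case .
  qed
  then have "(\<lambda>n. w n - scale n * (LINT u|lborel. (K u)\<^sup>2 / (h n * g (t - h n * u)))) \<longlonglongrightarrow> 0"
    by (rule Lim_null_comparison) (rule variance_rate_tendsto)
  from tendsto_add[OF this local_variance_integral_tendsto] have w: "w \<longlonglongrightarrow> W" by (simp add: W_def)
  have d: "d \<longlonglongrightarrow> 0" unfolding d_def using L_pos c by real_asymp
  have "\<forall>\<^sub>F n in sequentially. norm (boot_variance n - w n * (F0 t * (1 - F0 t))) \<le> w n * d n"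
    using eventually_regular
  proof eventually_elim
    case (elim n)
    interpret regular_path T \<Delta> F0 g K h t c \<eta> \<delta> L n using elim by (rule regular_pathI)
    define s where "s = F0 t * (1 - F0 t)"
    have coef: "(coefficient n i)\<^sup>2 = scale n / real n * (kernel_weight n (T i))\<^sup>2" for i
    proof -
      have sq: "(real n powr (2/5) / real n)\<^sup>2 = scale n / real n"
      proof -
        have "real n powr (2/5) * real n powr (2/5) = scale n * real n powr 1"
          unfolding powr_add[symmetric] by simp
        then show ?thesis using n_pos by (simp add: power2_eq_square field_simps)
      qed
      show ?thesis unfolding coefficient_def power_mult_distrib sq ..
    qed
    have w_eq: "w n = (\<Sum>i<n. (coefficient n i)\<^sup>2)"
      unfolding coef w_def by (simp add: sum_distrib_left sum_divide_distrib)
    have eq: "boot_variance n - w n * s = (\<Sum>i<n. (coefficient n i)\<^sup>2 * (boot_prob n i * (1 - boot_prob n i) - s))"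
      unfolding boot_variance_def w_eq by (simp add: sum_distrib_right sum_subtractf right_diff_distrib)
    have "norm (\<Sum>i<n. (coefficient n i)\<^sup>2 * (boot_prob n i * (1 - boot_prob n i) - s)) \<le> (\<Sum>i<n. (coefficient n i)\<^sup>2 * d n)"
    proof (rule sum_norm_le)
      fix i
      show "norm ((coefficient n i)\<^sup>2 * (boot_prob n i * (1 - boot_prob n i) - s)) \<le> (coefficient n i)\<^sup>2 * d n"
      proof (cases "T i \<in> {t - h n<..<t + h n}")
        case False
        then show ?thesis by (simp add: coefficient_def \<phi>_zero)
      next
        case True
        then have Ti: "T i \<in> window" by auto
        have "\<bar>boot_prob n i - F0 (T i)\<bar> \<le> (L + 2) * rate n" using window_near[OF Ti] \<eta> by (intro smle_rate) auto
        moreover have "\<bar>F0 (T i) - F0 t\<bar> \<le> L * h n"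
        proof -
          have "\<bar>F0 (T i) - F0 t\<bar> \<le> L * \<bar>T i - t\<bar>"
            using F0_upper[of "T i" t] F0_upper[of t "T i"] monoD[OF F0_mono, of "T i" t] monoD[OF F0_mono, of t "T i"] window_near[OF Ti] \<eta>
            by (cases "T i \<le> t") auto
          also have "\<dots> \<le> L * h n" using Ti L_pos by (intro mult_left_mono) auto
          finally show ?thesis .
        qed
        moreover have "L * h n \<le> L * (2 * c * scale n)" using h_bounds(2) L_pos by (intro mult_left_mono) auto
        ultimately have diff: "\<bar>boot_prob n i - F0 t\<bar> \<le> d n" unfolding d_def by linarith
        \<comment> \<open>In this factorization the second factor has modulus at most 1, so
          \<open>x * (1 - x)\<close> is 1-Lipschitz on the unit interval.\<close>
        have "boot_prob n i * (1 - boot_prob n i) - s = (boot_prob n i - F0 t) * (1 - boot_prob n i - F0 t)"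
          by (simp add: s_def algebra_simps)
        moreover have "\<bar>1 - boot_prob n i - F0 t\<bar> \<le> 1"
          using smle.F_nonneg[of "T i"] smle.F_le_1[of "T i"] F0_t by linarith
        ultimately have "\<bar>boot_prob n i * (1 - boot_prob n i) - s\<bar> \<le> \<bar>boot_prob n i - F0 t\<bar> * 1"
          by (simp add: abs_mult mult_left_le)
        then show ?thesis using diff by (auto simp: abs_mult intro!: mult_left_mono)
      qed
    qed
    also have "\<dots> = w n * d n" unfolding w_eq by (rule sum_distrib_right[symmetric])
    finally show ?case unfolding s_def[symmetric] eq .
  qed
  moreover have "(\<lambda>n. w n * d n) \<longlonglongrightarrow> 0" using tendsto_mult[OF w d] by simp
  ultimately have "(\<lambda>n. boot_variance n - w n * (F0 t * (1 - F0 t))) \<longlonglongrightarrow> 0"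
    by (rule Lim_null_comparison)
  from tendsto_add[OF this tendsto_mult_right[OF w, of "F0 t * (1 - F0 t)"]]
  show ?thesis by (simp add: W_def mult_ac)
qed

lemma bootstrap_indicators_eq: "bootstrap_indicators K (h n) n T \<Delta> = bernoulli_product (boot_prob n) n"
  by (simp add: bootstrap_indicators_def bernoulli_product_def)

text \<open>Three errors add up: the linearization on the event of moderate bootstrap noise, the
  probability of its complement, and the Gaussian comparison for the linear term.\<close>

lemma char_bootstrap_law_bound:
  assumes "regular n" and small: "s\<^sup>2 * (max_coefficient n)\<^sup>2 \<le> 2"
  shows "cmod (char (bootstrap_law K (h n) t n T \<Delta>) s - exp (- (s\<^sup>2 * boot_variance n / 2)))
     \<le> \<bar>s\<bar> * remainder n + 2 * (2 * (real n + 1)\<^sup>2 * exp (- 2 * (ln (real n))\<^sup>2))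
        + (\<bar>s\<bar> ^ 3 * max_coefficient n + s ^ 4 * (max_coefficient n)\<^sup>2) * boot_variance n"
proof -
  interpret regular_path T \<Delta> F0 g K h t c \<eta> \<delta> L n using assms(1) by (rule regular_pathI)
  define q where "q = bernoulli_product (boot_prob n) n"
  have p: "boot_prob n i \<in> {0..1}" if "i < n" for i using smle.F_nonneg smle.F_le_1 by simp
  define A where "A = {\<Delta>'. rank_deviation_le n T (\<lambda>i. of_bool (\<Delta>' i) - boot_prob n i) (ln (real n))}"
  define Z where "Z \<Delta>' = real n powr (2/5) * (smle K (h n) n T \<Delta>' t - kernel_smooth K (h n) (smle K (h n) n T \<Delta>) t)" for \<Delta>'
  define Z' where "Z' \<Delta>' = (\<Sum>i<n. coefficient n i * (of_bool (\<Delta>' i) - boot_prob n i))" for \<Delta>'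
  have hlow: "0 < c / 2 * scale n" using c n_pos by simp
  have C0: "0 \<le> kernel_bound / \<delta> + 2 * slope_const" using kernel_bound(1) \<delta> slope_const by simp
  have "0 \<le> 2 * L * (2 * c * scale n) + 2 * ((2 * L + 3) * rate n)" using L_pos c by simp
  then have "remainder n \<ge> 0"
    unfolding remainder_def using hlow C0 slope_const excess_nonneg kernel_bound(1) \<delta> c L_pos
    by (intro mult_nonneg_nonneg add_nonneg_nonneg divide_nonneg_nonneg; linarith?) auto
  have prob: "measure_pmf.prob q (- A) \<le> 2 * (real n + 1)\<^sup>2 * exp (- 2 * (ln (real n))\<^sup>2)"
  proof -
    have "measure_pmf.prob q {\<Delta>' \<in> space (measure_pmf q). \<not> rank_deviation_le n T (\<lambda>i. of_bool (\<Delta>' i) - boot_prob n i) (ln (real n))}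
       \<le> 2 * (real n + 1)\<^sup>2 * exp (- 2 * (ln (real n))\<^sup>2)"
    proof (rule prob_space.prob_not_rank_deviation_le(2)[OF measure_pmf.prob_space_axioms inj])
      show "prob_space.indep_vars (measure_pmf q) (\<lambda>_. borel) (\<lambda>i \<Delta>'. of_bool (\<Delta>' i) :: real) {..<n}"
        unfolding q_def by (rule indep_vars_bernoulli_product) (rule p)
      show "measure_pmf.expectation q (\<lambda>\<Delta>'. of_bool (\<Delta>' i)) = boot_prob n i" if "i < n" for i
        unfolding q_def using expectation_bernoulli_product[of n "boot_prob n" i of_bool] p that by simp
    qed (auto simp: ln_nonneg)
    then show ?thesis by (simp add: A_def Collect_neg_eq[symmetric])
  qed
  have close: "\<bar>Z \<Delta>' - Z' \<Delta>'\<bar> \<le> remainder n" if "\<Delta>' \<in> A" for \<Delta>'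
  proof -
    have dev': "rank_deviation_le n T (\<lambda>i. of_bool (\<Delta>' i) - boot_prob n i) (ln (real n))" using that by (simp add: A_def)
    have "Z' \<Delta>' = real n powr (2/5) * ((\<Sum>i<n. kernel_weight n (T i) * (of_bool (\<Delta>' i) - boot_prob n i)) / real n)"
      by (simp add: Z'_def coefficient_def sum_distrib_left sum_divide_distrib mult_ac)
    then have "\<bar>Z \<Delta>' - Z' \<Delta>'\<bar> = real n powr (2/5) *
       \<bar>(smle K (h n) n T \<Delta>' t - kernel_smooth K (h n) (smle K (h n) n T \<Delta>) t)
         - (\<Sum>i<n. kernel_weight n (T i) * (of_bool (\<Delta>' i) - boot_prob n i)) / real n\<bar>"
      unfolding Z_def by (simp only: right_diff_distrib[symmetric] abs_mult) simp
    also have "\<dots> \<le> real n powr (2/5) *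
       (8 * ((kernel_bound / \<delta> + 2 * slope_const) / h n) * (2 * L * h n + 2 * ((2 * L + 3) * rate n)) * gap n
         + 2 * slope_const / h n * excess n / real n)"
      by (intro mult_left_mono bootstrap_linearization dev') simp
    also have "\<dots> \<le> remainder n"
      unfolding remainder_def
    proof (intro mult_left_mono add_mono)
      show "8 * ((kernel_bound / \<delta> + 2 * slope_const) / h n) * (2 * L * h n + 2 * ((2 * L + 3) * rate n)) * gap n
         \<le> 8 * ((kernel_bound / \<delta> + 2 * slope_const) / (c / 2 * scale n))
            * (2 * L * (2 * c * scale n) + 2 * ((2 * L + 3) * rate n)) * gap n"
      proof (rule mult_right_mono[OF mult_mono])
        show "8 * ((kernel_bound / \<delta> + 2 * slope_const) / h n) \<le> 8 * ((kernel_bound / \<delta> + 2 * slope_const) / (c / 2 * scale n))"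
          using h_bounds(1) hlow C0 by (intro mult_left_mono frac_le) auto
        have "2 * L * h n \<le> 2 * L * (2 * c * scale n)" using h_bounds(2) L_pos by (intro mult_left_mono) auto
        then show "2 * L * h n + 2 * ((2 * L + 3) * rate n) \<le> 2 * L * (2 * c * scale n) + 2 * ((2 * L + 3) * rate n)"
          by simp
        have "0 \<le> 2 * L * h n" "0 \<le> 2 * ((2 * L + 3) * rate n)" using L_pos h_bounds(3) rate_pos by simp_all
        then show "0 \<le> 2 * L * h n + 2 * ((2 * L + 3) * rate n)" by linarith
        show "0 \<le> 8 * ((kernel_bound / \<delta> + 2 * slope_const) / (c / 2 * scale n))"
          using hlow C0 c by (intro mult_nonneg_nonneg divide_nonneg_nonneg) auto
      qed simp
      show "2 * slope_const / h n * excess n / real n \<le> 2 * slope_const / (c / 2 * scale n) * excess n / real n"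
        using h_bounds(1) hlow slope_const excess_nonneg
        by (intro divide_right_mono mult_right_mono frac_le) auto
    qed simp
    finally show ?thesis .
  qed
  have coef: "\<bar>coefficient n i\<bar> \<le> max_coefficient n" if "i < n" for i
  proof (cases "T i \<in> window")
    case True
    have "\<phi> (T i) \<le> kernel_bound / (h n * \<delta>)" "0 \<le> \<phi> (T i)" using \<phi>_range[OF True] by auto
    moreover have "kernel_bound / (h n * \<delta>) \<le> kernel_bound / (c / 2 * scale n * \<delta>)"
      using h_bounds(1) hlow kernel_bound(1) \<delta> by (intro frac_le mult_right_mono) auto
    ultimately have "\<bar>\<phi> (T i)\<bar> \<le> kernel_bound / (c / 2 * scale n * \<delta>)" by linarith
    then have "real n powr (2/5) / real n * \<bar>\<phi> (T i)\<bar> \<le> max_coefficient n"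
      unfolding max_coefficient_def by (rule mult_left_mono) simp
    then show ?thesis by (simp add: coefficient_def abs_mult)
  next
    case False
    then have "\<phi> (T i) = 0" by (intro \<phi>_zero) auto
    moreover have "0 \<le> max_coefficient n"
      unfolding max_coefficient_def using hlow kernel_bound(1) \<delta> c
      by (intro mult_nonneg_nonneg divide_nonneg_nonneg; linarith?) auto
    ultimately show ?thesis by (simp add: coefficient_def)
  qed
  have law: "bootstrap_law K (h n) t n T \<Delta> = distr (measure_pmf q) borel Z"
    unfolding bootstrap_law_def bootstrap_indicators_eq q_def Z_def[abs_def] ..
  have "cmod (char (distr (measure_pmf q) borel Z) s - char (distr (measure_pmf q) borel Z') s)
      \<le> \<bar>s\<bar> * remainder n + 2 * measure_pmf.prob q (- A)"
    by (rule char_diff_le) (use close \<open>remainder n \<ge> 0\<close> in auto)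
  moreover have "cmod (char (distr (measure_pmf q) borel Z') s - exp (- (s\<^sup>2 * boot_variance n / 2)))
      \<le> (\<bar>s\<bar> ^ 3 * max_coefficient n + s ^ 4 * (max_coefficient n)\<^sup>2) * boot_variance n"
    unfolding q_def Z'_def[abs_def]
    by (rule char_bernoulli_sum[OF p coef _ small]) (auto simp: boot_variance_def)
  ultimately show ?thesis
    unfolding law using prob
      norm_triangle_ineq[of "char (distr (measure_pmf q) borel Z) s - char (distr (measure_pmf q) borel Z') s"
        "char (distr (measure_pmf q) borel Z') s - complex_of_real (exp (- (s\<^sup>2 * boot_variance n / 2)))"]
    by simp
qed

theorem bootstrap_law_weak_conv:
  "weak_conv_m (\<lambda>n. bootstrap_law K (h n) t n T \<Delta>)
     (density lborel (normal_density 0 (sqrt (F0 t * (1 - F0 t) / (c * g t) * (LINT u|lborel. (K u)\<^sup>2)))))"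
proof -
  define v where "v = F0 t * (1 - F0 t) / (c * g t) * (LINT u|lborel. (K u)\<^sup>2)"
  have v: "0 < v" unfolding v_def using F0_t c g_t_pos integral_K_sq_pos by (intro mult_pos_pos divide_pos_pos) auto
  have "weak_conv_m (\<lambda>n. bootstrap_law K (h n) t n T \<Delta>) (density lborel (normal_density 0 (sqrt v)))"
  proof (rule levy_continuity)
    \<comment> \<open>Levy's theorem asks for this at every \<open>n\<close>, also where
      \<open>regular\<close> fails.\<close>
    show "real_distribution (bootstrap_law K (h n) t n T \<Delta>)" for n
      unfolding bootstrap_law_def by (intro prob_space.real_distribution_distr measure_pmf.prob_space_axioms) simp
    show "real_distribution (density lborel (normal_density 0 (sqrt v)))"
      unfolding real_distribution_def real_distribution_axioms_def
      using prob_space_normal_density[of "sqrt v" 0] v by simp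
    fix s :: real
    define B where "B n = \<bar>s\<bar> * remainder n + 2 * (2 * (real n + 1)\<^sup>2 * exp (- 2 * (ln (real n))\<^sup>2))
        + (\<bar>s\<bar> ^ 3 * max_coefficient n + s ^ 4 * (max_coefficient n)\<^sup>2) * boot_variance n" for n
    note bv = boot_variance_tendsto[folded v_def]
    have "(\<lambda>n. s\<^sup>2 * (max_coefficient n)\<^sup>2) \<longlonglongrightarrow> s\<^sup>2 * 0\<^sup>2"
      by (intro tendsto_intros max_coefficient_tendsto)
    then have "\<forall>\<^sub>F n in sequentially. s\<^sup>2 * (max_coefficient n)\<^sup>2 < 2" by (rule order_tendstoD) simp
    with eventually_regular have bound: "\<forall>\<^sub>F n in sequentially.
        norm (char (bootstrap_law K (h n) t n T \<Delta>) s - complex_of_real (exp (- (s\<^sup>2 * boot_variance n / 2)))) \<le> B n"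
      by eventually_elim (unfold B_def, rule char_bootstrap_law_bound, auto)
    have "(\<lambda>n. 2 * (real n + 1)\<^sup>2 * exp (- 2 * (ln (real n))\<^sup>2)) \<longlonglongrightarrow> 0"
      by (rule summable_LIMSEQ_zero[OF summable_log_deviation])
    then have "B \<longlonglongrightarrow> \<bar>s\<bar> * 0 + 2 * 0 + (\<bar>s\<bar> ^ 3 * 0 + s ^ 4 * 0\<^sup>2) * v"
      unfolding B_def by (intro tendsto_intros remainder_tendsto max_coefficient_tendsto bv)
    then have "B \<longlonglongrightarrow> 0" by simp
    with bound have "(\<lambda>n. char (bootstrap_law K (h n) t n T \<Delta>) s - complex_of_real (exp (- (s\<^sup>2 * boot_variance n / 2)))) \<longlonglongrightarrow> 0"
      by (rule Lim_null_comparison)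
    moreover have "(\<lambda>n. complex_of_real (exp (- (s\<^sup>2 * boot_variance n / 2)))) \<longlonglongrightarrow> complex_of_real (exp (- (s\<^sup>2 * v / 2)))"
      by (intro tendsto_intros bv) simp
    ultimately have "(\<lambda>n. char (bootstrap_law K (h n) t n T \<Delta>) s) \<longlonglongrightarrow> complex_of_real (exp (- (s\<^sup>2 * v / 2)))"
      using tendsto_add by fastforce
    then show "(\<lambda>n. char (bootstrap_law K (h n) t n T \<Delta>) s) \<longlonglongrightarrow> char (density lborel (normal_density 0 (sqrt v))) s"
      using char_normal[of "sqrt v" s] v by simp
  qed
  then show ?thesis by (simp add: v_def)
qed

end

section \<open>Increments and derivatives of distribution functions\<close>

text \<open>Continuity of the derivative at \<open>t\<close> alone bounds it by
  \<open>\<bar>f' t\<bar> + 1\<close> in a neighbourhood.\<close>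

lemma C1_imp_lipschitz_near:
  fixes f :: "real \<Rightarrow> real"
  assumes f: "\<forall>\<^sub>F x in nhds t. (f has_real_derivative f' x) (at x)" and f': "isCont f' t"
  obtains e B where "0 < e" "\<And>x y. \<bar>x - t\<bar> < e \<Longrightarrow> \<bar>y - t\<bar> < e \<Longrightarrow> \<bar>f x - f y\<bar> \<le> B * \<bar>x - y\<bar>"
proof -
  obtain e1 where e1: "e1 > 0" "\<And>x. dist x t < e1 \<Longrightarrow> (f has_real_derivative f' x) (at x)"
    using f unfolding eventually_nhds_metric by blast
  obtain e2 where e2: "e2 > 0" "\<And>x. dist x t < e2 \<Longrightarrow> dist (f' x) (f' t) < 1"
    using f' unfolding continuous_at_eps_delta by (metis zero_less_one)
  define e where "e = min e1 e2"
  show ?thesis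
  proof (rule that[of e "\<bar>f' t\<bar> + 1"])
    show "0 < e" using e1 e2 by (simp add: e_def)
    fix x y assume xy: "\<bar>x - t\<bar> < e" "\<bar>y - t\<bar> < e"
    have "norm (f x - f y) \<le> (\<bar>f' t\<bar> + 1) * norm (x - y)"
    proof (rule field_differentiable_bound[where S = "ball t e" and f' = f'])
      fix z assume "z \<in> ball t e"
      then have z: "dist z t < e1" "dist z t < e2" by (auto simp: e_def dist_commute)
      show "(f has_field_derivative f' z) (at z within ball t e)"
        using e1(2)[OF z(1)] by (rule has_field_derivative_at_within)
      show "norm (f' z) \<le> \<bar>f' t\<bar> + 1" using e2(2)[OF z(2)] by (auto simp: dist_real_def)
    qed (use xy in \<open>auto simp: dist_real_def\<close>)
    then show "\<bar>f x - f y\<bar> \<le> (\<bar>f' t\<bar> + 1) * \<bar>x - y\<bar>" by simp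
  qed
qed

text \<open>The second difference is \<open>\<integral>\<^sub>0\<^sup>d (f (x + s) - f (x - s)) ds\<close>.\<close>
lemma second_difference_le:
  fixes F f :: "real \<Rightarrow> real"
  assumes F: "\<And>y. \<bar>y - x\<bar> \<le> e \<Longrightarrow> (F has_real_derivative f y) (at y)"
    and f: "\<And>y z. \<bar>y - x\<bar> \<le> e \<Longrightarrow> \<bar>z - x\<bar> \<le> e \<Longrightarrow> \<bar>f y - f z\<bar> \<le> B * \<bar>y - z\<bar>"
    and d: "\<bar>d\<bar> \<le> e"
  shows "\<bar>F (x + d) + F (x - d) - 2 * F x\<bar> \<le> 2 * B * d\<^sup>2"
proof -
  have main: "\<bar>F (x + d) + F (x - d) - 2 * F x\<bar> \<le> 2 * B * d\<^sup>2" if d: "0 \<le> d" "d \<le> e" for d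
  proof -
    have "norm ((F (x + d) + F (x - d)) - (F (x + 0) + F (x - 0))) \<le> (2 * B * d) * norm (d - 0)"
    proof (rule field_differentiable_bound[where S = "{0..d}" and f' = "\<lambda>s. f (x + s) - f (x - s)"])
      fix s assume s: "s \<in> {0..d}"
      have "(F has_real_derivative f (x + s)) (at (x + s))" "(F has_real_derivative f (x - s)) (at (x - s))"
        using s d by (auto intro!: F)
      then have der: "((\<lambda>s. F (x + s) + F (x - s)) has_real_derivative f (x + s) * 1 + f (x - s) * (-1)) (at s)"
        by (intro DERIV_add DERIV_chain2[of F] derivative_eq_intros) auto
      have eq: "f (x + s) * 1 + f (x - s) * (-1) = f (x + s) - f (x - s)" by simp
      show "((\<lambda>s. F (x + s) + F (x - s)) has_field_derivative f (x + s) - f (x - s)) (at s within {0..d})"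
        using has_field_derivative_at_within[OF der] unfolding eq .
      have "\<bar>f (x + s) - f (x - s)\<bar> \<le> B * \<bar>(x + s) - (x - s)\<bar>" using s d by (intro f) auto
      also have "\<dots> = 2 * B * s" using s by simp
      also have "\<dots> \<le> 2 * B * d"
      \<comment> \<open>The sign of \<open>B\<close> is not assumed: if \<open>s\<close> differs
        from \<open>d\<close>, then \<open>d\<close> is positive and the Lipschitz bound at two
        distinct points forces \<open>0 \<le> B\<close>.\<close>
      proof (cases "s = d")
        case False
        then have "0 < d" using s by simp
        have "0 \<le> B" using f[of x "x + d"] \<open>0 < d\<close> d
          by (smt (verit) mult_neg_pos)
        then show ?thesis using s by (simp add: mult_left_mono)
      qed simp
      finally show "norm (f (x + s) - f (x - s)) \<le> 2 * B * d" by simp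
    qed (use d in auto)
    then show ?thesis using d by (simp add: power2_eq_square mult_ac)
  qed
  show ?thesis
  proof (cases "0 \<le> d")
    case False
    then show ?thesis using main[of "- d"] d by (simp add: add.commute)
  qed (use main[of d] assms(3) in auto)
qed

lemma cdf_increment_eq_integral:
  assumes P: "prob_space P" and X: "distributed P lborel X f" and f: "\<And>x. 0 \<le> f x" and xy: "x \<le> y"
  shows "cdf (distr P borel X) y - cdf (distr P borel X) x = (LINT u:{x..y}|lborel. f u)"
    and "set_integrable lborel {x..y} f"
proof -
  interpret prob_space P by fact
  have dens: "distr P borel X = density lborel (\<lambda>x. ennreal (f x))"
    using distributed_distr_eq_density[OF X] by (simp cong: distr_cong)
  have [measurable]: "f \<in> borel_measurable borel"
    using distributed_real_measurable[OF _ X] f by simp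
  have rv: "random_variable borel X" using distributed_measurable[OF X] by simp
  interpret D: real_distribution "distr P borel X" using rv by (rule real_distribution_distr)
  have int: "integrable lborel f"
    using distributed_integrable[OF X _ f, of "\<lambda>_. 1"] by simp
  then show "set_integrable lborel {x..y} f"
    unfolding set_integrable_def by (intro integrable_mult_indicator) auto
  have "cdf (distr P borel X) y - cdf (distr P borel X) x = measure (distr P borel X) {x<..y}"
    using D.cdf_diff_eq[of x y] xy by (cases "x = y") auto
  also have "\<dots> = (LINT u|distr P borel X. indicator {x<..y} u)" by simp
  also have "\<dots> = (LINT u|lborel. f u * indicator {x<..y} u)"
    unfolding dens by (subst integral_density) (use f in auto)
  also have "\<dots> = (LINT u|lborel. indicator {x..y} u * f u)"
  proof (rule integral_cong_AE)
    show "AE u in lborel. f u * indicator {x<..y} u = indicator {x..y} u * f u"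
      using AE_lborel_singleton[of x] by eventually_elim (use xy in \<open>auto simp: indicator_def\<close>)
  qed auto
  finally show "cdf (distr P borel X) y - cdf (distr P borel X) x = (LINT u:{x..y}|lborel. f u)"
    by (simp add: set_lebesgue_integral_def)
qed

text \<open>Continuity of \<open>f\<close> is known only on \<open>{0..M}\<close>, so the
  fundamental theorem is applied to the integral from 0 and yields a two-sided derivative at
  interior points.\<close>

lemma density_has_derivative:
  fixes F f :: "real \<Rightarrow> real"
  assumes F: "\<And>x y. 0 \<le> x \<Longrightarrow> x \<le> y \<Longrightarrow> y \<le> M \<Longrightarrow> F y - F x = (LINT u:{x..y}|lborel. f u)"
    and f: "continuous_on {0..M} f" and x: "0 < x" "x < M"
  shows "(F has_real_derivative f x) (at x)"
proof -
  have eq: "F y = F 0 + integral {0..y} f" if "y \<in> {0..M}" for y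
  proof -
    have "set_integrable lborel {0..y} f"
      using borel_integrable_compact[of "{0..y}" f] continuous_on_subset[OF f, of "{0..y}"] that
      unfolding set_integrable_def by (simp add: indicator_def if_distrib cong: if_cong)
    then have "(LINT u:{0..y}|lborel. f u) = integral {0..y} f"
      using set_borel_integral_eq_integral(2) by blast
    then show ?thesis using F[of 0 y] that by simp
  qed
  have "((\<lambda>y. integral {0..y} f) has_real_derivative f x) (at x within {0..M})"
    using integral_has_real_derivative[OF f] x by simp
  then have "((\<lambda>y. integral {0..y} f) has_real_derivative f x) (at x)"
    using x by (simp add: at_within_Icc_at)
  then have "((\<lambda>y. F 0 + integral {0..y} f) has_real_derivative f x) (at x)"
    by (auto intro!: derivative_eq_intros)
  then show ?thesis
  proof (rule has_field_derivative_transform_within_open[of _ _ _ "{0<..<M}"])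
    show "F 0 + integral {0..y} f = F y" if "y \<in> {0<..<M}" for y
      by (rule eq[symmetric]) (use that in auto)
  qed (use x in auto)
qed

theorem theorem2p1:
  fixes P :: "'a measure" and X T :: "nat \<Rightarrow> 'a \<Rightarrow> real"
    and F0 f0 g g' K :: "real \<Rightarrow> real" and h :: "nat \<Rightarrow> real" and M t c :: real
  assumes "prob_space P" and "0 < M"
    and "prob_space.indep_vars P (\<lambda>_. borel) X UNIV"
    and "prob_space.indep_vars P (\<lambda>_. borel) T UNIV"
    and "prob_space.indep_var P
           (\<Pi>\<^sub>M i\<in>UNIV. borel) (\<lambda>\<omega> i. X i \<omega>) (\<Pi>\<^sub>M i\<in>UNIV. borel) (\<lambda>\<omega> i. T i \<omega>)"
    and "\<And>i. cdf (distr P borel (X i)) = F0"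
    and "\<And>i. measure_support (distr P borel (X i)) = {0..M}"
    and "\<And>i. distributed P lborel (X i) f0" and "\<And>x. 0 \<le> f0 x"
    and "continuous_on {0..M} f0"
    and "\<exists>\<epsilon>>0. \<forall>x\<in>{0..M}. \<epsilon> \<le> f0 x"
    and "\<And>i. distributed P lborel (T i) g" and "\<And>x. 0 \<le> g x"
    and "{0..M} \<subseteq> closure {x. g x \<noteq> 0}"
    and "\<exists>\<epsilon>>0. \<forall>x\<in>{0..M}. \<epsilon> \<le> g x"
    and "\<And>x. x \<in> {0..M} \<Longrightarrow> (g has_real_derivative g' x) (at x within {0..M})"
    and "bounded (g' ` {0..M})"
    and "smoothing_kernel K"
    and "t \<in> {0<..<M}"
    and "\<exists>f0'. (\<forall>\<^sub>F x in nhds t. (f0 has_real_derivative f0' x) (at x)) \<and> isCont f0' t"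
    and "0 < c"
    and "asymp_equiv h sequentially (\<lambda>n. c * real n powr (-1/5))"
  defines "\<sigma> \<equiv> sqrt (F0 t * (1 - F0 t) / (c * g t) * (LINT u|lborel. (K u)\<^sup>2))"
  shows "AE \<omega> in P.
    weak_conv_m
      (\<lambda>n. bootstrap_law K (h n) t n (\<lambda>i. T i \<omega>) (\<lambda>i. X i \<omega> \<le> T i \<omega>))
      (density lborel (normal_density 0 \<sigma>))"
proof -
  interpret prob_space P by fact
  note X = assms(3) and T = assms(4) and XT = assms(5) and F0 = assms(6) and X_dens = assms(8) and f0_nonneg = assms(9)
    and f0_cont = assms(10) and T_dens = assms(12) and g_nonneg = assms(13) and g_deriv = assms(16) and t = assms(19)
  have rvX: "X i \<in> borel_measurable P" for i
    using X by (auto simp: indep_vars_def)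
  obtain \<epsilon>1 where \<epsilon>1: "0 < \<epsilon>1" "\<And>x. x \<in> {0..M} \<Longrightarrow> \<epsilon>1 \<le> f0 x" using assms(11) by blast
  obtain \<epsilon>2 where \<epsilon>2: "0 < \<epsilon>2" "\<And>x. x \<in> {0..M} \<Longrightarrow> \<epsilon>2 \<le> g x" using assms(15) by blast
  obtain e B where e: "0 < e" and f0_lip: "\<And>x y. \<bar>x - t\<bar> < e \<Longrightarrow> \<bar>y - t\<bar> < e \<Longrightarrow> \<bar>f0 x - f0 y\<bar> \<le> B * \<bar>x - y\<bar>"
  proof -
    obtain f0' where f0': "\<forall>\<^sub>F x in nhds t. (f0 has_real_derivative f0' x) (at x)" "isCont f0' t"
      using assms(20) by blast
    show ?thesis by (rule C1_imp_lipschitz_near[OF f0']) (rule that)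
  qed
  have "bounded (f0 ` {0..M})" using f0_cont by (intro compact_imp_bounded compact_continuous_image) auto
  then obtain Bf where "\<forall>x\<in>{0..M}. \<bar>f0 x\<bar> \<le> Bf" unfolding bounded_iff by auto
  then have Bf: "\<bar>f0 x\<bar> \<le> Bf" if "x \<in> {0..M}" for x using that by blast
  have "continuous_on {0..M} g" using g_deriv by (meson DERIV_continuous_on)
  then have "bounded (g ` {0..M})" by (intro compact_imp_bounded compact_continuous_image) auto
  then obtain Bg where "\<forall>x\<in>{0..M}. \<bar>g x\<bar> \<le> Bg" unfolding bounded_iff by auto
  then have Bg: "\<bar>g x\<bar> \<le> Bg" if "x \<in> {0..M}" for x using that by blast
  obtain Bg' where "\<forall>x\<in>{0..M}. \<bar>g' x\<bar> \<le> Bg'" using assms(17) unfolding bounded_iff by auto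
  then have Bg': "\<bar>g' x\<bar> \<le> Bg'" if "x \<in> {0..M}" for x using that by blast
  have g_lip: "\<bar>g x - g y\<bar> \<le> Bg' * \<bar>x - y\<bar>" if "x \<in> {0..M}" "y \<in> {0..M}" for x y
    using field_differentiable_bound[of "{0..M}" g g' Bg' x y] g_deriv Bg' that by auto
  \<comment> \<open>An eighth of each distance keeps the radius \<open>4 * \<eta>\<close> around
    \<open>t\<close> inside \<open>{0..M}\<close>, and the radius \<open>3 * \<eta>\<close> reached
    by second differences inside the region where \<open>f0\<close> is Lipschitz.\<close>
  define \<eta> where "\<eta> = Min {t / 8, (M - t) / 8, e / 8}"
  have "0 < \<eta>" using t e by (simp add: \<eta>_def)
  have \<eta>_le: "\<eta> \<le> t / 8" "\<eta> \<le> (M - t) / 8" "\<eta> \<le> e / 8" unfolding \<eta>_def by (rule Min_le; simp)+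
  have in_range: "x \<in> {0..M}" if "\<bar>x - t\<bar> \<le> 4 * \<eta>" for x
  proof -
    have "4 * \<eta> \<le> t" "4 * \<eta> \<le> M - t" using \<eta>_le t by auto
    then show ?thesis using that by auto
  qed
  define \<delta> where "\<delta> = min \<epsilon>1 \<epsilon>2"
  define L where "L = max (max Bf Bg) (max Bg' (2 * B))"
  have L: "Bf \<le> L" "Bg \<le> L" "Bg' \<le> L" "2 * B \<le> L" by (auto simp: L_def)
  have "0 < \<delta>" using \<epsilon>1 \<epsilon>2 by (simp add: \<delta>_def)
  have t_in: "t \<in> {0..M}" using t by simp
  have "0 \<le> Bg" using Bg[OF t_in] by linarith
  then have "0 \<le> L" using L(2) by linarith
  have [measurable]: "g \<in> borel_measurable borel"
    using distributed_real_measurable[OF _ T_dens] g_nonneg by simp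
  interpret X0: real_distribution "distr P borel (X 0)" using rvX by (rule real_distribution_distr)
  have F0_eq: "F0 = cdf (distr P borel (X 0))" using F0 by simp
  have F0_inc: "F0 y - F0 x = (LINT u:{x..y}|lborel. f0 u)" "set_integrable lborel {x..y} f0" if "x \<le> y" for x y
    using cdf_increment_eq_integral[OF assms(1) X_dens[of 0] f0_nonneg that] by (auto simp: F0_eq)
  have F0_lower: "\<epsilon>1 * (y - x) \<le> F0 y - F0 x" and F0_upper: "F0 y - F0 x \<le> Bf * (y - x)"
    if "0 \<le> x" "x \<le> y" "y \<le> M" for x y
  proof -
    have "\<epsilon>1 \<le> f0 u" "f0 u \<le> Bf" if "u \<in> {x..y}" for u
      using \<epsilon>1(2)[of u] Bf[of u] that \<open>0 \<le> x\<close> \<open>y \<le> M\<close> by auto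
    from set_integral_bounds[OF F0_inc(2)[OF that(2)] that(2) this]
    show "\<epsilon>1 * (y - x) \<le> F0 y - F0 x" "F0 y - F0 x \<le> Bf * (y - x)"
      unfolding F0_inc(1)[OF that(2)] by auto
  qed
  have F0_deriv: "(F0 has_real_derivative f0 x) (at x)" if "0 < x" "x < M" for x
    using density_has_derivative[OF F0_inc(1) f0_cont that] by simp
  have F0_range: "0 \<le> F0 x" "F0 x \<le> 1" for x
    unfolding F0_eq by (auto intro: X0.cdf_nonneg X0.cdf_bounded_prob)
  have "mono F0" unfolding F0_eq by (auto intro!: monoI X0.cdf_nondecreasing)
  \<comment> \<open>The density bound puts positive mass on both sides of \<open>t\<close>.\<close>
  have F0_t: "0 < F0 t" "F0 t < 1"
  proof -
    have "0 < \<epsilon>1 * (t - 0)" "0 < \<epsilon>1 * (M - t)" using \<epsilon>1(1) t by auto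
    then show "0 < F0 t" "F0 t < 1"
      using F0_lower[of 0 t] F0_lower[of t M] F0_range(1)[of 0] F0_range(2)[of M] t by auto
  qed
  define G where "G = cdf (distr P borel (T 0))"
  have G: "cdf (distr P borel (T i)) = G" for i
  proof -
    have "distr P borel (T j) = density lborel g" for j
      using distributed_distr_eq_density[OF T_dens[of j]] by (simp cong: distr_cong)
    then show ?thesis by (simp add: G_def)
  qed
  have G_inc: "G y - G x = (LINT u:{x..y}|lborel. g u)" "set_integrable lborel {x..y} g" if "x \<le> y" for x y
    using cdf_increment_eq_integral[OF assms(1) T_dens[of 0] g_nonneg that] by (auto simp: G_def)
  have G_lip: "G y - G x \<le> L * (y - x)" if "t - 4 * \<eta> \<le> x" "x \<le> y" "y \<le> t + 4 * \<eta>" for x y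
  proof -
    have "g u \<le> L" if "u \<in> {x..y}" for u
      using Bg[OF in_range, of u] L(2) that \<open>t - 4 * \<eta> \<le> x\<close> \<open>y \<le> t + 4 * \<eta>\<close> by (auto simp: abs_le_iff)
    then show ?thesis
      using set_integral_bounds(2)[OF G_inc(2)[OF that(2)] that(2), of 0 L] g_nonneg G_inc(1)[OF that(2)] by simp
  qed
  have ae1: "AE \<omega> in P. \<forall>\<^sub>F n in sequentially. \<forall>x\<in>{t - 4 * \<eta>..t + 4 * \<eta>}.
     \<bar>real (count_le n (\<lambda>i. T i \<omega>) x) - real n * G x\<bar>
       \<le> ln (real n) * sqrt (real n) + L * ((t + 4 * \<eta>) - (t - 4 * \<eta>))"
    by (rule AE_count_close[OF T G]) (use G_lip \<open>0 < \<eta>\<close> \<open>0 \<le> L\<close> in auto)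
  note ae2 = AE_rank_deviation[OF X XT F0]
  note ae3 = AE_inj_times[OF T T_dens]
  \<comment> \<open>The factor 2 accounts for the errors at both ends of an interval;
    \<open>ln n * n powr (-1/2)\<close> is eventually below \<open>n powr (-9/20)\<close>.\<close>
  have small: "\<forall>\<^sub>F n in sequentially. 2 * (ln (real n) * sqrt (real n) + L * (8 * \<eta>)) / real n \<le> real n powr (-9/20)"
    by real_asymp
  from ae1 ae2 ae3 show ?thesis
  \<comment> \<open>On the intersection of the three almost sure events the convergence is a
    deterministic statement about one data sequence.\<close>
  proof eventually_elim
    case (elim \<omega>)
    let ?T = "\<lambda>i. T i \<omega>" and ?\<Delta> = "\<lambda>i. X i \<omega> \<le> T i \<omega>"
    have inj: "inj ?T" by (rule elim)
    interpret current_status_path ?T ?\<Delta> F0 g K h t c \<eta> \<delta> L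
    proof
      show "inj ?T" "0 < \<eta>" "0 < \<delta>" "0 < c" "mono F0" "smoothing_kernel K" "0 < F0 t" "F0 t < 1"
        "h \<sim>[sequentially] (\<lambda>n. c * real n powr (-1/5))" "g \<in> borel_measurable borel"
        by fact+
      show "0 \<le> F0 x" "F0 x \<le> 1" for x by (rule F0_range)+
      show "\<delta> * (y - x) \<le> F0 y - F0 x" "F0 y - F0 x \<le> L * (y - x)"
        if "t - 4 * \<eta> \<le> x" "x \<le> y" "y \<le> t + 4 * \<eta>" for x y
      proof -
        have xy: "0 \<le> x" "y \<le> M" using in_range[of x] in_range[of y] that by auto
        have "\<delta> * (y - x) \<le> \<epsilon>1 * (y - x)" "Bf * (y - x) \<le> L * (y - x)"
          using that(2) L(1) by (auto intro!: mult_right_mono simp: \<delta>_def)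
        then show "\<delta> * (y - x) \<le> F0 y - F0 x" "F0 y - F0 x \<le> L * (y - x)"
          using F0_lower[OF xy(1) that(2) xy(2)] F0_upper[OF xy(1) that(2) xy(2)] by linarith+
      qed
      show "\<bar>F0 (x + d) + F0 (x - d) - 2 * F0 x\<bar> \<le> L * d\<^sup>2" if "\<bar>x - t\<bar> \<le> 2 * \<eta>" "\<bar>d\<bar> \<le> \<eta>" for x d
      proof -
        have near: "0 < y" "y < M" "\<bar>y - t\<bar> < e" if "\<bar>y - x\<bar> \<le> \<eta>" for y
          using that \<open>\<bar>x - t\<bar> \<le> 2 * \<eta>\<close> \<eta>_le t e by auto
        have "\<bar>F0 (x + d) + F0 (x - d) - 2 * F0 x\<bar> \<le> 2 * B * d\<^sup>2"
          by (rule second_difference_le[OF _ _ that(2), where f = f0]) (auto intro!: F0_deriv f0_lip near)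
        also have "\<dots> \<le> L * d\<^sup>2" using L(4) by (intro mult_right_mono) auto
        finally show ?thesis .
      qed
      show "\<delta> \<le> g x" "g x \<le> L" if "\<bar>x - t\<bar> \<le> 4 * \<eta>" for x
        using \<epsilon>2(2)[OF in_range[OF that]] Bg[OF in_range[OF that]] L(2) by (auto simp: \<delta>_def abs_le_iff)
      show "\<bar>g x - g y\<bar> \<le> L * \<bar>x - y\<bar>" if "\<bar>x - t\<bar> \<le> 4 * \<eta>" "\<bar>y - t\<bar> \<le> 4 * \<eta>" for x y
        by (rule order_trans[OF g_lip[OF in_range[OF that(1)] in_range[OF that(2)]] mult_right_mono[OF L(3)]]) simp
      show "\<forall>\<^sub>F n in sequentially. rank_deviation_le n ?T (\<lambda>i. of_bool (?\<Delta> i) - F0 (?T i)) (ln (real n))"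
        using elim(2) by eventually_elim (use inj_on_subset[OF inj] in auto)
      show "\<forall>\<^sub>F n in sequentially. \<forall>x\<ge>t - 4 * \<eta>. \<forall>y\<le>t + 4 * \<eta>. x \<le> y \<longrightarrow>
         empirical_error n ?T g x y \<le> real n powr (-9/20)"
        using elim(1) small eventually_gt_at_top[of 0]
      proof eventually_elim
        case (elim n)
        show ?case
        proof (intro allI impI)
          fix x y assume xy: "t - 4 * \<eta> \<le> x" "y \<le> t + 4 * \<eta>" "x \<le> y"
          define R where "R = ln (real n) * sqrt (real n) + L * (8 * \<eta>)"
          have "\<bar>real (count_le n ?T x) - real n * G x\<bar> \<le> R" "\<bar>real (count_le n ?T y) - real n * G y\<bar> \<le> R"
            using elim(1) xy by (auto simp: R_def)
          then have "\<bar>(real (count_le n ?T y) - real (count_le n ?T x)) - real n * (G y - G x)\<bar> \<le> 2 * R"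
            unfolding right_diff_distrib by linarith
          then have "\<bar>(real (count_le n ?T y) - real (count_le n ?T x)) - real n * (G y - G x)\<bar> / real n \<le> 2 * R / real n"
            by (rule divide_right_mono) simp
          also have "\<dots> \<le> real n powr (-9/20)" using elim(2) by (simp add: R_def)
          also have "\<bar>(real (count_le n ?T y) - real (count_le n ?T x)) - real n * (G y - G x)\<bar> / real n
            = \<bar>(real (count_le n ?T y) - real (count_le n ?T x)) / real n - (G y - G x)\<bar>"
          proof -
            have "((real (count_le n ?T y) - real (count_le n ?T x)) - real n * (G y - G x)) / real n
              = (real (count_le n ?T y) - real (count_le n ?T x)) / real n - (G y - G x)"
              using elim(3) by (simp add: diff_divide_distrib)
            then show ?thesis by (metis abs_divide abs_of_nat)
          qed
          finally show "empirical_error n ?T g x y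
              \<le> real n powr (-9/20)"
            unfolding empirical_error_def G_inc(1)[OF xy(3)] .
        qed
      qed
    qed
    show ?case unfolding \<sigma>_def by (rule bootstrap_law_weak_conv)
  qed
qed

end
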